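(* Let $T$ be a rooted plane tree of depth $n\ge1$ which is not a path, and let $\mathcal B\in\mathcal K(T)$. The map $\Gamma$ induces a monoid isomorphism between the integer metric $n$-bracketings in the conical set $\tau^{\mathrm{met}}(\mathcal B)\in\mathcal K^{\mathrm{met}}(T)$ (those $(\mathcal B',\ell)$ all of whose values $\ell(A)$ are integers) and the integer points of the corresponding cone $\tau(\mathcal B)\in\mathcal F(T)$ (i.e. $\tau(\mathcal B)\cap\mathbb Z^m$).
   Context: **Trees.** A rooted plane tree $T$ is a finite rooted tree with a total order on the set $\mathrm{ch}(u)$ of children of every vertex $u$. $V^k(T)$ is the set of vertices at distance $k$ from the root; the depth of $T$ is the largest $k$ with $V^k(T)\ne\emptyset$. $V^k(T)$ is totally ordered lexicographically (compare the sequences of child-positions along the paths from the root); $u^k_i$ is its $i$-th element. $T$ has depth $n\ge1$ and is not a path. **Brackets.** For $0\le k\le n$ a $k$-bracket of $T$ is $A=(A^0,\dots,A^k)$ with $A^i\subseteq V^i(T)$, $A^k\neq\emptyset$, such that the parent of every $u\in A^i$ ($i\ge 1$) lies in $A^{i-1}$, and for every $u\in A^{i-1}$ the set $A^i\cap\mathrm{ch}(u)$ is a (possibly empty) set of consecutive elements of $\mathrm{ch}(u)$. For $k$-brackets, $A\subseteq A'$ means $A^i\subseteq A'^i$ for all $i$. For $k\ge1$, $\pi(A)=(A^0,\dots,A^{k-1})$. The singleton $k$-bracket $A(u)$ of $u\in V^k(T)$ has $A(u)^i=\{\text{the depth-}i\text{ vertex on the path from the root to }u\}$; the maximum $k$-bracket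 is $(V^0(T),\dots,V^k(T))$. A bracket is nontrivial if it is neither singleton nor maximum. **$n$-bracketings.** An $n$-bracketing $\mathcal B$ of $T$ consists of sets $\mathcal B^k$ of $k$-brackets ($0\le k\le n$) and a strict partial order $<_{\mathcal B}$ on $\bigsqcup_k\mathcal B^k$ such that, writing $\mathcal B_A=\{A'\in\mathcal B^{k}:\pi(A')=A\}$ for $A\in\mathcal B^{k-1}$: (1) $\mathcal B^k$ contains the maximum and all singleton $k$-brackets; (2) $A\in\mathcal B^k$, $k\ge1$, implies $\pi(A)\in\mathcal B^{k-1}$; (3) if $A_1,A_2\in\mathcal B^k$ and $A_1^k\cap A_2^k\ne\emptyset$ then $A_1\subseteq A_2$ or $A_2\subseteq A_1$; (4a) for $A\in\mathcal B^{k-1}$, $1\le k\le n$: $\bigcup_{A'\in\mathcal B_A}A'^k=\bigcup_{u\in A^{k-1}}\mathrm{ch}(u)$; (4b) if $A_1,A_2\in\mathcal B_A$, $A_2\subsetneq A_1$, then every $u'\in A_1^k$ lies in $A_3^k$ for some $A_3\in\mathcal B_A$ with $A_3\subsetneq A_1$; (5a) distinct elements $A_1,A_2\in\mathcal B^k$ are comparable under $<_{\mathcal B}$ iff $\pi(A_1)=\pi(A_2)$ and $A_1^k\cap A_2^k=\emptyset$ (elements of different levels are incomparable); (5b) if $u_1$ precedes $u_2$ in $\mathrm{ch}(u)$ then $A(u_1)<_{\mathcal B}A(u_2)$; (5c) if $A,\tilde A\in\mathcal B^{k-1}$, $\tilde A\subseteq A$, $A_1\ne A_2\in\mathcal B_A$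 are comparable, $\tilde A_1\ne\tilde A_2\in\mathcal B_{\tilde A}$ are comparable, and $\tilde A_i\subseteq A_i$ for $i=1,2$, then $A_1<_{\mathcal B}A_2\iff\tilde A_1<_{\mathcal B}\tilde A_2$. The categorical $n$-associahedron $\mathcal K(T)$ is the set of $n$-bracketings of $T$ ordered by: $\mathcal B_1\le\mathcal B_2$ iff $\mathcal B_1^k\subseteq\mathcal B_2^k$ for all $k$ and $<_{\mathcal B_1}$ is the restriction of $<_{\mathcal B_2}$. Its minimum $\mathcal B_{\min}$ has only singleton and maximum brackets. **Collisions.** A collision is an atom of $\mathcal K(T)$ (a minimal element of $\mathcal K(T)\setminus\{\mathcal B_{\min}\}$). The fusion bracket of a collision $\mathcal C$ is the (unique) nonsingleton bracket $E_0$ of $\mathcal C$ such that $\pi(E_0)$ is a singleton bracket and $E_0=\pi^{l}(A')$ for some nontrivial $A'$ in $\mathcal C$ and $l\ge0$. A bracket $E$ of $\mathcal C$ is essential if $E=\pi^l(A')$ for some nontrivial $A'$ in $\mathcal C$, $l\ge0$, and $\pi^j(E)=E_0$ for some $j\ge0$. **Contraction.** Let $E_0\in\mathcal C^{k_0}$, $\pi(E_0)=A(w)$, $W=E_0^{k_0}\subseteq\mathrm{ch}(w)$. The rooted plane tree $T/\mathcal C$ is obtained from $T$ by removing $W$ and all its descendants and inserting a depth-$k$ vertex $v_E$ for each essential $E\in\mathcal C^k$: $v_{E_0}$ is a child of $w$ taking the place of the consecutive set $W$; the children of $v_E$ are the $v_{E'}$ with $E'$ essential, $\pi(E')=E$,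 ordered by $<_{\mathcal C}$. The map $\psi:V(T)\to V(T/\mathcal C)$ fixes the remaining vertices and sends a depth-$k$ vertex $v$ in or below $W$ to $v_E$, where $E\in\mathcal C^k$ is the unique essential bracket with $v\in E^k$. **Velocity fan.** Put $t_k=|V^k(T)|-1$, $m=\sum_{k=1}^nt_k$; vectors in $\mathbb R^m$ have coordinates $x^k_i$, $1\le k\le n$, $1\le i\le t_k$. For a collision $\mathcal C$, $\rho(\mathcal C)^k_i=d(\psi(u^k_i))-d(\psi(u^k_{i+1}))+1$, where $d(v)$ is the position of $v$ in the ordered set $V^k(T/\mathcal C)$; $\rho(\mathcal B_{\min})=\mathbf 1$ (all ones). For $\mathcal B\in\mathcal K(T)$, $\tau(\mathcal B)=\mathrm{cone}\{\rho(\mathcal C):\mathcal C\le\mathcal B\text{ a collision}\}+\mathbb R\mathbf 1$, and $\mathcal F(T)=\{\tau(\mathcal B):\mathcal B\in\mathcal K(T)\}$. **Metric $n$-bracketings.** A metric $n$-bracketing is a pair $(\mathcal B,\ell_{\mathcal B})$ with $\mathcal B\in\mathcal K(T)$ and $\ell_{\mathcal B}$ a real function on the brackets of $T$ such that: $\ell_{\mathcal B}(A)=0$ if $A$ is not in $\mathcal B$; $\ell_{\mathcal B}(A)=0$ if $A$ is singleton; $\ell_{\mathcal B}(A)>0$ if $A$ is a nontrivial bracket of $\mathcal B$; and for every nonsingleton $\tilde A\in\mathcal B^k$ and $A,A'\in\mathcal B_{\tilde A}$ with $A$ containment-maximal in $\mathcal B_{\tilde A}$, $A'$ containment-minimal in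 $\mathcal B_{\tilde A}$ and $A'\subseteq A$, one has $\ell_{\mathcal B}(\tilde A)=\sum_{A''\in\mathcal B_{\tilde A},\,A'\subseteq A''\subseteq A}\ell_{\mathcal B}(A'')$. $\tau^{\mathrm{met}}(\mathcal B)$ is the set of metric $n$-bracketings $(\mathcal B',\ell_{\mathcal B'})$ with $\mathcal B'\le\mathcal B$, a monoid via $(\mathcal B_1,\ell_1)+(\mathcal B_2,\ell_2)=(\mathcal B_1\vee\mathcal B_2,\ell_1+\ell_2)$ with zero $(\mathcal B_{\min},0)$, and with scalar multiplication $t(\mathcal B',\ell)=(\mathcal B',t\ell)$, $t>0$. $\mathcal K^{\mathrm{met}}(T)=\{\tau^{\mathrm{met}}(\mathcal B):\mathcal B\in\mathcal K(T)\}$. For a collision $\mathcal C$, $\ell(\mathcal C)$ is the metric $n$-bracketing on $\mathcal C$ equal to $1$ on essential brackets and $0$ otherwise; $\ell(\mathcal B_{\min})$ equals $1$ on nonsingleton maximum brackets and $0$ otherwise (negative multiples allowed). Every element of $\tau^{\mathrm{met}}(\mathcal B)$ can be written $\sum_{i=0}^k\lambda_i\ell(\mathcal C_i)$ with $\mathcal C_0=\mathcal B_{\min}$, $\mathcal C_i\le\mathcal B$ collisions, $\lambda_0\in\mathbb R$, $\lambda_i\ge0$ ($i>0$), and $\Gamma$ is the well-defined map sending it to $\sum_{i=0}^k\lambda_i\rho(\mathcal C_i)$; it maps $\tau^{\mathrm{met}}(\mathcal B)$ onto $\tau(\mathcal B)$. *)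

theory Defs
  imports Complex_Main "HOL-Algebra.Group"
begin

section \<open>Rooted plane trees\<close>

text \<open>The total orders on the sets of children are given by one relation \<open>tsib\<close>, of which only the
  restrictions to sibling sets matter. By convention the root is its own parent.\<close>

record 'v plane_tree =
  tverts :: "'v set"
  troot :: 'v
  tpar :: "'v \<Rightarrow> 'v"
  tsib :: "('v \<times> 'v) set"

definition ch :: "'v plane_tree \<Rightarrow> 'v \<Rightarrow> 'v set" where
  "ch T u = {v \<in> tverts T. v \<noteq> troot T \<and> tpar T v = u}"

definition rooted_plane_tree :: "'v plane_tree \<Rightarrow> bool" where
  "rooted_plane_tree T \<longleftrightarrow>
     finite (tverts T) \<and> troot T \<in> tverts T \<and> tpar T (troot T) = troot T \<and>
     (\<forall>v \<in> tverts T. tpar T v \<in> tverts T) \<and>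
     (\<forall>v \<in> tverts T. \<exists>k. (tpar T ^^ k) v = troot T) \<and>
     (\<forall>u \<in> tverts T. strict_linear_order_on (ch T u) (Restr (tsib T) (ch T u)))"

definition rdist :: "'v plane_tree \<Rightarrow> 'v \<Rightarrow> nat" where
  "rdist T v = (LEAST k. (tpar T ^^ k) v = troot T)"

definition level :: "'v plane_tree \<Rightarrow> nat \<Rightarrow> 'v set" where
  "level T k = {v \<in> tverts T. rdist T v = k}"

definition depth :: "'v plane_tree \<Rightarrow> nat" where
  "depth T = Max {k. level T k \<noteq> {}}"

definition is_path :: "'v plane_tree \<Rightarrow> bool" where
  "is_path T \<longleftrightarrow> (\<forall>u \<in> tverts T. card (ch T u) \<le> 1)"

definition child_pos :: "'v plane_tree \<Rightarrow> 'v \<Rightarrow> nat" where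
  "child_pos T v = card {w \<in> ch T (tpar T v). (w, v) \<in> tsib T} + 1"

definition anc :: "'v plane_tree \<Rightarrow> 'v \<Rightarrow> nat \<Rightarrow> 'v" where
  "anc T v i = (tpar T ^^ (rdist T v - i)) v"
  \<comment> \<open>the depth-\<open>i\<close> vertex on the path from the root to \<open>v\<close>, for \<open>i \<le> rdist T v\<close>\<close>

definition addr :: "'v plane_tree \<Rightarrow> 'v \<Rightarrow> nat list" where
  "addr T v = map (\<lambda>i. child_pos T (anc T v i)) [1..<Suc (rdist T v)]"

definition lpos :: "'v plane_tree \<Rightarrow> 'v \<Rightarrow> nat" where
  "lpos T v = card {w \<in> level T (rdist T v). (addr T w, addr T v) \<in> lex less_than} + 1"
  \<comment> \<open>addresses of vertices of one level have equal length, where \<open>lex\<close> is the lexicographic order\<close>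

definition lvert :: "'v plane_tree \<Rightarrow> nat \<Rightarrow> nat \<Rightarrow> 'v" where
  "lvert T k i = (THE v. v \<in> level T k \<and> lpos T v = i)"


section \<open>Brackets\<close>

text \<open>A \<open>k\<close>-bracket \<open>(A\<^sup>0, \<dots>, A\<^sup>k)\<close> is a list of length \<open>k + 1\<close>: \<open>A\<^sup>i\<close> is \<open>A ! i\<close>, the top part
  \<open>A\<^sup>k\<close> is \<open>last A\<close>, and \<open>\<pi>\<close> is \<open>butlast\<close> (on lists of length at least 2).\<close>

type_synonym 'v bracket = "'v set list"

definition consecutive_in :: "'v plane_tree \<Rightarrow> 'v \<Rightarrow> 'v set \<Rightarrow> bool" where
  "consecutive_in T u S \<longleftrightarrow> S \<subseteq> ch T u \<and>
     (\<forall>x \<in> S. \<forall>z \<in> S. \<forall>y \<in> ch T u. (x, y) \<in> tsib T \<longrightarrow> (y, z) \<in> tsib T \<longrightarrow> y \<in> S)"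

definition brackets :: "'v plane_tree \<Rightarrow> nat \<Rightarrow> 'v bracket set" where
  "brackets T k = {A. length A = Suc k \<and> k \<le> depth T \<and>
     (\<forall>i \<le> k. A ! i \<subseteq> level T i) \<and> A ! k \<noteq> {} \<and>
     (\<forall>i. 1 \<le> i \<and> i \<le> k \<longrightarrow>
        (\<forall>u \<in> A ! i. tpar T u \<in> A ! (i - 1)) \<and>
        (\<forall>u \<in> A ! (i - 1). consecutive_in T u (A ! i \<inter> ch T u)))}"

definition bsub :: "'v bracket \<Rightarrow> 'v bracket \<Rightarrow> bool" (infix "\<sqsubseteq>b" 50) where
  "A \<sqsubseteq>b A' \<longleftrightarrow> list_all2 (\<subseteq>) A A'"

abbreviation bsubs :: "'v bracket \<Rightarrow> 'v bracket \<Rightarrow> bool" (infix "\<sqsubset>b" 50) where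
  "A \<sqsubset>b A' \<equiv> A \<sqsubseteq>b A' \<and> A \<noteq> A'"

definition sing_br :: "'v plane_tree \<Rightarrow> 'v \<Rightarrow> 'v bracket" where
  "sing_br T u = map (\<lambda>i. {anc T u i}) [0..<Suc (rdist T u)]"

definition max_br :: "'v plane_tree \<Rightarrow> nat \<Rightarrow> 'v bracket" where
  "max_br T k = map (level T) [0..<Suc k]"

definition is_singleton_br :: "'v plane_tree \<Rightarrow> 'v bracket \<Rightarrow> bool" where
  "is_singleton_br T A \<longleftrightarrow> (\<exists>u \<in> tverts T. A = sing_br T u)"

definition is_max_br :: "'v plane_tree \<Rightarrow> 'v bracket \<Rightarrow> bool" where
  "is_max_br T A \<longleftrightarrow> (\<exists>k \<le> depth T. A = max_br T k)"

definition nontrivial_br :: "'v plane_tree \<Rightarrow> 'v bracket \<Rightarrow> bool" where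
  "nontrivial_br T A \<longleftrightarrow> \<not> is_singleton_br T A \<and> \<not> is_max_br T A"


section \<open>The categorical associahedron\<close>

text \<open>As brackets of different levels are lists of different lengths, \<open>brs\<close> is the disjoint union
  of the sets \<open>\<B>\<^sup>k\<close>.\<close>

record 'v bracketing =
  brs :: "'v bracket set"
  bless :: "('v bracket \<times> 'v bracket) set"

definition blev :: "'v bracketing \<Rightarrow> nat \<Rightarrow> 'v bracket set" where
  "blev B k = {A \<in> brs B. length A = Suc k}"

definition bover :: "'v bracketing \<Rightarrow> 'v bracket \<Rightarrow> 'v bracket set" where
  "bover B A = {A' \<in> blev B (length A). butlast A' = A}"

definition bcomp :: "'v bracketing \<Rightarrow> 'v bracket \<Rightarrow> 'v bracket \<Rightarrow> bool" where
  "bcomp B A1 A2 \<longleftrightarrow> (A1, A2) \<in> bless B \<or> (A2, A1) \<in> bless B"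

definition n_bracketing :: "'v plane_tree \<Rightarrow> 'v bracketing \<Rightarrow> bool" where
  "n_bracketing T B \<longleftrightarrow>
     brs B \<subseteq> (\<Union>k \<le> depth T. brackets T k) \<and>
     bless B \<subseteq> brs B \<times> brs B \<and> irrefl (bless B) \<and> trans (bless B) \<and>
     (\<forall>k \<le> depth T. max_br T k \<in> brs B) \<and> (\<forall>u \<in> tverts T. sing_br T u \<in> brs B) \<and>
     (\<forall>k. \<forall>A \<in> blev B (Suc k). butlast A \<in> blev B k) \<and>
     (\<forall>k. \<forall>A1 \<in> blev B k. \<forall>A2 \<in> blev B k. last A1 \<inter> last A2 \<noteq> {} \<longrightarrow> A1 \<sqsubseteq>b A2 \<or> A2 \<sqsubseteq>b A1) \<and>
     (\<forall>k < depth T. \<forall>A \<in> blev B k. (\<Union>A' \<in> bover B A. last A') = (\<Union>u \<in> last A. ch T u)) \<and>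
     (\<forall>k < depth T. \<forall>A \<in> blev B k. \<forall>A1 \<in> bover B A. \<forall>A2 \<in> bover B A. A2 \<sqsubset>b A1 \<longrightarrow>
        (\<forall>u \<in> last A1. \<exists>A3 \<in> bover B A. A3 \<sqsubset>b A1 \<and> u \<in> last A3)) \<and>
     (\<forall>A1 \<in> brs B. \<forall>A2 \<in> brs B. A1 \<noteq> A2 \<longrightarrow>
        (bcomp B A1 A2 \<longleftrightarrow>
           length A1 = length A2 \<and> butlast A1 = butlast A2 \<and> last A1 \<inter> last A2 = {})) \<and>
     (\<forall>u \<in> tverts T. \<forall>u1 \<in> ch T u. \<forall>u2 \<in> ch T u. (u1, u2) \<in> tsib T \<longrightarrow>
        (sing_br T u1, sing_br T u2) \<in> bless B) \<and>
     (\<forall>k < depth T. \<forall>A \<in> blev B k. \<forall>A' \<in> blev B k. A' \<sqsubseteq>b A \<longrightarrow>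
        (\<forall>A1 \<in> bover B A. \<forall>A2 \<in> bover B A. \<forall>A1' \<in> bover B A'. \<forall>A2' \<in> bover B A'.
           A1 \<noteq> A2 \<longrightarrow> bcomp B A1 A2 \<longrightarrow> A1' \<noteq> A2' \<longrightarrow> bcomp B A1' A2' \<longrightarrow>
           A1' \<sqsubseteq>b A1 \<longrightarrow> A2' \<sqsubseteq>b A2 \<longrightarrow>
           ((A1, A2) \<in> bless B \<longleftrightarrow> (A1', A2') \<in> bless B)))"

definition assoc :: "'v plane_tree \<Rightarrow> 'v bracketing set" where
  "assoc T = {B. n_bracketing T B}"

definition ble :: "'v bracketing \<Rightarrow> 'v bracketing \<Rightarrow> bool" (infix "\<preceq>" 50) where
  "B1 \<preceq> B2 \<longleftrightarrow> brs B1 \<subseteq> brs B2 \<and> bless B1 = Restr (bless B2) (brs B1)"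

definition bmin :: "'v plane_tree \<Rightarrow> 'v bracketing" where
  "bmin T = (THE B. B \<in> assoc T \<and> (\<forall>B' \<in> assoc T. B \<preceq> B'))"

definition bjoin :: "'v plane_tree \<Rightarrow> 'v bracketing \<Rightarrow> 'v bracketing \<Rightarrow> 'v bracketing" where
  "bjoin T B1 B2 = (THE J. J \<in> assoc T \<and> B1 \<preceq> J \<and> B2 \<preceq> J \<and>
     (\<forall>J' \<in> assoc T. B1 \<preceq> J' \<longrightarrow> B2 \<preceq> J' \<longrightarrow> J \<preceq> J'))"


section \<open>Collisions and contraction\<close>

definition collision :: "'v plane_tree \<Rightarrow> 'v bracketing \<Rightarrow> bool" where
  "collision T C \<longleftrightarrow> C \<in> assoc T - {bmin T} \<and> (\<forall>B \<in> assoc T - {bmin T}. B \<preceq> C \<longrightarrow> B = C)"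

definition fusion_br :: "'v plane_tree \<Rightarrow> 'v bracketing \<Rightarrow> 'v bracket" where
  "fusion_br T C = (THE E. E \<in> brs C \<and> \<not> is_singleton_br T E \<and> is_singleton_br T (butlast E) \<and>
     (\<exists>A \<in> brs C. \<exists>l. nontrivial_br T A \<and> E = (butlast ^^ l) A))"

definition essential :: "'v plane_tree \<Rightarrow> 'v bracketing \<Rightarrow> 'v bracket set" where
  "essential T C = {E \<in> brs C.
     (\<exists>A \<in> brs C. \<exists>l. nontrivial_br T A \<and> E = (butlast ^^ l) A) \<and>
     (\<exists>j. (butlast ^^ j) E = fusion_br T C)}"

definition fused :: "'v plane_tree \<Rightarrow> 'v bracketing \<Rightarrow> 'v set" where
  "fused T C = last (fusion_br T C)"

definition fusion_vertex :: "'v plane_tree \<Rightarrow> 'v bracketing \<Rightarrow> 'v" where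
  "fusion_vertex T C = (THE w. w \<in> tverts T \<and> butlast (fusion_br T C) = sing_br T w)"

definition below_fused :: "'v plane_tree \<Rightarrow> 'v bracketing \<Rightarrow> 'v set" where
  "below_fused T C = {v \<in> tverts T. \<exists>j. (tpar T ^^ j) v \<in> fused T C}"

text \<open>In the contracted tree, \<open>Inl v\<close> is a remaining vertex \<open>v\<close> of \<open>T\<close> and \<open>Inr E\<close> is \<open>v\<^sub>E\<close>.\<close>

definition contract :: "'v plane_tree \<Rightarrow> 'v bracketing \<Rightarrow> ('v + 'v bracket) plane_tree" where
  "contract T C = (let E0 = fusion_br T C; W = fused T C; w = fusion_vertex T C in
     \<lparr> tverts = Inl ` (tverts T - below_fused T C) \<union> Inr ` essential T C,
       troot = Inl (troot T),
       tpar = (\<lambda>x. case x of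
           Inl v \<Rightarrow> Inl (tpar T v)
         | Inr E \<Rightarrow> (if E = E0 then Inl w else Inr (butlast E))),
       tsib = {(Inl a, Inl b) | a b. (a, b) \<in> tsib T}
         \<union> {(Inl a, Inr E0) | a. a \<in> ch T w - W \<and> (\<forall>x \<in> W. (a, x) \<in> tsib T)}
         \<union> {(Inr E0, Inl b) | b. b \<in> ch T w - W \<and> (\<forall>x \<in> W. (x, b) \<in> tsib T)}
         \<union> {(Inr E, Inr E') | E E'. (E, E') \<in> bless C} \<rparr>)"

definition contract_map :: "'v plane_tree \<Rightarrow> 'v bracketing \<Rightarrow> 'v \<Rightarrow> 'v + 'v bracket" where
  "contract_map T C v =
     (if v \<in> below_fused T C
      then Inr (THE E. E \<in> essential T C \<and> E \<in> blev C (rdist T v) \<and> v \<in> last E)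
      else Inl v)"


section \<open>The velocity fan\<close>

text \<open>A vector of \<open>\<real>\<^sup>m\<close> is a function \<open>x\<close> with coordinates \<open>x k i\<close>, where \<open>1 \<le> k \<le> n\<close> and
  \<open>1 \<le> i \<le> t\<^sub>k\<close>, which is \<open>0\<close> at all other pairs of indices.\<close>

type_synonym vec = "nat \<Rightarrow> nat \<Rightarrow> real"

definition coord :: "'v plane_tree \<Rightarrow> nat \<Rightarrow> nat \<Rightarrow> bool" where
  "coord T k i \<longleftrightarrow> 1 \<le> k \<and> k \<le> depth T \<and> 1 \<le> i \<and> i \<le> card (level T k) - 1"

definition ones :: "'v plane_tree \<Rightarrow> vec" where
  "ones T = (\<lambda>k i. if coord T k i then 1 else 0)"
  \<comment> \<open>\<open>\<rho>\<close> of the minimum bracketing\<close>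

definition rho :: "'v plane_tree \<Rightarrow> 'v bracketing \<Rightarrow> vec" where
  "rho T C = (\<lambda>k i. if coord T k i then
       real (lpos (contract T C) (contract_map T C (lvert T k i)))
       - real (lpos (contract T C) (contract_map T C (lvert T k (i + 1)))) + 1
     else 0)"

definition vec_cone :: "vec set \<Rightarrow> vec set" where
  "vec_cone X = {\<lambda>k i. \<Sum>(t, v) \<leftarrow> tvs. t * v k i | tvs. \<forall>(t, v) \<in> set tvs. t \<ge> 0 \<and> v \<in> X}"

definition collisions_below :: "'v plane_tree \<Rightarrow> 'v bracketing \<Rightarrow> 'v bracketing set" where
  "collisions_below T B = {C. collision T C \<and> C \<preceq> B}"

definition tau :: "'v plane_tree \<Rightarrow> 'v bracketing \<Rightarrow> vec set" where
  "tau T B = {\<lambda>k i. y k i + c * ones T k i | y c. y \<in> vec_cone (rho T ` collisions_below T B)}"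


section \<open>Metric bracketings\<close>

text \<open>The length functions are defined on all lists of sets of vertices and vanish off the
  bracketing, so they are determined by their values on the brackets of \<open>T\<close>.\<close>

type_synonym 'v mbracketing = "'v bracketing \<times> ('v bracket \<Rightarrow> real)"

definition metric :: "'v plane_tree \<Rightarrow> 'v mbracketing \<Rightarrow> bool" where
  "metric T M \<longleftrightarrow> (case M of (B, l) \<Rightarrow>
     B \<in> assoc T \<and>
     (\<forall>A. A \<notin> brs B \<longrightarrow> l A = 0) \<and>
     (\<forall>A. is_singleton_br T A \<longrightarrow> l A = 0) \<and>
     (\<forall>A \<in> brs B. nontrivial_br T A \<longrightarrow> l A > 0) \<and>
     (\<forall>P \<in> brs B. \<not> is_singleton_br T P \<longrightarrow>
        (\<forall>A \<in> bover B P. \<forall>A' \<in> bover B P.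
           (\<forall>D \<in> bover B P. \<not> A \<sqsubset>b D) \<longrightarrow> (\<forall>D \<in> bover B P. \<not> D \<sqsubset>b A') \<longrightarrow> A' \<sqsubseteq>b A \<longrightarrow>
           l P = (\<Sum>D \<in> {D \<in> bover B P. A' \<sqsubseteq>b D \<and> D \<sqsubseteq>b A}. l D))))"

definition tau_met :: "'v plane_tree \<Rightarrow> 'v bracketing \<Rightarrow> 'v mbracketing set" where
  "tau_met T B = {M. metric T M \<and> fst M \<preceq> B}"

definition madd :: "'v plane_tree \<Rightarrow> 'v mbracketing \<Rightarrow> 'v mbracketing \<Rightarrow> 'v mbracketing" where
  "madd T M1 M2 = (bjoin T (fst M1) (fst M2), \<lambda>A. snd M1 A + snd M2 A)"

definition mzero :: "'v plane_tree \<Rightarrow> 'v mbracketing" where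
  "mzero T = (bmin T, \<lambda>A. 0)"

text \<open>The factor \<open>0\<close> gives the zero element; negative factors are used only for \<open>ell_min\<close>.\<close>

definition mscale :: "'v plane_tree \<Rightarrow> real \<Rightarrow> 'v mbracketing \<Rightarrow> 'v mbracketing" where
  "mscale T t M = (if t = 0 then mzero T else (fst M, \<lambda>A. t * snd M A))"

definition ell :: "'v plane_tree \<Rightarrow> 'v bracketing \<Rightarrow> 'v mbracketing" where
  "ell T C = (C, \<lambda>A. if A \<in> essential T C then 1 else 0)"

definition ell_min :: "'v plane_tree \<Rightarrow> 'v mbracketing" where
  "ell_min T = (bmin T, \<lambda>A. if is_max_br T A \<and> \<not> is_singleton_br T A then 1 else 0)"

text \<open>A list \<open>[(\<lambda>\<^sub>1, C\<^sub>1), \<dots>, (\<lambda>\<^sub>k, C\<^sub>k)]\<close> together with \<open>\<lambda>\<^sub>0\<close> encodes the formal combinations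
  \<open>\<Sum>\<^sub>i \<lambda>\<^sub>i \<ell>(C\<^sub>i)\<close> and \<open>\<Sum>\<^sub>i \<lambda>\<^sub>i \<rho>(C\<^sub>i)\<close>, where \<open>C\<^sub>0\<close> is the minimum bracketing.\<close>

definition ell_comb :: "'v plane_tree \<Rightarrow> real \<Rightarrow> (real \<times> 'v bracketing) list \<Rightarrow> 'v mbracketing" where
  "ell_comb T l0 cs =
     foldr (madd T) (map (\<lambda>(t, C). mscale T t (ell T C)) cs) (mscale T l0 (ell_min T))"

definition rho_comb :: "'v plane_tree \<Rightarrow> real \<Rightarrow> (real \<times> 'v bracketing) list \<Rightarrow> vec" where
  "rho_comb T l0 cs = (\<lambda>k i. l0 * ones T k i + (\<Sum>(t, C) \<leftarrow> cs. t * rho T C k i))"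

definition Gamma :: "'v plane_tree \<Rightarrow> 'v mbracketing \<Rightarrow> vec" where
  "Gamma T M = (THE x. \<exists>B \<in> assoc T. M \<in> tau_met T B \<and>
     (\<exists>l0 cs. (\<forall>(t, C) \<in> set cs. t \<ge> 0 \<and> C \<in> collisions_below T B) \<and>
        M = ell_comb T l0 cs \<and> x = rho_comb T l0 cs))"

definition int_metric_monoid :: "'v plane_tree \<Rightarrow> 'v bracketing \<Rightarrow> 'v mbracketing monoid" where
  "int_metric_monoid T B =
     \<lparr> carrier = {M \<in> tau_met T B. \<forall>A. snd M A \<in> \<int>}, mult = madd T, one = mzero T \<rparr>"

definition int_cone_monoid :: "'v plane_tree \<Rightarrow> 'v bracketing \<Rightarrow> vec monoid" where
  "int_cone_monoid T B =
     \<lparr> carrier = {x \<in> tau T B. \<forall>k i. x k i \<in> \<int>},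
       mult = (\<lambda>x y k i. x k i + y k i), one = (\<lambda>k i. 0) \<rparr>"

end

theory Submission
  imports Defs
begin

text \<open>For a vertex \<open>v\<close> of depth \<open>k\<close>, the \<open>k\<close>-brackets of \<open>\<B>\<close> containing \<open>v\<close> form a chain, which refines
  the corresponding chain of the parent of \<open>v\<close>. A metric bracketing below \<open>\<B>\<close> amounts to a function
  \<open>l\<close> on \<open>\<B>\<close> which is compatible with these refinements (a \<open>flow\<close>) and nonnegative on nontrivial
  brackets; the underlying bracketing is the support of \<open>l\<close>. A collision is the indicator function of
  a cut through all the chains below its fused vertices, and repeatedly subtracting multiples of such
  indicators decomposes every metric bracketing.

  The positions in \<open>T/\<C>\<close> are an affine function of the indicator of \<open>\<C>\<close>, with coefficients depending
  only on the order of \<open>\<B>\<close>. Hence \<open>\<Gamma>\<close> is the restriction of a linear map \<open>Vel\<close> on flows. If all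
  coordinates of \<open>Vel l\<close> lie in a subgroup \<open>G\<close> of \<open>\<real>\<close>, then so do all values of \<open>l\<close>: with \<open>G = {0}\<close>
  this is injectivity of \<open>\<Gamma>\<close>, and with \<open>G = \<int>\<close> it says that integer points come from integer metric
  bracketings.\<close>

section \<open>Plane trees\<close>

text \<open>The obstacle to recovering \<open>l\<close> from \<open>Vel l\<close> is that a velocity
  involves all brackets of a level, so a difference of velocities mixes unknown values from many
  fibres, a fibre being the set of brackets with a given truncation \<open>P\<close>. Two facts
  separate them. The order part \<open>eprec\<close> of a coefficient changes between two vertices
  of \<open>E\<close> only for brackets over \<open>butlast E\<close> or over something smaller, so
  the fibres can be solved in a well-founded order. The counting part enters through
  \<open>tot\<close>, the sum of all values through a vertex, which again sees every fibre. This
  circularity is broken at singleton brackets: nothing is smaller than these, and for neighbouring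
  siblings \<open>u\<close>, \<open>u'\<close> the counting part reduces to \<open>tot u\<close>,
  which modulo \<open>G\<close> is a sum over the singleton fibre itself. Once these fibres are
  solved, every \<open>tot\<close> lies in \<open>G\<close> and the other fibres follow.

  All comparisons are made inside a fixed bracketing: those below it are determined by their sets of
  brackets, joins become unions, and \<open>bless_transfer\<close> moves the order between pairs of
  brackets that share vertices.\<close>

lemma rank_bij:
  assumes fin: "finite A"
    and tr: "\<And>x y z. x \<in> A \<Longrightarrow> y \<in> A \<Longrightarrow> z \<in> A \<Longrightarrow> r x y \<Longrightarrow> r y z \<Longrightarrow> r x z"
    and irr: "\<And>x. x \<in> A \<Longrightarrow> \<not> r x x"
    and tot: "\<And>x y. x \<in> A \<Longrightarrow> y \<in> A \<Longrightarrow> x \<noteq> y \<Longrightarrow> r x y \<or> r y x"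
  shows "bij_betw (\<lambda>x. card {w \<in> A. r w x} + 1) A {1..card A}"
proof -
  let ?f = "\<lambda>x. card {w \<in> A. r w x} + 1"
  have mono: "?f x < ?f y" if "x \<in> A" "y \<in> A" "r x y" for x y
  proof -
    have "{w \<in> A. r w x} \<subset> {w \<in> A. r w y}"
      using that tr irr by blast
    then show ?thesis using fin by (simp add: psubset_card_mono)
  qed
  have inj: "inj_on ?f A"
  proof (rule inj_onI)
    fix x y assume "x \<in> A" "y \<in> A" "?f x = ?f y"
    then show "x = y" using mono[of x y] mono[of y x] tot[of x y] by force
  qed
  have "?f x \<le> card A" if "x \<in> A" for x
  proof -
    have "{w \<in> A. r w x} \<subset> A" using that irr by blast
    then show ?thesis using fin by (simp add: Suc_leI psubset_card_mono)
  qed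
  then have "?f ` A \<subseteq> {1..card A}" by auto
  moreover have "card (?f ` A) = card {1..card A}"
    using inj by (simp add: card_image)
  ultimately have "?f ` A = {1..card A}" by (intro card_subset_eq) auto
  then show ?thesis using inj by (simp add: bij_betw_def)
qed

text \<open>\<open>lex\<close> compares from the front, while an address grows at its end when
  passing to a child; this form lets \<open>addr_lex\<close> induct on the depth.\<close>

lemma lex_snoc:
  assumes "length xs = length ys" "irrefl r"
  shows "(xs @ [a], ys @ [b]) \<in> lex r \<longleftrightarrow> (xs, ys) \<in> lex r \<or> (xs = ys \<and> (a, b) \<in> r)"
  using assms
proof (induction xs ys rule: list_induct2)
  case (Cons x xs y ys)
  then show ?case by (auto simp: irrefl_def)
qed auto

lemma in_ch: "v \<in> ch T u \<longleftrightarrow> v \<in> tverts T \<and> v \<noteq> troot T \<and> tpar T v = u"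
  by (simp add: ch_def)

text \<open>The lexicographic order of a level without addresses: two ancestors at equal height are
  siblings in the right order, and from their common parent upwards the paths agree. The root is
  excluded because, being its own parent, it would pass for a sibling of its children.\<close>

definition tless :: "'v plane_tree \<Rightarrow> 'v \<Rightarrow> 'v \<Rightarrow> bool" where
  "tless T x y \<longleftrightarrow> (\<exists>i. (tpar T ^^ i) x \<noteq> troot T \<and> (tpar T ^^ i) y \<noteq> troot T \<and>
     tpar T ((tpar T ^^ i) x) = tpar T ((tpar T ^^ i) y) \<and>
     ((tpar T ^^ i) x, (tpar T ^^ i) y) \<in> tsib T)"

lemma ex_nat_split: "(\<exists>i. P i) \<longleftrightarrow> P (0::nat) \<or> (\<exists>i. P (Suc i))"
  by (auto elim: nat.exhaust) (metis nat.exhaust)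

lemma tless_rec:
  "tless T x y \<longleftrightarrow> x \<noteq> troot T \<and> y \<noteq> troot T \<and> tpar T x = tpar T y \<and> (x, y) \<in> tsib T
     \<or> tless T (tpar T x) (tpar T y)"
  unfolding tless_def by (subst ex_nat_split) (simp add: funpow_swap1)

locale rpt =
  fixes T :: "'v plane_tree"
  assumes rpt: "rooted_plane_tree T"
begin

lemma fin_verts: "finite (tverts T)"
  and root_in: "troot T \<in> tverts T"
  and par_root: "tpar T (troot T) = troot T"
  and par_in: "v \<in> tverts T \<Longrightarrow> tpar T v \<in> tverts T"
  and reach: "v \<in> tverts T \<Longrightarrow> \<exists>k. (tpar T ^^ k) v = troot T"
  and sib_order: "u \<in> tverts T \<Longrightarrow> strict_linear_order_on (ch T u) (Restr (tsib T) (ch T u))"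
  using rpt by (auto simp: rooted_plane_tree_def)

lemma par_pow_root: "(tpar T ^^ i) (troot T) = troot T"
  by (induction i) (auto simp: par_root)

lemma par_pow_in: "v \<in> tverts T \<Longrightarrow> (tpar T ^^ i) v \<in> tverts T"
  by (induction i) (auto simp: par_in)

lemma rdist_root [simp]: "rdist T (troot T) = 0"
  unfolding rdist_def by (rule Least_equality) auto

lemma rdist_par:
  assumes "v \<in> tverts T" "v \<noteq> troot T"
  shows "rdist T v = Suc (rdist T (tpar T v))"
proof -
  obtain k where k: "(tpar T ^^ k) v = troot T" using reach assms by blast
  have "(LEAST k. (tpar T ^^ k) v = troot T) = Suc (LEAST m. (tpar T ^^ Suc m) v = troot T)"
    by (rule Least_Suc[where P = "\<lambda>k. (tpar T ^^ k) v = troot T", OF k]) (use assms in simp)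
  then show ?thesis by (simp add: rdist_def funpow_swap1)
qed

lemma rdist_0_iff: "v \<in> tverts T \<Longrightarrow> rdist T v = 0 \<longleftrightarrow> v = troot T"
  using rdist_par by force

lemma ch_verts: "v \<in> ch T u \<Longrightarrow> u \<in> tverts T"
  by (auto simp: in_ch par_in)

lemma rdist_ch: "v \<in> ch T u \<Longrightarrow> rdist T v = Suc (rdist T u)"
  by (auto simp: in_ch rdist_par)

lemma level_0: "level T 0 = {troot T}"
  using rdist_0_iff root_in by (auto simp: level_def)

lemma level_Suc: "level T (Suc k) = (\<Union>u \<in> level T k. ch T u)"
proof -
  have "v \<in> level T (Suc k) \<longleftrightarrow> v \<in> (\<Union>u \<in> level T k. ch T u)" for v
    using rdist_par[of v] par_in[of v] rdist_0_iff[of v]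
    by (cases "v = troot T") (auto simp: level_def in_ch)
  then show ?thesis by blast
qed

lemma level_Suc_par: "v \<in> level T (Suc k) \<Longrightarrow> tpar T v \<in> level T k \<and> v \<noteq> troot T \<and> v \<in> ch T (tpar T v)"
  by (auto simp: level_Suc in_ch)

lemma level_ch: "u \<in> level T k \<Longrightarrow> v \<in> ch T u \<Longrightarrow> v \<in> level T (Suc k)"
  by (auto simp: level_Suc)

lemma finite_level [simp]: "finite (level T k)"
  using fin_verts by (simp add: level_def)

lemma level_verts: "v \<in> level T k \<Longrightarrow> v \<in> tverts T"
  by (simp add: level_def)

lemma finite_levels: "finite {k. level T k \<noteq> {}}"
proof -
  have "{k. level T k \<noteq> {}} \<subseteq> rdist T ` tverts T" by (auto simp: level_def)
  then show ?thesis using fin_verts finite_surj by blast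
qed

lemma level_le_depth: "v \<in> level T k \<Longrightarrow> k \<le> depth T"
  unfolding depth_def by (rule Max_ge[OF finite_levels]) auto

lemma level_ne: "k \<le> depth T \<Longrightarrow> level T k \<noteq> {}"
proof (induction rule: inc_induct)
  case base
  have "{k. level T k \<noteq> {}} \<noteq> {}" using level_0 by blast
  then show ?case using Max_in[OF finite_levels] by (auto simp: depth_def)
next
  case (step m)
  then show ?case by (auto simp: level_Suc)
qed

lemma finite_ch [simp]: "finite (ch T u)"
  using fin_verts by (simp add: ch_def)

lemma sib_irrefl: "x \<in> ch T u \<Longrightarrow> (x, x) \<notin> tsib T"
  and sib_trans: "x \<in> ch T u \<Longrightarrow> y \<in> ch T u \<Longrightarrow> z \<in> ch T u \<Longrightarrow>
    (x, y) \<in> tsib T \<Longrightarrow> (y, z) \<in> tsib T \<Longrightarrow> (x, z) \<in> tsib T"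
  and sib_total: "x \<in> ch T u \<Longrightarrow> y \<in> ch T u \<Longrightarrow> x \<noteq> y \<Longrightarrow> (x, y) \<in> tsib T \<or> (y, x) \<in> tsib T"
proof -
  assume x: "x \<in> ch T u"
  have o: "strict_linear_order_on (ch T u) (Restr (tsib T) (ch T u))"
    using sib_order ch_verts[OF x] .
  show "(x, x) \<notin> tsib T" using o x by (auto simp: strict_linear_order_on_def irrefl_def)
  show "(x, z) \<in> tsib T" if "y \<in> ch T u" "z \<in> ch T u" "(x, y) \<in> tsib T" "(y, z) \<in> tsib T"
    using o x that unfolding strict_linear_order_on_def trans_def by blast
  show "(x, y) \<in> tsib T \<or> (y, x) \<in> tsib T" if "y \<in> ch T u" "x \<noteq> y"
    using o x that unfolding strict_linear_order_on_def total_on_def by blast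
qed

lemma tless_irrefl: "x \<in> level T k \<Longrightarrow> \<not> tless T x x"
proof (induction k arbitrary: x)
  case 0
  then show ?case by (simp add: level_0 tless_def par_pow_root)
next
  case (Suc k)
  then show ?case
    using level_Suc_par[OF Suc.prems] sib_irrefl by (subst tless_rec) blast
qed

lemma tless_total: "x \<in> level T k \<Longrightarrow> y \<in> level T k \<Longrightarrow> x \<noteq> y \<Longrightarrow> tless T x y \<or> tless T y x"
proof (induction k arbitrary: x y)
  case 0
  then show ?case by (simp add: level_0)
next
  case (Suc k)
  note px = level_Suc_par[OF Suc.prems(1)] and py = level_Suc_par[OF Suc.prems(2)]
  show ?case
  proof (cases "tpar T x = tpar T y")
    case True
    then show ?thesis using px py sib_total[of x "tpar T x" y] Suc.prems
      by (metis tless_rec)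
  next
    case False
    then show ?thesis using px py Suc.IH[of "tpar T x" "tpar T y"] by (metis tless_rec)
  qed
qed

lemma tless_trans: "x \<in> level T k \<Longrightarrow> y \<in> level T k \<Longrightarrow> z \<in> level T k \<Longrightarrow>
    tless T x y \<Longrightarrow> tless T y z \<Longrightarrow> tless T x z"
proof (induction k arbitrary: x y z)
  case 0
  then show ?case by (simp add: level_0)
next
  case (Suc k)
  note px = level_Suc_par[OF Suc.prems(1)] and py = level_Suc_par[OF Suc.prems(2)]
    and pz = level_Suc_par[OF Suc.prems(3)]
  have "tpar T x = tpar T y \<and> (x, y) \<in> tsib T \<or> tless T (tpar T x) (tpar T y)"
    "tpar T y = tpar T z \<and> (y, z) \<in> tsib T \<or> tless T (tpar T y) (tpar T z)"
    using Suc.prems tless_rec by metis+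
  then show ?case
    using px py pz Suc.IH[of "tpar T x" "tpar T y" "tpar T z"] sib_trans[of x "tpar T x" y z]
    by (metis tless_rec)
qed

lemma tless_asym: "x \<in> level T k \<Longrightarrow> y \<in> level T k \<Longrightarrow> tless T x y \<Longrightarrow> \<not> tless T y x"
  using tless_trans tless_irrefl by blast

lemma anc_self [simp]: "anc T v (rdist T v) = v"
  by (simp add: anc_def)

lemma anc_par:
  assumes "v \<in> tverts T" "v \<noteq> troot T" "i \<le> rdist T (tpar T v)"
  shows "anc T v i = anc T (tpar T v) i"
proof -
  have "rdist T v - i = Suc (rdist T (tpar T v) - i)" using rdist_par assms by simp
  then show ?thesis by (simp add: anc_def funpow_swap1)
qed

lemma sing_br_root: "sing_br T (troot T) = [{troot T}]"
  using anc_self[of "troot T"] by (simp add: sing_br_def)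

lemma sing_br_snoc:
  assumes "v \<in> tverts T" "v \<noteq> troot T"
  shows "sing_br T v = sing_br T (tpar T v) @ [{v}]"
proof -
  have "anc T v (Suc (rdist T (tpar T v))) = v"
    using anc_self[of v] rdist_par[OF assms] by simp
  then show ?thesis
    using assms by (simp add: sing_br_def rdist_par anc_par)
qed

lemma length_sing_br [simp]: "length (sing_br T v) = Suc (rdist T v)"
  by (simp add: sing_br_def)

lemma sing_br_ne [simp]: "sing_br T v \<noteq> []"
  by (simp add: sing_br_def)

lemma last_sing_br [simp]: "last (sing_br T v) = {v}"
  by (simp add: sing_br_def)

lemma sing_br_inj: "sing_br T u = sing_br T v \<longleftrightarrow> u = v"
  by (metis last_sing_br singleton_inject)

lemma butlast_sing_br:
  "v \<in> tverts T \<Longrightarrow> v \<noteq> troot T \<Longrightarrow> butlast (sing_br T v) = sing_br T (tpar T v)"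
  by (simp add: sing_br_snoc)

lemma is_sing_iff: "is_singleton_br T A \<longleftrightarrow> (\<exists>u \<in> tverts T. A = sing_br T u)"
  by (simp add: is_singleton_br_def)

section \<open>Addresses and positions within a level\<close>

lemma addr_snoc:
  assumes "v \<in> tverts T" "v \<noteq> troot T"
  shows "addr T v = addr T (tpar T v) @ [child_pos T v]"
proof -
  have "anc T v (Suc (rdist T (tpar T v))) = v"
    using anc_self[of v] rdist_par[OF assms] by simp
  then show ?thesis
    using assms by (auto simp: addr_def rdist_par anc_par)
qed

lemma length_addr [simp]: "length (addr T v) = rdist T v"
  by (simp add: addr_def)

lemma child_pos_bij: "u \<in> tverts T \<Longrightarrow> bij_betw (child_pos T) (ch T u) {1..card (ch T u)}"
proof -
  assume "u \<in> tverts T"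
  have "bij_betw (\<lambda>x. card {w \<in> ch T u. (w, x) \<in> tsib T} + 1) (ch T u) {1..card (ch T u)}"
    by (rule rank_bij) (simp, erule (4) sib_trans, erule sib_irrefl, erule (2) sib_total)
  moreover have "\<And>v. v \<in> ch T u \<Longrightarrow> child_pos T v = card {w \<in> ch T u. (w, v) \<in> tsib T} + 1"
    by (simp add: child_pos_def in_ch)
  ultimately show ?thesis
    by (subst bij_betw_cong[where g = "\<lambda>x. card {w \<in> ch T u. (w, x) \<in> tsib T} + 1"]) auto
qed

lemma child_pos_less:
  assumes "x \<in> ch T u" "y \<in> ch T u"
  shows "child_pos T x < child_pos T y \<longleftrightarrow> (x, y) \<in> tsib T"
proof -
  have m: "child_pos T x < child_pos T y" if "x \<in> ch T u" "y \<in> ch T u" "(x, y) \<in> tsib T" for x y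
  proof -
    have "{w \<in> ch T u. (w, x) \<in> tsib T} \<subset> {w \<in> ch T u. (w, y) \<in> tsib T}"
      using that sib_trans sib_irrefl by blast
    then have "card {w \<in> ch T u. (w, x) \<in> tsib T} < card {w \<in> ch T u. (w, y) \<in> tsib T}"
      by (intro psubset_card_mono) auto
    moreover have "tpar T x = u" "tpar T y = u" using that by (auto simp: in_ch)
    ultimately show ?thesis by (simp add: child_pos_def)
  qed
  show ?thesis using m[of x y] m[of y x] assms sib_total by (metis nat_neq_iff not_less_iff_gr_or_eq)
qed

text \<open>Injectivity of \<open>addr\<close> is carried through the same induction because child
  positions decide only when the parents' addresses agree, and this must then mean equal
  parents.\<close>

lemma addr_lex:
  "x \<in> level T k \<Longrightarrow> y \<in> level T k \<Longrightarrow>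
    (addr T x = addr T y \<longleftrightarrow> x = y) \<and> ((addr T x, addr T y) \<in> lex less_than \<longleftrightarrow> tless T x y)"
proof (induction k arbitrary: x y)
  case 0
  then show ?case by (simp add: level_0 tless_irrefl[of _ 0] addr_def)
next
  case (Suc k)
  note px = level_Suc_par[OF Suc.prems(1)] and py = level_Suc_par[OF Suc.prems(2)]
  have a: "addr T x = addr T (tpar T x) @ [child_pos T x]"
     "addr T y = addr T (tpar T y) @ [child_pos T y]"
    using px py by (auto simp: in_ch addr_snoc)
  have IH: "addr T (tpar T x) = addr T (tpar T y) \<longleftrightarrow> tpar T x = tpar T y"
    "(addr T (tpar T x), addr T (tpar T y)) \<in> lex less_than \<longleftrightarrow> tless T (tpar T x) (tpar T y)"
    using Suc.IH px py by auto
  have l: "length (addr T (tpar T x)) = length (addr T (tpar T y))"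
    using px py by (simp add: level_def)
  have c: "child_pos T x = child_pos T y \<longleftrightarrow> x = y" if "tpar T x = tpar T y"
    using child_pos_bij[of "tpar T x"] px py that unfolding bij_betw_def inj_on_def
    by (metis level_verts)
  have "(addr T x, addr T y) \<in> lex less_than \<longleftrightarrow> (addr T (tpar T x), addr T (tpar T y)) \<in> lex less_than
     \<or> addr T (tpar T x) = addr T (tpar T y) \<and> child_pos T x < child_pos T y"
    unfolding a by (subst lex_snoc[OF l]) (auto simp: irrefl_def)
  also have "\<dots> \<longleftrightarrow> tless T (tpar T x) (tpar T y) \<or> tpar T x = tpar T y \<and> (x, y) \<in> tsib T"
    unfolding IH using child_pos_less px py by metis
  also have "\<dots> \<longleftrightarrow> tless T x y" using px py tless_rec by metis
  finally show ?case using a IH c by auto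
qed

lemma lpos_eq: "v \<in> level T k \<Longrightarrow> lpos T v = card {w \<in> level T k. tless T w v} + 1"
proof -
  assume v: "v \<in> level T k"
  then have "rdist T v = k" by (simp add: level_def)
  then have "{w \<in> level T (rdist T v). (addr T w, addr T v) \<in> lex less_than} = {w \<in> level T k. tless T w v}"
    using addr_lex[OF _ v] by auto
  then show ?thesis by (simp only: lpos_def)
qed

lemma lpos_bij: "bij_betw (lpos T) (level T k) {1..card (level T k)}"
proof -
  have "bij_betw (\<lambda>x. card {w \<in> level T k. tless T w x} + 1) (level T k) {1..card (level T k)}"
    by (rule rank_bij) (simp, erule (4) tless_trans, erule tless_irrefl, erule (2) tless_total)
  then show ?thesis
    by (subst bij_betw_cong[where g = "\<lambda>x. card {w \<in> level T k. tless T w x} + 1"])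
      (auto simp: lpos_eq)
qed

lemma lvert:
  assumes "1 \<le> i" "i \<le> card (level T k)"
  shows "lvert T k i \<in> level T k" "lpos T (lvert T k i) = i"
proof -
  have "i \<in> lpos T ` level T k"
    using lpos_bij[of k] assms by (simp add: bij_betw_def)
  then obtain v where v: "v \<in> level T k" "lpos T v = i" by blast
  have "lvert T k i = v" unfolding lvert_def
  proof (rule the_equality)
    fix u assume "u \<in> level T k \<and> lpos T u = i"
    then show "u = v" using lpos_bij[of k] v by (auto simp: bij_betw_def dest: inj_onD)
  qed (use v in simp)
  then show "lvert T k i \<in> level T k" "lpos T (lvert T k i) = i" using v by auto
qed

lemma lpos_range: "v \<in> level T k \<Longrightarrow> 1 \<le> lpos T v \<and> lpos T v \<le> card (level T k)"
  using lpos_bij[of k] by (auto simp: bij_betw_def)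

lemma lvert_lpos: "v \<in> level T k \<Longrightarrow> lvert T k (lpos T v) = v"
  unfolding lvert_def
  by (rule the_equality) (use lpos_bij[of k] in \<open>auto simp: bij_betw_def dest: inj_onD\<close>)

lemma length_max_br [simp]: "length (max_br T k) = Suc k"
  by (simp add: max_br_def)

lemma max_br_ne [simp]: "max_br T k \<noteq> []"
  by (simp add: max_br_def)

lemma last_max_br [simp]: "last (max_br T k) = level T k"
  by (simp add: max_br_def)

lemma max_br_Suc: "max_br T (Suc k) = max_br T k @ [level T (Suc k)]"
  by (simp add: max_br_def)

lemma max_br_0: "max_br T 0 = [{troot T}]"
  by (simp add: max_br_def level_0)

end

lemma list_all2_snoc: "list_all2 P (xs @ [x]) (ys @ [y]) \<longleftrightarrow> list_all2 P xs ys \<and> P x y"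
  by (cases "length xs = length ys") (auto simp: list_all2_append dest: list_all2_lengthD)

lemma bsub_rec: "A \<noteq> [] \<Longrightarrow> A' \<noteq> [] \<Longrightarrow> A \<sqsubseteq>b A' \<longleftrightarrow> butlast A \<sqsubseteq>b butlast A' \<and> last A \<subseteq> last A'"
  by (cases A rule: rev_cases; cases A' rule: rev_cases) (simp_all add: bsub_def list_all2_snoc)

lemma bsub_refl [simp]: "A \<sqsubseteq>b A"
  by (simp add: bsub_def list.rel_refl)

lemma bsub_antisym: "A \<sqsubseteq>b B \<Longrightarrow> B \<sqsubseteq>b A \<Longrightarrow> A = B"
  unfolding bsub_def by (rule list_all2_antisym[of "(\<subseteq>)" "(\<subseteq>)"]) auto

lemma bsub_length: "A \<sqsubseteq>b B \<Longrightarrow> length A = length B"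
  unfolding bsub_def by (rule list_all2_lengthD)

section \<open>Bracketings\<close>

text \<open>In \<open>T/\<C>\<close>, \<open>eprec T \<C> E u\<close> means that \<open>v\<^sub>E\<close> precedes the image of \<open>u\<close>. As \<open>[]\<close> is not
  a bracket, only \<open>i < length E\<close> matters.\<close>

definition eprec :: "'v plane_tree \<Rightarrow> 'v bracketing \<Rightarrow> 'v bracket \<Rightarrow> 'v \<Rightarrow> bool" where
  "eprec T B E u \<longleftrightarrow>
     (\<exists>i. \<exists>A \<in> brs B. (tpar T ^^ i) u \<in> last A \<and> ((butlast ^^ i) E, A) \<in> bless B)"

lemma eprec_rec:
  "eprec T B E u \<longleftrightarrow> (\<exists>A \<in> brs B. u \<in> last A \<and> (E, A) \<in> bless B) \<or> eprec T B (butlast E) (tpar T u)"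
  unfolding eprec_def by (subst ex_nat_split) (simp add: funpow_swap1)

text \<open>Phrased by intersection rather than containment: a bracket of the same fibre that meets
  \<open>m\<close> contains it. Hence the minimal brackets of a fibre are pairwise disjoint, and by
  (4b) they cover it (\<open>min_elt\<close>), so they serve as its atoms.\<close>

definition minel :: "'v bracketing \<Rightarrow> 'v bracket \<Rightarrow> bool" where
  "minel B m \<longleftrightarrow> m \<in> brs B \<and>
     (\<forall>D \<in> brs B. butlast D = butlast m \<longrightarrow> last D \<inter> last m \<noteq> {} \<longrightarrow> last m \<subseteq> last D)"

lemma ble_refl: "n_bracketing T B \<Longrightarrow> B \<preceq> B"
  unfolding ble_def
proof
  assume "n_bracketing T B"
  then have "bless B \<subseteq> brs B \<times> brs B" by (simp add: n_bracketing_def)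
  then show "bless B = Restr (bless B) (brs B)" by blast
qed simp

lemma ble_trans: "B1 \<preceq> B2 \<Longrightarrow> B2 \<preceq> B3 \<Longrightarrow> B1 \<preceq> B3"
  unfolding ble_def by blast

lemma ble_antisym:
  assumes "B1 \<preceq> B2" "B2 \<preceq> B1"
  shows "B1 = (B2 :: 'v bracketing)"
proof (rule bracketing.equality)
  show "brs B1 = brs B2" using assms unfolding ble_def by blast
  then show "bless B1 = bless B2" using assms unfolding ble_def by blast
qed simp

lemma ble_brs: "B1 \<preceq> B2 \<Longrightarrow> A \<in> brs B1 \<Longrightarrow> A \<in> brs B2"
  by (auto simp: ble_def)

lemma ble_bless: "B1 \<preceq> B2 \<Longrightarrow> A \<in> brs B1 \<Longrightarrow> A' \<in> brs B1 \<Longrightarrow> (A, A') \<in> bless B1 \<longleftrightarrow> (A, A') \<in> bless B2"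
  by (auto simp: ble_def)

text \<open>Below a common \<open>B\<close> the order is the restriction of that of
  \<open>B\<close>, so the brackets determine the bracketing.\<close>

lemma ble_eqI:
  assumes "B1 \<preceq> B" "B2 \<preceq> B" "brs B1 = brs (B2 :: 'v bracketing)"
  shows "B1 = B2"
proof (rule bracketing.equality)
  show "bless B1 = bless B2" using assms unfolding ble_def by metis
qed (use assms in simp_all)

locale brk = rpt T for T :: "'v plane_tree" +
  fixes B :: "'v bracketing"
  assumes nb: "n_bracketing T B"
begin

lemma brs_bracket: "A \<in> brs B \<Longrightarrow> \<exists>k \<le> depth T. A \<in> brackets T k"
proof -
  have "brs B \<subseteq> (\<Union>k \<le> depth T. brackets T k)" using nb by (simp add: n_bracketing_def)
  then show "A \<in> brs B \<Longrightarrow> \<exists>k \<le> depth T. A \<in> brackets T k" by blast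
qed

lemma brs_ne: "A \<in> brs B \<Longrightarrow> A \<noteq> []"
  using brs_bracket[of A] by (auto simp: brackets_def)

lemma brs_last:
  assumes "A \<in> brs B"
  shows "last A \<noteq> {} \<and> last A \<subseteq> level T (length A - 1)"
proof -
  obtain k where k: "A \<in> brackets T k" using brs_bracket[OF assms] by blast
  then have "last A = A ! k" using brs_ne[OF assms] by (simp add: brackets_def last_conv_nth)
  then show ?thesis using k by (auto simp: brackets_def)
qed

lemma brs_rdist: "A \<in> brs B \<Longrightarrow> u \<in> last A \<Longrightarrow> length A = Suc (rdist T u)"
proof -
  assume A: "A \<in> brs B" "u \<in> last A"
  then have "rdist T u = length A - 1" using brs_last[of A] by (auto simp: level_def)
  then show ?thesis using brs_ne[OF A(1)] by simp
qed

lemma brs_verts: "A \<in> brs B \<Longrightarrow> u \<in> last A \<Longrightarrow> u \<in> tverts T"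
  using brs_last[of A] by (auto simp: level_def)

lemma brs_level: "A \<in> brs B \<Longrightarrow> length A = Suc k \<Longrightarrow> last A \<subseteq> level T k"
  using brs_last[of A] by auto

lemma brs_ex: "A \<in> brs B \<Longrightarrow> \<exists>u. u \<in> last A"
  using brs_last by blast

lemma finite_brs: "finite (brs B)"
proof -
  have "A \<in> {xs. set xs \<subseteq> Pow (tverts T) \<and> length xs \<le> Suc (depth T)}" if "A \<in> brs B" for A
  proof -
    from brs_bracket[OF that] obtain k where k: "A \<in> brackets T k" by blast
    then have "x \<subseteq> tverts T" if "x \<in> set A" for x
      using that by (fastforce simp: brackets_def in_set_conv_nth level_def less_Suc_eq_le)
    then show ?thesis using k by (auto simp: brackets_def)
  qed
  then have "brs B \<subseteq> {xs. set xs \<subseteq> Pow (tverts T) \<and> length xs \<le> Suc (depth T)}" by blast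
  then show ?thesis
    by (rule finite_subset) (simp add: finite_lists_length_le fin_verts)
qed

lemma finite_last: "A \<in> brs B \<Longrightarrow> finite (last A)"
  using brs_last[of A] finite_subset[OF _ finite_level] by blast

lemma brs_par:
  assumes A: "A \<in> brs B" "u \<in> last A" "u \<noteq> troot T"
  shows "butlast A \<in> brs B" "tpar T u \<in> last (butlast A)"
proof -
  obtain k where k: "A \<in> brackets T k" "k \<le> depth T" using brs_bracket A by blast
  then have len: "length A = Suc k" by (simp add: brackets_def)
  have "rdist T u = k" using brs_rdist[OF A(1,2)] len by simp
  moreover have "u \<in> tverts T" using brs_verts A by blast
  ultimately obtain j where j: "k = Suc j" using A rdist_par by metis
  have "A \<in> blev B (Suc j)" using A len j by (simp add: blev_def)
  moreover have "\<forall>k. \<forall>A \<in> blev B (Suc k). butlast A \<in> blev B k"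
    using nb by (simp add: n_bracketing_def)
  ultimately have "butlast A \<in> blev B j" by blast
  then show "butlast A \<in> brs B" by (simp add: blev_def)
  have "butlast A \<noteq> []" using len j by (metis length_butlast diff_Suc_1 list.size(3) nat.distinct(1))
  then have "last A = A ! k" "last (butlast A) = A ! j"
    using len j brs_ne[OF A(1)] by (simp_all add: last_conv_nth nth_butlast)
  then show "tpar T u \<in> last (butlast A)"
    using k A j by (force simp: brackets_def)
qed

lemma brs_root: 
  assumes "A \<in> brs B" "troot T \<in> last A"
  shows "A = [{troot T}]"
proof -
  have "length A = Suc 0" using brs_rdist assms by fastforce
  then show ?thesis using brs_last[OF assms(1)] by (auto simp: length_Suc_conv level_0)
qed

lemma brs_butlast: 
  assumes "A \<in> brs B" "butlast A \<noteq> []"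
  shows "butlast A \<in> brs B" "u \<in> last A \<Longrightarrow> u \<noteq> troot T" 
     "u \<in> last A \<Longrightarrow> u \<in> ch T (tpar T u) \<and> tpar T u \<in> last (butlast A)"
proof -
  have nr: "u \<noteq> troot T" if "u \<in> last A" for u
    using brs_root assms that by fastforce
  then show "u \<in> last A \<Longrightarrow> u \<noteq> troot T" .
  show "butlast A \<in> brs B" using brs_ex[OF assms(1)] brs_par nr assms by blast
  show "u \<in> last A \<Longrightarrow> u \<in> ch T (tpar T u) \<and> tpar T u \<in> last (butlast A)"
    using brs_par nr assms brs_verts by (auto simp: in_ch)
qed

lemma brs_butlast_nil: "A \<in> brs B \<Longrightarrow> butlast A = [] \<Longrightarrow> A = [{troot T}]"
  using brs_last[of A] brs_ne[of A] by (cases A rule: rev_cases) (auto simp: level_0)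

lemma bover_eq: "bover B P = {D \<in> brs B. butlast D = P}"
  using brs_ne by (auto simp: bover_def blev_def)

lemma nested:
  assumes "A1 \<in> brs B" "A2 \<in> brs B" "u \<in> last A1" "u \<in> last A2"
  shows "A1 \<sqsubseteq>b A2 \<or> A2 \<sqsubseteq>b A1"
proof -
  have "A1 \<in> blev B (rdist T u)" "A2 \<in> blev B (rdist T u)"
    using assms brs_rdist by (auto simp: blev_def)
  moreover have "\<forall>k. \<forall>A1 \<in> blev B k. \<forall>A2 \<in> blev B k. last A1 \<inter> last A2 \<noteq> {} \<longrightarrow> A1 \<sqsubseteq>b A2 \<or> A2 \<sqsubseteq>b A1"
    using nb by (simp add: n_bracketing_def)
  ultimately show ?thesis using assms by blast
qed

lemma bsub_brs: "A1 \<in> brs B \<Longrightarrow> A2 \<in> brs B \<Longrightarrow>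
    A1 \<sqsubseteq>b A2 \<longleftrightarrow> butlast A1 \<sqsubseteq>b butlast A2 \<and> last A1 \<subseteq> last A2"
  by (rule bsub_rec) (auto dest: brs_ne)

lemma fiber_bsub: "A1 \<in> brs B \<Longrightarrow> A2 \<in> brs B \<Longrightarrow> butlast A1 = butlast A2 \<Longrightarrow>
    A1 \<sqsubseteq>b A2 \<longleftrightarrow> last A1 \<subseteq> last A2"
  by (simp add: bsub_brs)

lemma fiber_eq: "A1 \<in> brs B \<Longrightarrow> A2 \<in> brs B \<Longrightarrow> butlast A1 = butlast A2 \<Longrightarrow> last A1 = last A2 \<Longrightarrow> A1 = A2"
  by (metis append_butlast_last_id brs_ne)

lemma fiber_nested: "A1 \<in> brs B \<Longrightarrow> A2 \<in> brs B \<Longrightarrow> butlast A1 = butlast A2 \<Longrightarrow>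
    u \<in> last A1 \<Longrightarrow> u \<in> last A2 \<Longrightarrow> last A1 \<subseteq> last A2 \<or> last A2 \<subseteq> last A1"
  using nested fiber_bsub by metis

lemma max_in: "k \<le> depth T \<Longrightarrow> max_br T k \<in> brs B"
  and sing_in: "u \<in> tverts T \<Longrightarrow> sing_br T u \<in> brs B"
  using nb by (simp_all add: n_bracketing_def)

lemma cover:
  assumes "P \<in> brs B" "u \<in> last P" "v \<in> ch T u"
  obtains D where "D \<in> brs B" "butlast D = P" "v \<in> last D"
proof -
  have len: "length P = Suc (rdist T u)" using brs_rdist assms by blast
  have "v \<in> level T (Suc (rdist T u))"
    using brs_verts assms level_ch[of u] by (auto simp: level_def)
  then have "rdist T u < depth T" using level_le_depth by fastforce
  moreover have "\<forall>k < depth T. \<forall>A \<in> blev B k. (\<Union>A' \<in> bover B A. last A') = (\<Union>u \<in> last A. ch T u)"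
    using nb by (simp add: n_bracketing_def)
  moreover have "P \<in> blev B (rdist T u)" using assms len by (simp add: blev_def)
  ultimately have "v \<in> (\<Union>A' \<in> bover B P. last A')" using assms by blast
  then show ?thesis using that by (auto simp: bover_eq)
qed

lemma split_bracket:
  assumes "A1 \<in> brs B" "A2 \<in> brs B" "butlast A1 = butlast A2" "last A2 \<subset> last A1" "u \<in> last A1"
  obtains A3 where "A3 \<in> brs B" "butlast A3 = butlast A1" "last A3 \<subset> last A1" "u \<in> last A3"
proof -
  let ?P = "butlast A1"
  have "?P \<noteq> []"
  proof
    assume "?P = []"
    then have "A1 = A2" using brs_butlast_nil assms by metis
    then show False using assms by blast
  qed
  then have P: "?P \<in> brs B" and u: "u \<in> ch T (tpar T u)" "tpar T u \<in> last ?P"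
    using brs_butlast[OF assms(1)] assms(5) by blast+
  have len: "length ?P = Suc (rdist T (tpar T u))" using brs_rdist P u by blast
  have "u \<in> level T (Suc (rdist T (tpar T u)))"
    using u brs_verts[OF P u(2)] level_ch[of "tpar T u"] by (auto simp: level_def)
  then have "rdist T (tpar T u) < depth T" using level_le_depth by fastforce
  moreover have "?P \<in> blev B (rdist T (tpar T u))" using P len by (simp add: blev_def)
  moreover have "A1 \<in> bover B ?P" "A2 \<in> bover B ?P" using assms by (auto simp: bover_eq)
  moreover have "A2 \<sqsubset>b A1" using assms fiber_bsub by auto
  moreover have "\<forall>k < depth T. \<forall>A \<in> blev B k. \<forall>A1 \<in> bover B A. \<forall>A2 \<in> bover B A. A2 \<sqsubset>b A1 \<longrightarrow>
        (\<forall>u \<in> last A1. \<exists>A3 \<in> bover B A. A3 \<sqsubset>b A1 \<and> u \<in> last A3)"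
    using nb by (simp add: n_bracketing_def)
  ultimately obtain A3 where "A3 \<in> bover B ?P" "A3 \<sqsubset>b A1" "u \<in> last A3"
    using assms by blast
  then show ?thesis using that[of A3] assms fiber_bsub[of A3 A1] fiber_eq[of A3 A1]
    by (auto simp: bover_eq)
qed

lemma bless_brs: "(A1, A2) \<in> bless B \<Longrightarrow> A1 \<in> brs B \<and> A2 \<in> brs B"
proof -
  have "bless B \<subseteq> brs B \<times> brs B" using nb by (simp add: n_bracketing_def)
  then show "(A1, A2) \<in> bless B \<Longrightarrow> A1 \<in> brs B \<and> A2 \<in> brs B" by blast
qed

lemma bless_irrefl: "(A, A) \<notin> bless B"
  using nb by (simp add: n_bracketing_def irrefl_def)

lemma bless_trans: "(A1, A2) \<in> bless B \<Longrightarrow> (A2, A3) \<in> bless B \<Longrightarrow> (A1, A3) \<in> bless B"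
proof -
  have "trans (bless B)" using nb by (simp add: n_bracketing_def)
  then show "(A1, A2) \<in> bless B \<Longrightarrow> (A2, A3) \<in> bless B \<Longrightarrow> (A1, A3) \<in> bless B"
    by (rule transD)
qed

lemma bless_asym: "(A1, A2) \<in> bless B \<Longrightarrow> (A2, A1) \<notin> bless B"
  using bless_trans bless_irrefl by blast

lemma bcomp_iff: "A1 \<in> brs B \<Longrightarrow> A2 \<in> brs B \<Longrightarrow>
    bcomp B A1 A2 \<longleftrightarrow> butlast A1 = butlast A2 \<and> last A1 \<inter> last A2 = {}"
proof -
  assume A: "A1 \<in> brs B" "A2 \<in> brs B"
  show ?thesis
  proof (cases "A1 = A2")
    case True
    then show ?thesis using bless_irrefl brs_last A by (auto simp: bcomp_def)
  next
    case False
    have "\<forall>A1 \<in> brs B. \<forall>A2 \<in> brs B. A1 \<noteq> A2 \<longrightarrow>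
        (bcomp B A1 A2 \<longleftrightarrow> length A1 = length A2 \<and> butlast A1 = butlast A2 \<and> last A1 \<inter> last A2 = {})"
      using nb by (simp add: n_bracketing_def)
    moreover have "length A1 = length A2" if "butlast A1 = butlast A2"
      using brs_ne A that by (metis append_butlast_last_id length_append_singleton)
    ultimately show ?thesis using A False by blast
  qed
qed

lemma blessD: "(A1, A2) \<in> bless B \<Longrightarrow> A1 \<in> brs B \<and> A2 \<in> brs B \<and> butlast A1 = butlast A2 \<and> last A1 \<inter> last A2 = {}"
  using bcomp_iff bless_brs unfolding bcomp_def by blast

lemma bless_total: "A1 \<in> brs B \<Longrightarrow> A2 \<in> brs B \<Longrightarrow> butlast A1 = butlast A2 \<Longrightarrow> last A1 \<inter> last A2 = {} \<Longrightarrow>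
   (A1, A2) \<in> bless B \<or> (A2, A1) \<in> bless B"
  using bcomp_iff unfolding bcomp_def by blast

text \<open>This is (5c). Comparability already yields, by (5a), the common truncations and
  disjointness, and containment of the truncations follows from that of the brackets.\<close>

lemma bless_sub:
  assumes less: "(A1, A2) \<in> bless B \<or> (A2, A1) \<in> bless B" "(A1', A2') \<in> bless B \<or> (A2', A1') \<in> bless B"
    and sub: "A1' \<sqsubseteq>b A1" "A2' \<sqsubseteq>b A2"
  shows "(A1, A2) \<in> bless B \<longleftrightarrow> (A1', A2') \<in> bless B"
proof -
  have A: "A1 \<in> brs B" "A2 \<in> brs B" "butlast A1 = butlast A2" "last A1 \<inter> last A2 = {}" "A1 \<noteq> A2"
    and A': "A1' \<in> brs B" "A2' \<in> brs B" "butlast A1' = butlast A2'" "last A1' \<inter> last A2' = {}" "A1' \<noteq> A2'"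
    using less blessD bless_irrefl by (metis inf_commute)+
  have ne: "butlast A1 \<noteq> []" using A brs_butlast_nil by metis
  have len: "length A1' = length A1" using sub bsub_length by blast
  then have ne': "butlast A1' \<noteq> []" using ne by (metis length_butlast length_0_conv)
  obtain u where u: "u \<in> last A1" using brs_ex A by blast
  have P: "butlast A1 \<in> brs B" "tpar T u \<in> last (butlast A1)" "u \<in> ch T (tpar T u)"
    using brs_butlast[OF A(1) ne] u by blast+
  have P': "butlast A1' \<in> brs B" using brs_butlast[OF A'(1) ne'] by blast
  have lenP: "length (butlast A1) = Suc (rdist T (tpar T u))" using P brs_rdist by blast
  then have lenP': "length (butlast A1') = Suc (rdist T (tpar T u))" using len by simp
  have "u \<in> level T (Suc (rdist T (tpar T u)))"
    using P brs_verts[OF P(1,2)] level_ch[of "tpar T u"] by (auto simp: level_def)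
  then have "rdist T (tpar T u) < depth T" using level_le_depth by fastforce
  moreover have "\<forall>k < depth T. \<forall>A \<in> blev B k. \<forall>A' \<in> blev B k. A' \<sqsubseteq>b A \<longrightarrow>
        (\<forall>A1 \<in> bover B A. \<forall>A2 \<in> bover B A. \<forall>A1' \<in> bover B A'. \<forall>A2' \<in> bover B A'.
           A1 \<noteq> A2 \<longrightarrow> bcomp B A1 A2 \<longrightarrow> A1' \<noteq> A2' \<longrightarrow> bcomp B A1' A2' \<longrightarrow>
           A1' \<sqsubseteq>b A1 \<longrightarrow> A2' \<sqsubseteq>b A2 \<longrightarrow>
           ((A1, A2) \<in> bless B \<longleftrightarrow> (A1', A2') \<in> bless B))"
    using nb unfolding n_bracketing_def by (elim conjE)
  moreover have "butlast A1 \<in> blev B (rdist T (tpar T u))" "butlast A1' \<in> blev B (rdist T (tpar T u))"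
    using P P' lenP lenP' by (auto simp: blev_def)
  moreover have "A1 \<in> bover B (butlast A1)" "A2 \<in> bover B (butlast A1)"
    "A1' \<in> bover B (butlast A1')" "A2' \<in> bover B (butlast A1')"
    using A A' by (auto simp: bover_eq)
  moreover have "butlast A1' \<sqsubseteq>b butlast A1" using sub A A' bsub_brs by blast
  moreover have "bcomp B A1 A2" "bcomp B A1' A2'" using less by (auto simp: bcomp_def)
  ultimately show ?thesis using sub A(5) A'(5) by blast
qed

text \<open>Nestedness at \<open>x\<close> and at \<open>y\<close> leaves four cases, and (5c)
  settles the two in which both containments point the same way. In the mixed cases the containments
  of the truncations go both ways, so all four brackets lie in one fibre and a pair such as
  \<open>A1'\<close>, \<open>A2\<close> serves as intermediate.\<close>

lemma bless_transfer:
  assumes less: "(A1, A2) \<in> bless B"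
    and A': "A1' \<in> brs B" "A2' \<in> brs B" "butlast A1' = butlast A2'" "last A1' \<inter> last A2' = {}"
    and x: "x \<in> last A1" "x \<in> last A1'" and y: "y \<in> last A2" "y \<in> last A2'"
  shows "(A1', A2') \<in> bless B"
proof -
  have A: "A1 \<in> brs B" "A2 \<in> brs B" "butlast A1 = butlast A2" "last A1 \<inter> last A2 = {}"
    using blessD less by auto
  have c': "(A1', A2') \<in> bless B \<or> (A2', A1') \<in> bless B" using bless_total A' by blast
  consider "A1' \<sqsubseteq>b A1" "A2' \<sqsubseteq>b A2" | "A1 \<sqsubseteq>b A1'" "A2 \<sqsubseteq>b A2'" | "A1' \<sqsubseteq>b A1" "A2 \<sqsubseteq>b A2'"
    | "A1 \<sqsubseteq>b A1'" "A2' \<sqsubseteq>b A2"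
    using nested A A' x y by meson
  then show ?thesis
  proof cases
    case 1
    then show ?thesis using bless_sub less c' by blast
  next
    case 2
    then show ?thesis using bless_sub less c' by blast
  next
    case 3
    then have s: "butlast A1' \<sqsubseteq>b butlast A1" "last A1' \<subseteq> last A1"
      "butlast A2 \<sqsubseteq>b butlast A2'" "last A2 \<subseteq> last A2'"
      using bsub_brs A A' by blast+
    then have "butlast A1' = butlast A2" using A A' bsub_antisym by metis
    then have c: "(A1', A2) \<in> bless B \<or> (A2, A1') \<in> bless B"
      using s A A' by (intro bless_total) auto
    have "(A1', A2) \<in> bless B" using bless_sub[OF _ c, of A1 A2] less 3 bsub_refl by blast
    then show ?thesis using bless_sub[OF c' c] 3 bsub_refl by blast
  next
    case 4
    then have s: "butlast A1 \<sqsubseteq>b butlast A1'" "last A1 \<subseteq> last A1'"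
      "butlast A2' \<sqsubseteq>b butlast A2" "last A2' \<subseteq> last A2"
      using bsub_brs A A' by blast+
    then have "butlast A1 = butlast A2'" using A A' bsub_antisym by metis
    then have c: "(A1, A2') \<in> bless B \<or> (A2', A1) \<in> bless B"
      using s A A' by (intro bless_total) auto
    have "(A1, A2') \<in> bless B" using bless_sub[OF _ c, of A1 A2] less 4 bsub_refl by blast
    then show ?thesis using bless_sub[OF c' c] 4 bsub_refl by blast
  qed
qed

lemma sing_less:
  assumes "a \<in> ch T u" "b \<in> ch T u"
  shows "(sing_br T a, sing_br T b) \<in> bless B \<longleftrightarrow> (a, b) \<in> tsib T"
proof -
  have "\<forall>u \<in> tverts T. \<forall>u1 \<in> ch T u. \<forall>u2 \<in> ch T u. (u1, u2) \<in> tsib T \<longrightarrow>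
        (sing_br T u1, sing_br T u2) \<in> bless B"
    using nb by (simp add: n_bracketing_def)
  then have *: "(a, b) \<in> tsib T \<Longrightarrow> (sing_br T a, sing_br T b) \<in> bless B"
    if "a \<in> ch T u" "b \<in> ch T u" for a b using that ch_verts by blast
  show ?thesis using *[of a b] *[of b a] assms sib_total[of a u b] bless_asym bless_irrefl by metis
qed

text \<open>Take a bracket of the fibre through \<open>v\<close> with fewest top vertices. If some
  \<open>D\<close> met it without containing it, nestedness would put \<open>D\<close> strictly
  inside, and (4b) would give a smaller bracket through \<open>v\<close>.\<close>

lemma min_elt:
  assumes P: "P \<in> brs B" and u: "u \<in> last P" "v \<in> ch T u"
  obtains m where "minel B m" "butlast m = P" "v \<in> last m"
proof -
  obtain D0 where D0: "D0 \<in> brs B \<and> butlast D0 = P \<and> v \<in> last D0" using cover[OF P u] by blast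
  obtain m where m: "m \<in> brs B \<and> butlast m = P \<and> v \<in> last m"
    and min: "\<And>D. D \<in> brs B \<and> butlast D = P \<and> v \<in> last D \<Longrightarrow> card (last m) \<le> card (last D)"
    using ex_has_least_nat[of "\<lambda>D. D \<in> brs B \<and> butlast D = P \<and> v \<in> last D" D0 "\<lambda>D. card (last D)"] D0 by blast
  have "last m \<subseteq> last D" if D: "D \<in> brs B" "butlast D = P" "last D \<inter> last m \<noteq> {}" for D
  proof (rule ccontr)
    assume n: "\<not> last m \<subseteq> last D"
    obtain x where "x \<in> last D" "x \<in> last m" using D by blast
    then have "last D \<subset> last m" using n fiber_nested[of m D x] m D by auto
    then obtain A3 where A3: "A3 \<in> brs B" "butlast A3 = butlast m" "last A3 \<subset> last m" "v \<in> last A3"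
      using split_bracket[of m D v] m D by metis
    then have "card (last A3) < card (last m)" using finite_last m by (simp add: psubset_card_mono)
    then show False using min[of A3] A3 m by simp
  qed
  then show ?thesis using that[of m] m unfolding minel_def by blast
qed

lemma minel_disj:
  assumes "minel B m" "A \<in> brs B" "butlast A = butlast m" "v \<in> last m" "v \<notin> last A"
  shows "last A \<inter> last m = {}"
  using assms unfolding minel_def by blast

lemma minel_unique: "minel B m \<Longrightarrow> minel B m' \<Longrightarrow> butlast m = butlast m' \<Longrightarrow> v \<in> last m \<Longrightarrow> v \<in> last m' \<Longrightarrow> m = m'"
  using fiber_eq unfolding minel_def by (metis disjoint_iff subset_antisym)

end

section \<open>Sub-bracketings and flows\<close>

definition triv :: "'v plane_tree \<Rightarrow> 'v bracket set" where
  "triv T = sing_br T ` tverts T \<union> max_br T ` {..depth T}"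

lemma nontrivial_iff: "nontrivial_br T A \<longleftrightarrow> A \<notin> triv T"
  by (auto simp: nontrivial_br_def is_singleton_br_def is_max_br_def triv_def)

definition restrict_br :: "'v bracketing \<Rightarrow> 'v bracket set \<Rightarrow> 'v bracketing" where
  "restrict_br B S = \<lparr>brs = S, bless = Restr (bless B) S\<rparr>"

lemma brs_restrict [simp]: "brs (restrict_br B S) = S"
  and bless_restrict [simp]: "bless (restrict_br B S) = Restr (bless B) S"
  by (simp_all add: restrict_br_def)

lemma restrict_ble: "S \<subseteq> brs B \<Longrightarrow> restrict_br B S \<preceq> B"
  by (simp add: ble_def)

lemma restrict_cong: "B' \<preceq> B \<Longrightarrow> B' = restrict_br B (brs B')"
  by (rule bracketing.equality) (auto simp: ble_def)

text \<open>The sum runs over the part above \<open>P\<close> of the chain of brackets containing \<open>v\<close>; this part is the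
  interval between the minimal and the maximal bracket over \<open>P\<close> that contain \<open>v\<close>, so flows are the
  length functions without their positivity condition.\<close>

definition flow :: "'v plane_tree \<Rightarrow> 'v bracketing \<Rightarrow> ('v bracket \<Rightarrow> real) \<Rightarrow> bool" where
  "flow T B l \<longleftrightarrow> (\<forall>A. A \<notin> brs B \<longrightarrow> l A = 0) \<and> (\<forall>A. is_singleton_br T A \<longrightarrow> l A = 0) \<and>
     (\<forall>P \<in> brs B. \<not> is_singleton_br T P \<longrightarrow> (\<forall>u \<in> last P. \<forall>v \<in> ch T u.
        l P = (\<Sum>D | D \<in> brs B \<and> butlast D = P \<and> v \<in> last D. l D)))"

text \<open>Maximum brackets carry no sign condition: the coefficient of the minimum bracketing
  ranges over all reals, which matches the line spanned by \<open>ones T\<close> in the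
  cone.\<close>

definition pflow :: "'v plane_tree \<Rightarrow> 'v bracketing \<Rightarrow> ('v bracket \<Rightarrow> real) \<Rightarrow> bool" where
  "pflow T B l \<longleftrightarrow> flow T B l \<and> (\<forall>A \<in> brs B. A \<notin> triv T \<longrightarrow> l A \<ge> 0)"

definition supp_br :: "'v plane_tree \<Rightarrow> 'v bracketing \<Rightarrow> ('v bracket \<Rightarrow> real) \<Rightarrow> 'v bracketing" where
  "supp_br T B l = restrict_br B ({A \<in> brs B. l A \<noteq> 0} \<union> triv T)"

lemma flow_add: "flow T B l \<Longrightarrow> flow T B l' \<Longrightarrow> flow T B (\<lambda>A. l A + l' A)"
  unfolding flow_def by (auto simp: sum.distrib)

lemma flow_scale: "flow T B l \<Longrightarrow> flow T B (\<lambda>A. t * l A)"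
  unfolding flow_def by (auto simp: sum_distrib_left)

lemma flow_0: "flow T B (\<lambda>A. 0)"
  by (simp add: flow_def)

lemma flow_sum: "flow T B l \<Longrightarrow> P \<in> brs B \<Longrightarrow> \<not> is_singleton_br T P \<Longrightarrow> u \<in> last P \<Longrightarrow> v \<in> ch T u \<Longrightarrow>
    l P = (\<Sum>D | D \<in> brs B \<and> butlast D = P \<and> v \<in> last D. l D)"
  by (simp add: flow_def)

lemma (in rpt) brkI: "n_bracketing T B \<Longrightarrow> brk T B"
  by unfold_locales

text \<open>The order between a bracket of \<open>B1\<close> and a further bracket is forced by \<open>B1\<close>, since \<open>B1\<close>
  has a bracket that meets the further one and is disjoint from the given one.\<close>

lemma (in rpt) bless_cross:
  assumes "n_bracketing T B1" "n_bracketing T B" "n_bracketing T J" "B1 \<preceq> B" "B1 \<preceq> J"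
    and A: "A1 \<in> brs B1" "A2 \<in> brs J"
  shows "(A1, A2) \<in> bless B \<Longrightarrow> (A1, A2) \<in> bless J" "(A2, A1) \<in> bless B \<Longrightarrow> (A2, A1) \<in> bless J"
proof -
  interpret B1: brk T B1 using assms brkI by blast
  interpret B: brk T B using assms brkI by blast
  interpret J: brk T J using assms brkI by blast
  have AJ: "A1 \<in> brs J" and AB: "A1 \<in> brs B" using assms ble_brs by blast+
  have *: "\<exists>m. m \<in> brs B1 \<and> v \<in> last m \<and> butlast m = butlast A1 \<and> last A1 \<inter> last m = {}"
    if c: "butlast A1 = butlast A2" "last A1 \<inter> last A2 = {}" "v \<in> last A2" for v
  proof -
    have ne: "butlast A1 \<noteq> []"
    proof
      assume "butlast A1 = []"
      then have "A1 = A2" using J.brs_butlast_nil c AJ A by metis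
      then show False using c by blast
    qed
    then have "v \<in> ch T (tpar T v)" "tpar T v \<in> last (butlast A1)" "butlast A1 \<in> brs B1"
      using J.brs_butlast[OF A(2)] B1.brs_butlast[OF A(1)] c by auto
    then obtain m where m: "minel B1 m" "butlast m = butlast A1" "v \<in> last m"
      using B1.min_elt by metis
    moreover have "last A1 \<inter> last m = {}" using B1.minel_disj[OF m(1) A(1)] m c by auto
    ultimately show ?thesis unfolding minel_def by blast
  qed
  show "(A1, A2) \<in> bless J" if l: "(A1, A2) \<in> bless B"
  proof -
    note d = B.blessD[OF l]
    obtain v where v: "v \<in> last A2" using B.brs_ex d by blast
    obtain m where m: "m \<in> brs B1" "v \<in> last m" "butlast m = butlast A1" "last A1 \<inter> last m = {}"
      using *[of v] d v by blast
    obtain x where x: "x \<in> last A1" using B.brs_ex d by blast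
    have "(A1, m) \<in> bless B"
      by (rule B.bless_transfer[OF l AB _ _ _ x x v]) (use m assms ble_brs in auto)
    then have "(A1, m) \<in> bless J" using m assms ble_bless by metis
    then show ?thesis
      by (rule J.bless_transfer[OF _ AJ A(2) _ _ x x _ v]) (use m d in auto)
  qed
  show "(A2, A1) \<in> bless J" if l: "(A2, A1) \<in> bless B"
  proof -
    note d = B.blessD[OF l]
    obtain v where v: "v \<in> last A2" using B.brs_ex d by blast
    obtain m where m: "m \<in> brs B1" "v \<in> last m" "butlast m = butlast A1" "last A1 \<inter> last m = {}"
      using *[of v] d v by (metis inf_commute)
    obtain x where x: "x \<in> last A1" using B.brs_ex d by blast
    have "(m, A1) \<in> bless B"
      by (rule B.bless_transfer[OF l _ AB _ _ v _ x x]) (use m assms ble_brs in auto)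
    then have "(m, A1) \<in> bless J" using m assms ble_bless by metis
    then show ?thesis
      by (rule J.bless_transfer[OF _ A(2) AJ _ _ _ v x x]) (use m d in auto)
  qed
qed

section \<open>Sub-bracketings, the minimum bracketing and joins\<close>

context brk
begin

lemma triv_in: "A \<in> triv T \<Longrightarrow> A \<in> brs B"
  using max_in sing_in by (auto simp: triv_def)

text \<open>Nestedness and the order axioms pass to subsets. The hypotheses are the axioms that
  assert existence: trivial brackets, closure under truncation (2), covering (4a) and splitting
  (4b).\<close>

lemma sub_bracketing:
  assumes S: "S \<subseteq> brs B" and tr: "triv T \<subseteq> S"
    and par: "\<And>A. A \<in> S \<Longrightarrow> butlast A \<noteq> [] \<Longrightarrow> butlast A \<in> S"
    and cov: "\<And>P u v. P \<in> S \<Longrightarrow> u \<in> last P \<Longrightarrow> v \<in> ch T u \<Longrightarrow> \<exists>D \<in> S. butlast D = P \<and> v \<in> last D"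
    and spl: "\<And>A1 A2 u. A1 \<in> S \<Longrightarrow> A2 \<in> S \<Longrightarrow> butlast A1 = butlast A2 \<Longrightarrow> last A2 \<subset> last A1 \<Longrightarrow>
      u \<in> last A1 \<Longrightarrow> \<exists>A3 \<in> S. butlast A3 = butlast A1 \<and> last A3 \<subset> last A1 \<and> u \<in> last A3"
  shows "n_bracketing T (restrict_br B S)"
proof -
  have bov: "bover (restrict_br B S) P = {D \<in> S. butlast D = P}" for P
    using S brs_ne by (auto simp: bover_def blev_def)
  have bc: "bcomp (restrict_br B S) A1 A2 \<longleftrightarrow> bcomp B A1 A2" if "A1 \<in> S" "A2 \<in> S" for A1 A2
    using that by (auto simp: bcomp_def)
  show ?thesis unfolding n_bracketing_def
  proof (intro conjI)
    show "brs (restrict_br B S) \<subseteq> (\<Union>k\<le>depth T. brackets T k)" using S brs_bracket by fastforce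
    show "bless (restrict_br B S) \<subseteq> brs (restrict_br B S) \<times> brs (restrict_br B S)" by auto
    show "irrefl (bless (restrict_br B S))" using bless_irrefl by (auto simp: irrefl_def)
    show "trans (bless (restrict_br B S))" using bless_trans by (auto intro!: transI)
    show "\<forall>k\<le>depth T. max_br T k \<in> brs (restrict_br B S)" using tr by (auto simp: triv_def)
    show "\<forall>u\<in>tverts T. sing_br T u \<in> brs (restrict_br B S)" using tr by (auto simp: triv_def)
    show "\<forall>k. \<forall>A\<in>blev (restrict_br B S) (Suc k). butlast A \<in> blev (restrict_br B S) k"
    proof (intro allI ballI)
      fix k A assume "A \<in> blev (restrict_br B S) (Suc k)"
      then have A: "A \<in> S" "length A = Suc (Suc k)" by (auto simp: blev_def)
      then have "length (butlast A) = Suc k" by simp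
      moreover then have "butlast A \<in> S" using par A by (metis list.size(3) nat.distinct(1))
      ultimately show "butlast A \<in> blev (restrict_br B S) k" by (simp add: blev_def)
    qed
    show "\<forall>k. \<forall>A1\<in>blev (restrict_br B S) k. \<forall>A2\<in>blev (restrict_br B S) k.
        last A1 \<inter> last A2 \<noteq> {} \<longrightarrow> A1 \<sqsubseteq>b A2 \<or> A2 \<sqsubseteq>b A1"
      using nested S by (fastforce simp: blev_def)
    show "\<forall>k<depth T. \<forall>A\<in>blev (restrict_br B S) k.
        (\<Union>A' \<in> bover (restrict_br B S) A. last A') = (\<Union>u \<in> last A. ch T u)"
    proof (intro allI ballI impI equalityI)
      fix k A assume A: "A \<in> blev (restrict_br B S) k"
      then have AS: "A \<in> S" and "length A = Suc k" by (auto simp: blev_def)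
      then have ne: "A \<noteq> []" by auto
      show "(\<Union>A' \<in> bover (restrict_br B S) A. last A') \<subseteq> (\<Union>u \<in> last A. ch T u)"
      proof
        fix v assume "v \<in> (\<Union>A' \<in> bover (restrict_br B S) A. last A')"
        then obtain D where D: "D \<in> S" "butlast D = A" "v \<in> last D" by (auto simp: bov)
        then show "v \<in> (\<Union>u \<in> last A. ch T u)" using brs_butlast(3)[of D v] S ne by blast
      qed
      show "(\<Union>u \<in> last A. ch T u) \<subseteq> (\<Union>A' \<in> bover (restrict_br B S) A. last A')"
        using cov[OF AS] by (auto simp: bov)
    qed
    show "\<forall>k<depth T. \<forall>A\<in>blev (restrict_br B S) k. \<forall>A1\<in>bover (restrict_br B S) A.
        \<forall>A2\<in>bover (restrict_br B S) A. A2 \<sqsubset>b A1 \<longrightarrow>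
          (\<forall>u\<in>last A1. \<exists>A3\<in>bover (restrict_br B S) A. A3 \<sqsubset>b A1 \<and> u \<in> last A3)"
    proof (intro allI ballI impI)
      fix k A A1 A2 u
      assume "A1 \<in> bover (restrict_br B S) A" "A2 \<in> bover (restrict_br B S) A" "A2 \<sqsubset>b A1" "u \<in> last A1"
      then have A: "A1 \<in> S" "A2 \<in> S" "butlast A1 = A" "butlast A2 = A" "A2 \<sqsubseteq>b A1" "A2 \<noteq> A1" "u \<in> last A1"
        by (auto simp: bov)
      then have "last A2 \<subset> last A1" using fiber_bsub fiber_eq S by (metis psubsetI subsetD)
      then obtain A3 where A3: "A3 \<in> S" "butlast A3 = A" "last A3 \<subset> last A1" "u \<in> last A3"
        using spl[of A1 A2 u] A by auto
      moreover have "A3 \<sqsubseteq>b A1" using fiber_bsub[of A3 A1] A A3 S by auto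
      ultimately show "\<exists>A3\<in>bover (restrict_br B S) A. A3 \<sqsubset>b A1 \<and> u \<in> last A3"
        by (intro bexI[of _ A3]) (auto simp: bov)
    qed
    show "\<forall>A1\<in>brs (restrict_br B S). \<forall>A2\<in>brs (restrict_br B S). A1 \<noteq> A2 \<longrightarrow>
        bcomp (restrict_br B S) A1 A2 =
        (length A1 = length A2 \<and> butlast A1 = butlast A2 \<and> last A1 \<inter> last A2 = {})"
    proof (intro ballI impI)
      fix A1 A2 assume A: "A1 \<in> brs (restrict_br B S)" "A2 \<in> brs (restrict_br B S)"
      then have "length A1 = length A2" if "butlast A1 = butlast A2"
        using brs_ne S that by (metis append_butlast_last_id length_append_singleton brs_restrict subsetD)
      then show "bcomp (restrict_br B S) A1 A2 =
        (length A1 = length A2 \<and> butlast A1 = butlast A2 \<and> last A1 \<inter> last A2 = {})"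
        using A bc[of A1 A2] bcomp_iff[of A1 A2] S by auto
    qed
    show "\<forall>u\<in>tverts T. \<forall>u1\<in>ch T u. \<forall>u2\<in>ch T u. (u1, u2) \<in> tsib T \<longrightarrow>
        (sing_br T u1, sing_br T u2) \<in> bless (restrict_br B S)"
      using sing_less tr by (auto simp: triv_def in_ch)
    show "\<forall>k<depth T. \<forall>A\<in>blev (restrict_br B S) k. \<forall>A'\<in>blev (restrict_br B S) k. A' \<sqsubseteq>b A \<longrightarrow>
        (\<forall>A1\<in>bover (restrict_br B S) A. \<forall>A2\<in>bover (restrict_br B S) A.
         \<forall>A1'\<in>bover (restrict_br B S) A'. \<forall>A2'\<in>bover (restrict_br B S) A'.
           A1 \<noteq> A2 \<longrightarrow> bcomp (restrict_br B S) A1 A2 \<longrightarrow> A1' \<noteq> A2' \<longrightarrow>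
           bcomp (restrict_br B S) A1' A2' \<longrightarrow> A1' \<sqsubseteq>b A1 \<longrightarrow> A2' \<sqsubseteq>b A2 \<longrightarrow>
           ((A1, A2) \<in> bless (restrict_br B S) \<longleftrightarrow> (A1', A2') \<in> bless (restrict_br B S)))"
    proof (intro allI ballI impI)
      fix k A A' A1 A2 A1' A2'
      assume "A1 \<in> bover (restrict_br B S) A" "A2 \<in> bover (restrict_br B S) A"
        "A1' \<in> bover (restrict_br B S) A'" "A2' \<in> bover (restrict_br B S) A'"
        and c: "bcomp (restrict_br B S) A1 A2" "bcomp (restrict_br B S) A1' A2'"
        and s: "A1' \<sqsubseteq>b A1" "A2' \<sqsubseteq>b A2"
      then have i: "A1 \<in> S" "A2 \<in> S" "A1' \<in> S" "A2' \<in> S" by (auto simp: bov)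
      have "(A1, A2) \<in> bless B \<longleftrightarrow> (A1', A2') \<in> bless B"
        by (rule bless_sub) (use c s i in \<open>auto simp: bcomp_def\<close>)
      then show "(A1, A2) \<in> bless (restrict_br B S) \<longleftrightarrow> (A1', A2') \<in> bless (restrict_br B S)"
        using i by auto
    qed
  qed
qed

text \<open>A maximum bracket meets every bracket of its fibre and is thus comparable with none, and
  singletons are ordered by (5b). So all bracketings agree on trivial brackets, which is why a
  minimum exists.\<close>

lemma triv_bless:
  assumes A: "A1 \<in> triv T" "A2 \<in> triv T"
  shows "(A1, A2) \<in> bless B \<longleftrightarrow>
    (\<exists>u a b. a \<in> ch T u \<and> b \<in> ch T u \<and> (a, b) \<in> tsib T \<and> A1 = sing_br T a \<and> A2 = sing_br T b)"
proof
  assume l: "(A1, A2) \<in> bless B"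
  note d = blessD[OF l]
  have nm: "A \<notin> max_br T ` {..depth T}" if "A \<in> brs B" "A' \<in> brs B" "butlast A = butlast A'" "last A \<inter> last A' = {}" for A A'
  proof
    assume "A \<in> max_br T ` {..depth T}"
    then obtain k where k: "A = max_br T k" by blast
    have "length A' = length A" using that brs_ne by (metis append_butlast_last_id length_append_singleton)
    then have "last A' \<subseteq> last A" using brs_level[OF that(2), of k] k by simp
    then show False using that brs_ex by blast
  qed
  obtain a where a: "a \<in> tverts T" "A1 = sing_br T a" using A nm[of A1 A2] d by (auto simp: triv_def)
  have "A2 \<notin> max_br T ` {..depth T}" using nm[of A2 A1] d by (simp add: inf_commute)
  then obtain b where b: "b \<in> tverts T" "A2 = sing_br T b" using A by (auto simp: triv_def)
  have "a \<noteq> b" using d a b by auto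
  have len: "length A1 = length A2" using d brs_ne by (metis append_butlast_last_id length_append_singleton)
  then have "rdist T a = rdist T b" using a b by simp
  then have nr: "a \<noteq> troot T" "b \<noteq> troot T" using rdist_0_iff a b \<open>a \<noteq> b\<close> by (metis rdist_root)+
  then have "sing_br T (tpar T a) = sing_br T (tpar T b)" using d a b butlast_sing_br by metis
  then have "tpar T a = tpar T b" using sing_br_inj by blast
  then have "a \<in> ch T (tpar T a)" "b \<in> ch T (tpar T a)" using nr a b by (auto simp: in_ch)
  then show "\<exists>u a b. a \<in> ch T u \<and> b \<in> ch T u \<and> (a, b) \<in> tsib T \<and> A1 = sing_br T a \<and> A2 = sing_br T b"
    using sing_less l a b by blast
qed (use sing_less in blast)

lemma butlast_max: "k \<le> depth T \<Longrightarrow> butlast (max_br T k) \<noteq> [] \<Longrightarrow> \<exists>j. k = Suc j \<and> butlast (max_br T k) = max_br T j"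
  by (cases k) (auto simp: max_br_0 max_br_Suc)

lemma triv_butlast: "A \<in> triv T \<Longrightarrow> butlast A \<noteq> [] \<Longrightarrow> butlast A \<in> triv T"
proof -
  assume A: "A \<in> triv T" "butlast A \<noteq> []"
  show ?thesis
  proof (cases "A \<in> sing_br T ` tverts T")
    case True
    then obtain u where u: "u \<in> tverts T" "A = sing_br T u" by blast
    then have "u \<noteq> troot T" using A sing_br_root by fastforce
    then show ?thesis using u butlast_sing_br par_in by (auto simp: triv_def)
  next
    case False
    then obtain k where "k \<le> depth T" "A = max_br T k" using A by (auto simp: triv_def)
    then show ?thesis using A butlast_max by (fastforce simp: triv_def)
  qed
qed

lemma triv_cover:
  assumes P: "P \<in> triv T" "u \<in> last P" "v \<in> ch T u"
  shows "\<exists>D \<in> triv T. butlast D = P \<and> v \<in> last D"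
proof (cases "P \<in> sing_br T ` tverts T")
  case True
  then have "P = sing_br T u" using P by auto
  then have "butlast (sing_br T v) = P" using P butlast_sing_br by (auto simp: in_ch)
  then show ?thesis using P by (intro bexI[of _ "sing_br T v"]) (auto simp: triv_def in_ch)
next
  case False
  then obtain k where k: "k \<le> depth T" "P = max_br T k" using P by (auto simp: triv_def)
  then have v: "v \<in> level T (Suc k)" using P level_ch[of u k v] by auto
  then have "max_br T (Suc k) \<in> triv T" using level_le_depth[OF v] unfolding triv_def by blast
  then show ?thesis using k v
    by (intro bexI[of _ "max_br T (Suc k)"]) (auto simp: max_br_Suc)
qed

text \<open>Over a singleton bracket, singletons always witness (4b).\<close>

lemma sing_sub:
  assumes A: "A1 \<in> brs B" "A2 \<in> brs B" "butlast A1 = butlast A2" "last A2 \<subset> last A1" "u \<in> last A1"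
    and P: "is_singleton_br T (butlast A1)"
  shows "butlast (sing_br T u) = butlast A1" "last (sing_br T u) \<subset> last A1" "sing_br T u \<in> triv T"
proof -
  obtain w where w: "w \<in> tverts T" "butlast A1 = sing_br T w" using P by (auto simp: is_sing_iff)
  then have "u \<in> ch T w" using brs_butlast(3)[OF A(1) _ A(5)] by (metis last_sing_br singletonD sing_br_ne)
  then show "butlast (sing_br T u) = butlast A1" "sing_br T u \<in> triv T"
    using w butlast_sing_br by (auto simp: in_ch triv_def)
  have "last A1 \<noteq> {u}"
  proof
    assume "last A1 = {u}"
    then show False using A(4) brs_ex[OF A(2)] by auto
  qed
  then show "last (sing_br T u) \<subset> last A1" using A(5) by auto
qed

lemma butlast_sing:
  assumes "is_singleton_br T A" "butlast A \<noteq> []"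
  shows "is_singleton_br T (butlast A)"
proof -
  obtain u where u: "u \<in> tverts T" "A = sing_br T u" using assms by (auto simp: is_sing_iff)
  then have "u \<noteq> troot T" using assms sing_br_root by fastforce
  then show ?thesis using u butlast_sing_br par_in by (auto simp: is_sing_iff)
qed

lemma triv_max: "A \<in> triv T \<Longrightarrow> \<not> is_singleton_br T A \<Longrightarrow> \<exists>k \<le> depth T. A = max_br T k"
  by (auto simp: triv_def is_sing_iff)

lemma max_last: "A \<in> brs B \<Longrightarrow> butlast A = butlast (max_br T k) \<Longrightarrow> last A \<subseteq> last (max_br T k)"
proof -
  assume A: "A \<in> brs B" "butlast A = butlast (max_br T k)"
  then have "length A = Suc k" using brs_ne by (metis append_butlast_last_id length_append_singleton length_max_br max_br_ne)
  then show ?thesis using brs_level A by simp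
qed

lemma bmin_bracketing: "n_bracketing T (restrict_br B (triv T))"
proof (rule sub_bracketing)
  show "triv T \<subseteq> brs B" using triv_in by blast
  fix A1 A2 u
  assume A: "A1 \<in> triv T" "A2 \<in> triv T" "butlast A1 = butlast A2" "last A2 \<subset> last A1" "u \<in> last A1"
  have A2s: "is_singleton_br T A2"
  proof (rule ccontr)
    assume "\<not> is_singleton_br T A2"
    then obtain k where "k \<le> depth T" "A2 = max_br T k" using triv_max A by blast
    then show False using max_last[of A1 k] triv_in A by auto
  qed
  have ne: "butlast A1 \<noteq> []" using brs_butlast_nil triv_in A by (metis psubset_eq)
  then have "is_singleton_br T (butlast A1)" using butlast_sing[OF A2s] A by simp
  then show "\<exists>A3 \<in> triv T. butlast A3 = butlast A1 \<and> last A3 \<subset> last A1 \<and> u \<in> last A3"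
    using sing_sub[of A1 A2 u] A triv_in by (intro bexI[of _ "sing_br T u"]) auto
qed (use triv_butlast triv_cover in auto)

lemma bmin_eq: "bmin T = restrict_br B (triv T)"
proof -
  have least: "restrict_br B (triv T) \<preceq> B'" if "B' \<in> assoc T" for B'
  proof -
    interpret B': brk T B' using that brkI by (simp add: assoc_def)
    show ?thesis
      using triv_bless B'.triv_bless B'.triv_in unfolding ble_def by auto
  qed
  show ?thesis unfolding bmin_def
  proof (rule the_equality)
    show "restrict_br B (triv T) \<in> assoc T \<and> (\<forall>B'\<in>assoc T. restrict_br B (triv T) \<preceq> B')"
      using least bmin_bracketing by (simp add: assoc_def)
    fix B1 assume "B1 \<in> assoc T \<and> (\<forall>B'\<in>assoc T. B1 \<preceq> B')"
    then show "B1 = restrict_br B (triv T)"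
      using least bmin_bracketing ble_antisym by (auto simp: assoc_def)
  qed
qed

lemma brs_bmin: "brs (bmin T) = triv T"
  and bmin_le: "bmin T \<preceq> B"
  using bmin_eq restrict_ble[of "triv T" B] triv_in by auto

text \<open>For (4b) in the union, let \<open>A2\<close> come from \<open>C\<close>, one of the two
  bracketings. The minimal bracket of \<open>C\<close> through \<open>u\<close> lies strictly inside
  \<open>A1\<close>: otherwise it would contain \<open>A1\<close>, hence properly contain
  \<open>A2\<close>, against minimality. That the union is least rests on
  \<open>bless_cross\<close>, as the order between a bracket of \<open>B1\<close> and one of
  \<open>B2\<close> is forced.\<close>

lemma join:
  assumes B1: "n_bracketing T B1" "B1 \<preceq> B" and B2: "n_bracketing T B2" "B2 \<preceq> B"
  shows "bjoin T B1 B2 = restrict_br B (brs B1 \<union> brs B2)" 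
    and "n_bracketing T (restrict_br B (brs B1 \<union> brs B2))"
proof -
  interpret B1: brk T B1 using B1 brkI by simp
  interpret B2: brk T B2 using B2 brkI by simp
  let ?J = "restrict_br B (brs B1 \<union> brs B2)"
  have sub: "brs B1 \<union> brs B2 \<subseteq> brs B" using B1 B2 ble_brs by blast
  have spl: "\<exists>A3 \<in> brs C. butlast A3 = butlast A1 \<and> last A3 \<subset> last A1 \<and> u \<in> last A3"
    if C: "n_bracketing T C" "C \<preceq> B" and A: "A1 \<in> brs B" "A2 \<in> brs C"
      "butlast A1 = butlast A2" "last A2 \<subset> last A1" "u \<in> last A1" for C A1 A2 u
  proof -
    interpret C: brk T C using C brkI by simp
    have CB: "A \<in> brs B" if "A \<in> brs C" for A using C ble_brs that by blast
    have ne: "butlast A1 \<noteq> []" using brs_butlast_nil A CB by (metis psubset_eq)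
    have "tpar T u \<in> last (butlast A1)" "u \<in> ch T (tpar T u)"
      using brs_butlast(3)[OF A(1) ne A(5)] by auto
    moreover have "butlast A1 \<in> brs C" using C.brs_butlast(1)[OF A(2)] ne A by simp
    ultimately obtain m where m: "minel C m" "butlast m = butlast A1" "u \<in> last m"
      using C.min_elt by metis
    then have mC: "m \<in> brs C" by (simp add: minel_def)
    have "last m \<subset> last A1"
    proof (rule ccontr)
      assume "\<not> last m \<subset> last A1"
      then have "last A1 \<subseteq> last m" using fiber_nested[of m A1 u] CB[OF mC] A m by auto
      then have s: "last A2 \<subset> last m" using A by blast
      then have "last A2 \<inter> last m \<noteq> {}" using C.brs_ex[OF A(2)] by blast
      then have "last m \<subseteq> last A2" using m A unfolding minel_def by metis
      then show False using s by blast
    qed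
    then show ?thesis using m mC by blast
  qed
  show nbJ: "n_bracketing T ?J"
  proof (rule sub_bracketing[OF sub])
    fix A1 A2 u
    assume A: "A1 \<in> brs B1 \<union> brs B2" "A2 \<in> brs B1 \<union> brs B2" "butlast A1 = butlast A2"
      "last A2 \<subset> last A1" "u \<in> last A1"
    then show "\<exists>A3 \<in> brs B1 \<union> brs B2. butlast A3 = butlast A1 \<and> last A3 \<subset> last A1 \<and> u \<in> last A3"
      using spl[OF B1, of A1 A2 u] spl[OF B2, of A1 A2 u] sub by blast
  next
    fix P u v assume "P \<in> brs B1 \<union> brs B2" "u \<in> last P" "v \<in> ch T u"
    then show "\<exists>D \<in> brs B1 \<union> brs B2. butlast D = P \<and> v \<in> last D"
      using B1.cover[of P u v] B2.cover[of P u v] by blast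
  qed (use B1.triv_in B1.brs_butlast B2.brs_butlast in blast)+
  have up: "B1 \<preceq> ?J" "B2 \<preceq> ?J" using B1 B2 by (auto simp: ble_def)
  have least: "?J \<preceq> J'" if J': "J' \<in> assoc T" "B1 \<preceq> J'" "B2 \<preceq> J'" for J'
  proof -
    have nJ: "n_bracketing T J'" using J' by (simp add: assoc_def)
    have s: "A \<in> brs J'" if "A \<in> brs B1 \<union> brs B2" for A using that J' ble_brs by blast
    have iff: "(A1, A2) \<in> bless B \<longleftrightarrow> (A1, A2) \<in> bless J'"
      if A: "A1 \<in> brs B1 \<union> brs B2" "A2 \<in> brs B1 \<union> brs B2" for A1 A2
      using A(1)
    proof
      assume i: "A1 \<in> brs B1"
      show ?thesis
        using bless_cross(1)[OF B1(1) nb nJ B1(2) J'(2) i s[OF A(2)]]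
          bless_cross(1)[OF B1(1) nJ nb J'(2) B1(2) i] A sub by blast
    next
      assume i: "A1 \<in> brs B2"
      show ?thesis
        using bless_cross(1)[OF B2(1) nb nJ B2(2) J'(3) i s[OF A(2)]]
          bless_cross(1)[OF B2(1) nJ nb J'(3) B2(2) i] A sub by blast
    qed
    show ?thesis unfolding ble_def
    proof
      show "brs ?J \<subseteq> brs J'" using s by auto
      show "bless ?J = Restr (bless J') (brs ?J)" using iff by auto
    qed
  qed
  show "bjoin T B1 B2 = ?J" unfolding bjoin_def
  proof (rule the_equality)
    show "?J \<in> assoc T \<and> B1 \<preceq> ?J \<and> B2 \<preceq> ?J \<and> (\<forall>J'\<in>assoc T. B1 \<preceq> J' \<longrightarrow> B2 \<preceq> J' \<longrightarrow> ?J \<preceq> J')"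
      using nbJ up least by (simp add: assoc_def)
    fix J assume "J \<in> assoc T \<and> B1 \<preceq> J \<and> B2 \<preceq> J \<and> (\<forall>J'\<in>assoc T. B1 \<preceq> J' \<longrightarrow> B2 \<preceq> J' \<longrightarrow> J \<preceq> J')"
    then show "J = ?J" using nbJ up least by (intro ble_antisym) (auto simp: assoc_def)
  qed
qed


end

section \<open>Flows and metric bracketings across sub-bracketings\<close>

context brk
begin

lemma butlast_pow_in: "E \<in> brs B \<Longrightarrow> (butlast ^^ i) E \<noteq> [] \<Longrightarrow> (butlast ^^ i) E \<in> brs B"
proof (induction i)
  case (Suc i)
  then have "(butlast ^^ i) E \<noteq> []" by auto
  then show ?case using Suc brs_butlast(1)[of "(butlast ^^ i) E"] by simp
qed simp

text \<open>A witness in \<open>B\<close> can be replaced by the minimal bracket of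
  \<open>B'\<close> through the same ancestor of \<open>u\<close>, by \<open>bless_transfer\<close>.
  This makes the coefficients \<open>gco\<close> independent of the ambient bracketing.\<close>

lemma eprec_sub:
  assumes "n_bracketing T B'" "B' \<preceq> B" "E \<in> brs B'"
  shows "eprec T B' E u \<longleftrightarrow> eprec T B E u"
proof
  interpret B': brk T B' using assms brkI by simp
  show "eprec T B' E u \<Longrightarrow> eprec T B E u"
    using assms ble_brs ble_bless B'.bless_brs unfolding eprec_def by metis
  assume "eprec T B E u"
  then obtain i A where A: "A \<in> brs B" "(tpar T ^^ i) u \<in> last A" "((butlast ^^ i) E, A) \<in> bless B"
    by (auto simp: eprec_def)
  let ?E = "(butlast ^^ i) E" and ?v = "(tpar T ^^ i) u"
  note d = blessD[OF A(3)]
  have E: "?E \<in> brs B'" using B'.butlast_pow_in[OF assms(3)] brs_ne d by blast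
  have ne: "butlast ?E \<noteq> []" using brs_butlast_nil d bless_irrefl A(3) by metis
  then have P: "butlast ?E \<in> brs B'" using B'.brs_butlast E by blast
  have "?v \<in> ch T (tpar T ?v)" "tpar T ?v \<in> last (butlast ?E)"
    using brs_butlast(3)[of A ?v] d A ne by auto
  then obtain m where m: "minel B' m" "butlast m = butlast ?E" "?v \<in> last m"
    using B'.min_elt[OF P] by metis
  then have mB': "m \<in> brs B'" by (simp add: minel_def)
  have disj: "last ?E \<inter> last m = {}"
    using B'.minel_disj[OF m(1) E] m d A by auto
  obtain x where x: "x \<in> last ?E" using brs_ex d by blast
  have "(?E, m) \<in> bless B"
    by (rule bless_transfer[OF A(3) _ _ _ disj x x A(2) m(3)]) (use d m mB' assms ble_brs in auto)
  then have "(?E, m) \<in> bless B'" using E mB' ble_bless[OF assms(2)] by blast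
  then show "eprec T B' E u" unfolding eprec_def using m mB' by blast
qed

text \<open>Extension by zero: over a bracket of \<open>B'\<close> the two sums agree, and over any
  other bracket all terms vanish because \<open>B'\<close> is closed under truncation.\<close>

lemma flow_restrict:
  assumes B': "n_bracketing T B'" "B' \<preceq> B" and l: "\<And>A. A \<notin> brs B' \<Longrightarrow> l A = 0"
  shows "flow T B' l \<longleftrightarrow> flow T B l"
proof -
  interpret B': brk T B' using assms brkI by simp
  have sub: "A \<in> brs B" if "A \<in> brs B'" for A using B' ble_brs that by blast
  have eq: "(\<Sum>D | D \<in> brs B' \<and> butlast D = P \<and> v \<in> last D. l D)
     = (\<Sum>D | D \<in> brs B \<and> butlast D = P \<and> v \<in> last D. l D)" for P v
    by (rule sum.mono_neutral_left) (use finite_brs sub l in auto)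
  show ?thesis
  proof
    assume f: "flow T B' l"
    show "flow T B l" unfolding flow_def
    proof (intro conjI ballI impI allI)
      fix P u v assume P: "P \<in> brs B" "\<not> is_singleton_br T P" "u \<in> last P" "v \<in> ch T u"
      show "l P = (\<Sum>D | D \<in> brs B \<and> butlast D = P \<and> v \<in> last D. l D)"
      proof (cases "P \<in> brs B'")
        case True
        show ?thesis using flow_sum[OF f True P(2,3,4)] unfolding eq .
      next
        case False
        have "l D = 0" if "D \<in> brs B" "butlast D = P" for D
        proof (rule l)
          show "D \<notin> brs B'" using B'.brs_butlast(1)[of D] that False brs_ne[OF P(1)] by auto
        qed
        then have "(\<Sum>D | D \<in> brs B \<and> butlast D = P \<and> v \<in> last D. l D) = 0"
          by (intro sum.neutral) auto
        then show ?thesis using l[OF False] by simp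
      qed
    qed (use f l sub in \<open>auto simp: flow_def\<close>)
  next
    assume f: "flow T B l"
    show "flow T B' l" unfolding flow_def eq
      using f l sub by (simp add: flow_def)
  qed
qed

lemma chain_set:
  assumes A: "A \<in> bover B P" "A' \<in> bover B P" "\<forall>D \<in> bover B P. \<not> A \<sqsubset>b D" "\<forall>D \<in> bover B P. \<not> D \<sqsubset>b A'"
    "A' \<sqsubseteq>b A" and v: "v \<in> last A'"
  shows "{D \<in> bover B P. A' \<sqsubseteq>b D \<and> D \<sqsubseteq>b A} = {D \<in> brs B. butlast D = P \<and> v \<in> last D}"
proof -
  have vA: "v \<in> last A" using A v fiber_bsub by (auto simp: bover_eq)
  have "A' \<sqsubseteq>b D \<and> D \<sqsubseteq>b A" if D: "D \<in> brs B" "butlast D = P" "v \<in> last D" for D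
  proof
    have Db: "D \<in> bover B P" using D by (simp add: bover_eq)
    have i: "A \<in> brs B" "A' \<in> brs B" using A by (auto simp: bover_eq)
    show "A' \<sqsubseteq>b D" using nested[OF i(2) D(1) v D(3)] A(4) Db bsub_refl by metis
    show "D \<sqsubseteq>b A" using nested[OF i(1) D(1) vA D(3)] A(3) Db bsub_refl by metis
  qed
  moreover have "v \<in> last D" if "D \<in> bover B P" "A' \<sqsubseteq>b D" for D
    using that A v fiber_bsub by (auto simp: bover_eq)
  ultimately show ?thesis by (auto simp: bover_eq)
qed

text \<open>The metric condition indexes chains by their ends, a flow by a vertex. A vertex of the
  lower end gives one direction; for the other, the ends of the chain of \<open>v\<close> are the
  minimal bracket through \<open>v\<close> and one of largest top part.\<close>

lemma metric_iff: "metric T (B, l) \<longleftrightarrow> flow T B l \<and> (\<forall>A \<in> brs B. A \<notin> triv T \<longrightarrow> l A > 0)"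
proof -
  have "(\<forall>u \<in> last P. \<forall>v \<in> ch T u. l P = (\<Sum>D | D \<in> brs B \<and> butlast D = P \<and> v \<in> last D. l D)) \<longleftrightarrow>
    (\<forall>A \<in> bover B P. \<forall>A' \<in> bover B P.
       (\<forall>D \<in> bover B P. \<not> A \<sqsubset>b D) \<longrightarrow> (\<forall>D \<in> bover B P. \<not> D \<sqsubset>b A') \<longrightarrow> A' \<sqsubseteq>b A \<longrightarrow>
       l P = (\<Sum>D \<in> {D \<in> bover B P. A' \<sqsubseteq>b D \<and> D \<sqsubseteq>b A}. l D))" (is "?L \<longleftrightarrow> ?R")
    if P: "P \<in> brs B" for P
  proof
    assume L: ?L
    show ?R
    proof (intro ballI impI)
      fix A A' assume A: "A \<in> bover B P" "A' \<in> bover B P" "\<forall>D \<in> bover B P. \<not> A \<sqsubset>b D" "\<forall>D \<in> bover B P. \<not> D \<sqsubset>b A'"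
        "A' \<sqsubseteq>b A"
      have A': "A' \<in> brs B" "butlast A' = P" using A by (auto simp: bover_eq)
      obtain v where v: "v \<in> last A'" using brs_ex A' by blast
      then have "v \<in> ch T (tpar T v)" "tpar T v \<in> last P"
        using brs_butlast(3)[OF A'(1)] A' brs_ne[OF P] by auto
      then show "l P = (\<Sum>D \<in> {D \<in> bover B P. A' \<sqsubseteq>b D \<and> D \<sqsubseteq>b A}. l D)"
        unfolding chain_set[OF A v] using L by blast
    qed
  next
    assume R: ?R
    show ?L
    proof (intro ballI)
      fix u v assume u: "u \<in> last P" "v \<in> ch T u"
      obtain m where m: "minel B m" "butlast m = P" "v \<in> last m" using min_elt[OF P u] .
      then have mB: "m \<in> brs B" by (simp add: minel_def)
      let ?F = "{D \<in> brs B. butlast D = P \<and> v \<in> last D}"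
      have fin: "finite ((\<lambda>D. card (last D)) ` ?F)" using finite_brs by simp
      have ne: "(\<lambda>D. card (last D)) ` ?F \<noteq> {}" using m mB by blast
      obtain A where A: "A \<in> ?F" "\<And>D. D \<in> ?F \<Longrightarrow> card (last D) \<le> card (last A)"
      proof -
        obtain A where "A \<in> ?F" "card (last A) = Max ((\<lambda>D. card (last D)) ` ?F)"
          using Max_in[OF fin ne] by fastforce
        then show ?thesis using that[of A] Max_ge[OF fin] by simp
      qed
      have i: "A \<in> bover B P" "m \<in> bover B P" using A m mB by (auto simp: bover_eq)
      have mx: "\<not> A \<sqsubset>b D" if "D \<in> bover B P" for D
      proof
        assume s: "A \<sqsubset>b D"
        have D: "D \<in> brs B" "butlast D = P" using that by (auto simp: bover_eq)
        then have "last A \<subset> last D" using s A fiber_bsub[of A D] fiber_eq[of A D] by auto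
        then have "card (last A) < card (last D)" "D \<in> ?F"
          using finite_last D A by (auto simp: psubset_card_mono)
        then show False using A(2)[of D] by simp
      qed
      have mn: "\<not> D \<sqsubset>b m" if "D \<in> bover B P" for D
      proof
        assume s: "D \<sqsubset>b m"
        have D: "D \<in> brs B" "butlast D = P" using that by (auto simp: bover_eq)
        then have "last D \<subset> last m" using s m mB fiber_bsub[of D m] fiber_eq[of D m] by auto
        then show False using m D brs_ex[OF D(1)] unfolding minel_def by blast
      qed
      have "last A \<inter> last m \<noteq> {}" using A m by blast
      then have "last m \<subseteq> last A" using m A unfolding minel_def by simp
      then have mA: "m \<sqsubseteq>b A" using m mB A fiber_bsub[of m A] by simp
      have "l P = (\<Sum>D \<in> {D \<in> bover B P. m \<sqsubseteq>b D \<and> D \<sqsubseteq>b A}. l D)"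
        by (rule R[rule_format, OF i _ _ mA]) (use mx mn in auto)
      then show "l P = (\<Sum>D | D \<in> brs B \<and> butlast D = P \<and> v \<in> last D. l D)"
        by (subst (asm) chain_set[OF i _ _ mA m(3)]) (use mx mn in auto)
    qed
  qed
  moreover have "B \<in> assoc T" using nb by (simp add: assoc_def)
  ultimately show ?thesis
    unfolding metric_def flow_def by (simp add: nontrivial_iff) blast
qed

text \<open>The flow equations give all existence axioms for the support. As nontrivial values
  cannot cancel, a positive value on \<open>A\<close> forces one on a nontrivial
  \<open>butlast A\<close>; a nonzero \<open>l P\<close> reaches every child above \<open>P\<close>.
  For (4b), the chains of two vertices of \<open>A1\<close> have equal totals and share the part
  from \<open>A1\<close> upwards, so their sums strictly inside \<open>A1\<close> agree.\<close>

lemma supp_br_nb: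
  assumes l: "pflow T B l"
  shows "n_bracketing T (supp_br T B l)" "supp_br T B l \<preceq> B"
proof -
  let ?S = "{A \<in> brs B. l A \<noteq> 0} \<union> triv T"
  have f: "flow T B l" and pos: "\<And>A. A \<in> brs B \<Longrightarrow> A \<notin> triv T \<Longrightarrow> l A \<ge> 0"
    using l by (auto simp: pflow_def)
  have sub: "?S \<subseteq> brs B" using triv_in by blast
  have fin: "finite {D \<in> brs B. Q D}" for Q using finite_brs by simp
  have nt: "D \<notin> triv T" if "D \<in> brs B" "butlast D = P" "P \<notin> triv T" "P \<noteq> []" for D P
    using triv_butlast that by blast
  show "n_bracketing T (supp_br T B l)" unfolding supp_br_def
  proof (rule sub_bracketing[OF sub])
    fix A assume A: "A \<in> ?S" "butlast A \<noteq> []"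
    show "butlast A \<in> ?S"
    proof (cases "A \<in> triv T \<or> butlast A \<in> triv T")
      case True
      then show ?thesis using triv_butlast A by blast
    next
      case False
      then have a: "A \<in> brs B" "l A \<noteq> 0" and P: "butlast A \<in> brs B" "\<not> is_singleton_br T (butlast A)"
        using A brs_butlast(1) by (auto simp: triv_def is_sing_iff)
      obtain v where v: "v \<in> last A" using brs_ex a by blast
      then have u: "v \<in> ch T (tpar T v)" "tpar T v \<in> last (butlast A)"
        using brs_butlast(3)[OF a(1) A(2)] by auto
      have "l (butlast A) = (\<Sum>D | D \<in> brs B \<and> butlast D = butlast A \<and> v \<in> last D. l D)"
        using flow_sum[OF f P u(2,1)] .
      also have "\<dots> \<ge> l A"
        by (rule member_le_sum) (use a v fin pos nt False A in auto)
      finally have "l (butlast A) > 0" using a pos[of A] False by auto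
      then show ?thesis using P by auto
    qed
  next
    fix P u v assume P: "P \<in> ?S" "u \<in> last P" "v \<in> ch T u"
    show "\<exists>D \<in> ?S. butlast D = P \<and> v \<in> last D"
    proof (cases "P \<in> triv T")
      case True
      then show ?thesis using triv_cover P by blast
    next
      case False
      then have "P \<in> brs B" "\<not> is_singleton_br T P" "l P \<noteq> 0" using P by (auto simp: triv_def is_sing_iff)
      then have "(\<Sum>D | D \<in> brs B \<and> butlast D = P \<and> v \<in> last D. l D) \<noteq> 0"
        using flow_sum[OF f _ _ P(2,3)] by simp
      then obtain D where "D \<in> {D. D \<in> brs B \<and> butlast D = P \<and> v \<in> last D}" "l D \<noteq> 0"
        by (rule sum.not_neutral_contains_not_neutral)
      then show ?thesis by auto
    qed
  next
    fix A1 A2 u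
    assume A: "A1 \<in> ?S" "A2 \<in> ?S" "butlast A1 = butlast A2" "last A2 \<subset> last A1" "u \<in> last A1"
    then have i: "A1 \<in> brs B" "A2 \<in> brs B" using triv_in by auto
    have ne: "butlast A1 \<noteq> []" using brs_butlast_nil i A by (metis psubset_eq)
    show "\<exists>A3 \<in> ?S. butlast A3 = butlast A1 \<and> last A3 \<subset> last A1 \<and> u \<in> last A3"
    proof (cases "is_singleton_br T (butlast A1)")
      case True
      note ss = sing_sub[OF i A(3,4,5) True]
      show ?thesis by (rule bexI[of _ "sing_br T u"]) (use ss in simp_all)
    next
      case False
      let ?P = "butlast A1"
      \<comment> \<open>A trivial bracket here would be a singleton, whose truncation is a
        singleton, or a maximum bracket, which contains \<open>A1\<close>; so every summand strictly
        inside \<open>A1\<close> is nonnegative.\<close>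
      have nt2: "D \<notin> triv T" if D: "D \<in> brs B" "butlast D = ?P" "last D \<subset> last A1" for D
      proof
        assume "D \<in> triv T"
        moreover have "\<not> is_singleton_br T D" using butlast_sing[of D] False D ne by auto
        ultimately obtain k where "D = max_br T k" using triv_max by blast
        then show False using max_last[OF i(1), of k] D by auto
      qed
      have P: "?P \<in> brs B" using brs_butlast(1)[OF i(1) ne] .
      obtain v where v: "v \<in> last A2" using brs_ex i by blast
      have vA: "v \<in> last A1" using v A by blast
      let ?F = "\<lambda>x. {D. D \<in> brs B \<and> butlast D = ?P \<and> x \<in> last D}"
      \<comment> \<open>By nestedness, the chain of a vertex \<open>x\<close> of \<open>A1\<close>
        splits into \<open>?G\<close>, which is the same for all such \<open>x\<close>, and
        \<open>?H x\<close>.\<close>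
      let ?G = "{D \<in> brs B. butlast D = ?P \<and> last A1 \<subseteq> last D}"
      let ?H = "\<lambda>x. {D \<in> brs B. butlast D = ?P \<and> last D \<subset> last A1 \<and> x \<in> last D}"
      have eq: "l ?P = (\<Sum>D\<in>?G. l D) + (\<Sum>D\<in>?H x. l D)" if x: "x \<in> last A1" for x
      proof -
        have "l ?P = (\<Sum>D\<in>?F x. l D)"
          using flow_sum[OF f P False] brs_butlast(3)[OF i(1) ne x] by blast
        also have "?F x = ?G \<union> ?H x"
        proof -
          have "last A1 \<subseteq> last D \<or> last D \<subset> last A1" if "D \<in> ?F x" for D
            using fiber_nested[OF i(1), of D x] x that by auto
          then show ?thesis using x by blast
        qed
        also have "(\<Sum>D\<in>?G \<union> ?H x. l D) = (\<Sum>D\<in>?G. l D) + (\<Sum>D\<in>?H x. l D)"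
          by (rule sum.union_disjoint) (use fin in auto)
        finally show ?thesis .
      qed
      have "l A2 \<le> (\<Sum>D\<in>?H v. l D)"
        by (rule member_le_sum) (use i A v fin pos nt2 in auto)
      moreover have "l A2 > 0" using nt2[of A2] i A pos[of A2] by auto
      ultimately have "(\<Sum>D\<in>?H u. l D) \<noteq> 0" using eq[OF vA] eq[OF A(5)] by simp
      then obtain D where "D \<in> ?H u" "l D \<noteq> 0"
        by (rule sum.not_neutral_contains_not_neutral)
      then show ?thesis by auto
    qed
  qed auto
  show "supp_br T B l \<preceq> B" using sub by (simp add: supp_br_def restrict_ble)
qed

lemma tau_met_iff: "(B', l) \<in> tau_met T B \<longleftrightarrow> pflow T B l \<and> B' = supp_br T B l"
proof
  assume "(B', l) \<in> tau_met T B"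
  then have M: "metric T (B', l)" "B' \<preceq> B" and nb': "n_bracketing T B'"
    by (auto simp: tau_met_def metric_def assoc_def)
  interpret B': brk T B' using nb' brkI by simp
  have f: "flow T B' l" "\<forall>A \<in> brs B'. A \<notin> triv T \<longrightarrow> l A > 0" using M B'.metric_iff by auto
  then have z: "\<And>A. A \<notin> brs B' \<Longrightarrow> l A = 0" by (auto simp: flow_def)
  then have "flow T B l" using flow_restrict[OF nb' M(2)] f by blast
  moreover have "\<forall>A \<in> brs B. A \<notin> triv T \<longrightarrow> l A \<ge> 0" using f z by (metis less_eq_real_def)
  moreover have "brs B' = {A \<in> brs B. l A \<noteq> 0} \<union> triv T"
    using f z B'.triv_in ble_brs[OF M(2)] by fastforce
  then have "B' = supp_br T B l" unfolding supp_br_def using restrict_cong[OF M(2)] by simp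
  ultimately show "pflow T B l \<and> B' = supp_br T B l" by (simp add: pflow_def)
next
  assume a: "pflow T B l \<and> B' = supp_br T B l"
  then have nb': "n_bracketing T B'" and le: "B' \<preceq> B" using supp_br_nb by auto
  interpret B': brk T B' using nb' brkI by simp
  have br: "brs B' = {A \<in> brs B. l A \<noteq> 0} \<union> triv T" using a by (simp add: supp_br_def)
  have f: "flow T B l" using a by (simp add: pflow_def)
  have "flow T B' l"
    by (subst flow_restrict[OF nb' le]) (use br f in \<open>auto simp: flow_def\<close>)
  moreover have "\<forall>A \<in> brs B'. A \<notin> triv T \<longrightarrow> l A > 0"
  proof (intro ballI impI)
    fix A assume A: "A \<in> brs B'" "A \<notin> triv T"
    then have "A \<in> brs B" "l A \<noteq> 0" using br by auto
    then show "l A > 0" using a A(2) unfolding pflow_def by fastforce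
  qed
  ultimately show "(B', l) \<in> tau_met T B"
    using le B'.metric_iff by (simp add: tau_met_def)
qed

lemma pflow_add: "pflow T B l \<Longrightarrow> pflow T B l' \<Longrightarrow> pflow T B (\<lambda>A. l A + l' A)"
  by (simp add: pflow_def flow_add)

lemma pflow_scale: "pflow T B l \<Longrightarrow> t \<ge> 0 \<Longrightarrow> pflow T B (\<lambda>A. t * l A)"
  by (simp add: pflow_def flow_scale)

lemma pflow_0: "pflow T B (\<lambda>A. 0)"
  by (simp add: pflow_def flow_0)

lemma supp_br_0: "supp_br T B (\<lambda>A. 0) = bmin T"
  by (simp add: supp_br_def bmin_eq)

lemma supp_br_scale: "t \<noteq> 0 \<Longrightarrow> supp_br T B (\<lambda>A. t * l A) = supp_br T B l"
  by (simp add: supp_br_def)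

text \<open>Nonnegative values on nontrivial brackets do not cancel, so the support of a sum is the
  union of the supports, which is the join.\<close>

lemma madd_supp:
  assumes "pflow T B l" "pflow T B l'"
  shows "madd T (supp_br T B l, l) (supp_br T B l', l') =
    (supp_br T B (\<lambda>A. l A + l' A), \<lambda>A. l A + l' A)"
proof -
  have nn: "l A \<ge> 0 \<and> l' A \<ge> 0" if "A \<in> brs B" "A \<notin> triv T" for A
    using assms that by (simp add: pflow_def)
  have "l A + l' A \<noteq> 0 \<longleftrightarrow> l A \<noteq> 0 \<or> l' A \<noteq> 0" if "A \<in> brs B" "A \<notin> triv T" for A
    using nn[OF that] by auto
  then have "{A \<in> brs B. l A + l' A \<noteq> 0} \<union> triv T
      = ({A \<in> brs B. l A \<noteq> 0} \<union> triv T) \<union> ({A \<in> brs B. l' A \<noteq> 0} \<union> triv T)"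
    by blast
  then show ?thesis
    using join(1)[OF supp_br_nb[OF assms(1)] supp_br_nb[OF assms(2)]]
    by (simp add: madd_def supp_br_def)
qed

lemma mzero_eq: "mzero T = (supp_br T B (\<lambda>A. 0), \<lambda>A. 0)"
  by (simp add: mzero_def supp_br_0)

end

section \<open>Collisions\<close>

lemma butlast_pow_length: "length ((butlast ^^ j) A) = length A - j"
  by (induction j) auto

text \<open>The shape of the essential brackets of a collision: a tree rooted at \<open>E0\<close>
  whose members over each \<open>P\<close> partition the children of the vertices of
  \<open>P\<close>. Its members become the new vertices of the contracted tree.\<close>

definition cut :: "'v plane_tree \<Rightarrow> 'v bracketing \<Rightarrow> 'v bracket \<Rightarrow> 'v bracket set \<Rightarrow> bool" where
  "cut T C E0 X \<longleftrightarrow> X \<subseteq> brs C \<and> E0 \<in> X \<and> \<not> is_singleton_br T E0 \<and> is_singleton_br T (butlast E0) \<and>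
     (\<forall>E \<in> X. E = E0 \<or> butlast E \<in> X) \<and>
     (\<forall>P \<in> X. \<forall>u \<in> last P. \<forall>v \<in> ch T u. \<exists>!D. D \<in> X \<and> butlast D = P \<and> v \<in> last D)"

text \<open>The children chosen over \<open>P\<close>: the truncation of \<open>A\<close> over \<open>P\<close>, if there is one, and the minimal
  brackets disjoint from it.\<close>

inductive_set cut_through :: "'v bracketing \<Rightarrow> 'v bracket \<Rightarrow> 'v bracket \<Rightarrow> 'v bracket set"
  for C E0 A where
  base: "E0 \<in> cut_through C E0 A"
| path: "(butlast ^^ j) A \<in> brs C \<Longrightarrow> butlast ((butlast ^^ j) A) \<in> cut_through C E0 A \<Longrightarrow>
    (butlast ^^ j) A \<in> cut_through C E0 A"
| min: "minel C D \<Longrightarrow> butlast D \<in> cut_through C E0 A \<Longrightarrow>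
    (\<And>j. (butlast ^^ j) A \<in> brs C \<Longrightarrow> butlast ((butlast ^^ j) A) = butlast D \<Longrightarrow>
       last D \<inter> last ((butlast ^^ j) A) = {}) \<Longrightarrow> D \<in> cut_through C E0 A"

context brk
begin

lemma nonsing_over:
  assumes "E \<in> brs B" "\<not> is_singleton_br T (butlast E)" "butlast E \<noteq> []"
  shows "\<not> is_singleton_br T E"
  using assms butlast_sing by blast

lemma root_sing: "is_singleton_br T [{troot T}]"
  using root_in sing_br_root by (metis is_sing_iff)

text \<open>Repeated truncation ends at the root bracket, which is a singleton; the last truncation
  before singletons begin is the required one.\<close>

lemma ex_fusion:
  "A \<in> brs B \<Longrightarrow> \<not> is_singleton_br T A \<Longrightarrow>
    \<exists>j. (butlast ^^ j) A \<in> brs B \<and> \<not> is_singleton_br T ((butlast ^^ j) A) \<and>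
      is_singleton_br T (butlast ((butlast ^^ j) A))"
proof (induction "length A" arbitrary: A)
  case 0
  then show ?case using brs_ne by auto
next
  case (Suc n)
  have ne: "butlast A \<noteq> []" using Suc.prems brs_butlast_nil root_sing by metis
  then have b: "butlast A \<in> brs B" using brs_butlast Suc.prems by blast
  show ?case
  proof (cases "is_singleton_br T (butlast A)")
    case True
    then show ?thesis using Suc.prems by (intro exI[of _ 0]) simp
  next
    case False
    have "n = length (butlast A)" using Suc.hyps(2) by simp
    then obtain j where "(butlast ^^ j) (butlast A) \<in> brs B \<and> \<not> is_singleton_br T ((butlast ^^ j) (butlast A)) \<and>
      is_singleton_br T (butlast ((butlast ^^ j) (butlast A)))"
      using Suc.hyps(1)[of "butlast A"] b False by blast
    then show ?thesis by (intro exI[of _ "Suc j"]) (simp add: funpow_swap1)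
  qed
qed

lemma cut_nonsing:
  assumes c: "cut T B E0 X" and E: "E \<in> X"
  shows "\<not> is_singleton_br T E \<and> (\<exists>j. (butlast ^^ j) E = E0)"
  using E
proof (induction "length E" arbitrary: E)
  case 0
  then show ?case using c brs_ne by (auto simp: cut_def)
next
  case (Suc n)
  show ?case
  proof (cases "E = E0")
    case True
    then show ?thesis using c by (auto simp: cut_def intro: exI[of _ 0])
  next
    case False
    then have b: "butlast E \<in> X" using c Suc.prems by (auto simp: cut_def)
    then have "\<not> is_singleton_br T (butlast E)" "\<exists>j. (butlast ^^ j) (butlast E) = E0"
      using Suc.hyps(1)[of "butlast E"] Suc.hyps(2) by auto
    moreover have "E \<in> brs B" "butlast E \<noteq> []" using c b Suc.prems brs_ne by (auto simp: cut_def)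
    ultimately show ?thesis using nonsing_over by (metis funpow_Suc_right o_apply)
  qed
qed

lemma cut_trunc:
  assumes c: "cut T B E0 X" and E: "E \<in> X" and len: "length E0 \<le> length E - i"
  shows "(butlast ^^ i) E \<in> X"
  using len
proof (induction i)
  case (Suc i)
  then have i: "(butlast ^^ i) E \<in> X" by simp
  have "length E0 > 0" using c brs_ne by (auto simp: cut_def)
  then have "length ((butlast ^^ i) E) \<noteq> length E0"
    using Suc.prems unfolding butlast_pow_length by linarith
  then have "(butlast ^^ i) E \<noteq> E0" by auto
  then show ?case using c i by (auto simp: cut_def)
qed (use E in simp)

text \<open>At the length of \<open>E0\<close> the cut has no other member; above it, the
  truncations coincide by induction and the unique choice over them decides.\<close>

lemma cut_unique:
  assumes c: "cut T B E0 X"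
  shows "E \<in> X \<Longrightarrow> E' \<in> X \<Longrightarrow> v \<in> last E \<Longrightarrow> v \<in> last E' \<Longrightarrow> E = E'"
proof (induction "length E" arbitrary: E E' v)
  case 0
  then show ?case using c brs_ne by (auto simp: cut_def)
next
  case (Suc n)
  have i: "E \<in> brs B" "E' \<in> brs B" using Suc.prems c by (auto simp: cut_def)
  have len: "length E = length E'" using brs_rdist[of E v] brs_rdist[of E' v] i Suc.prems by simp
  have long: "length D \<ge> length E0" if "D \<in> X" for D
    using cut_nonsing[OF c that] butlast_pow_length[of _ D] by (metis diff_le_self)
  have ne0: "E0 \<noteq> []" using c brs_ne by (auto simp: cut_def)
  have up: "butlast D \<in> X" if "D \<in> X" "length D > length E0" for D
    using c that by (auto simp: cut_def)
  show ?case
  proof (cases "length E = length E0")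
    case True
    have "D = E0" if "D \<in> X" "length D = length E0" for D
    proof (rule ccontr)
      assume "D \<noteq> E0"
      then have "butlast D \<in> X" using c that by (auto simp: cut_def)
      then show False using long[of "butlast D"] that ne0 by (cases E0) auto
    qed
    then show ?thesis using True len Suc.prems by metis
  next
    case False
    then have b: "butlast E \<in> X" "butlast E' \<in> X"
      using up[OF Suc.prems(1)] up[OF Suc.prems(2)] long[OF Suc.prems(1)] len by auto
    then have ne: "butlast E \<noteq> []" "butlast E' \<noteq> []" using c brs_ne by (auto simp: cut_def)
    have p: "v \<in> ch T (tpar T v)" "tpar T v \<in> last (butlast E)" "tpar T v \<in> last (butlast E')"
      using brs_butlast(3)[OF i(1) ne(1) Suc.prems(3)] brs_butlast(3)[OF i(2) ne(2) Suc.prems(4)] by auto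
    have "n = length (butlast E)" using Suc.hyps(2) by simp
    then have "butlast E = butlast E'" using Suc.hyps(1)[of "butlast E" "butlast E'"] b p by blast
    moreover have "\<exists>!D. D \<in> X \<and> butlast D = butlast E \<and> v \<in> last D"
      using c b p by (auto simp: cut_def)
    ultimately show ?thesis using Suc.prems by metis
  qed
qed

text \<open>Over a member of \<open>X\<close> exactly one summand is 1. Over any other nonsingleton
  \<open>P\<close> all are 0, since the only member whose truncation leaves \<open>X\<close> is
  \<open>E0\<close>, and that truncation is a singleton.\<close>

lemma cut_flow:
  assumes c: "cut T B E0 X"
  shows "pflow T B (\<lambda>E. if E \<in> X then 1 else 0)"
proof -
  let ?l = "\<lambda>E. if E \<in> X then 1 else (0::real)"
  have X: "X \<subseteq> brs B" using c by (simp add: cut_def)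
  have "flow T B ?l" unfolding flow_def
  proof (intro conjI allI impI ballI)
    fix P u v assume P: "P \<in> brs B" "\<not> is_singleton_br T P" "u \<in> last P" "v \<in> ch T u"
    let ?F = "{D. D \<in> brs B \<and> butlast D = P \<and> v \<in> last D}"
    have "(\<Sum>D | D \<in> brs B \<and> butlast D = P \<and> v \<in> last D. ?l D) = real (card (?F \<inter> X))"
      using finite_brs by (simp add: sum.If_cases)
    also have "?F \<inter> X = {D. D \<in> X \<and> butlast D = P \<and> v \<in> last D}" using X by blast
    also have "real (card \<dots>) = ?l P"
    proof (cases "P \<in> X")
      case True
      then have "\<exists>!D. D \<in> X \<and> butlast D = P \<and> v \<in> last D" using c P by (auto simp: cut_def)
      then have "card {D. D \<in> X \<and> butlast D = P \<and> v \<in> last D} = 1"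
        by (auto simp: card_1_singleton_iff)
      then show ?thesis using True by simp
    next
      case False
      have "{D. D \<in> X \<and> butlast D = P \<and> v \<in> last D} = {}"
        using c P(2) False by (auto simp: cut_def)
      then show ?thesis using False by (simp only: card.empty) simp
    qed
    finally show "?l P = (\<Sum>D | D \<in> brs B \<and> butlast D = P \<and> v \<in> last D. ?l D)" by simp
  qed (use X cut_nonsing[OF c] in auto)
  then show ?thesis by (simp add: pflow_def)
qed

text \<open>The cut follows the truncations of \<open>A\<close> and is filled up with minimal
  brackets. A minimal bracket through a vertex outside the truncation over the same \<open>P\<close>
  is disjoint from it, so the choices over \<open>P\<close> form a partition.\<close>

lemma ex_cut:
  assumes A: "A \<in> brs B" "\<not> is_singleton_br T A"
  obtains E0 X where "cut T B E0 X" "A \<in> X"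
proof -
  obtain j where j: "(butlast ^^ j) A \<in> brs B" "\<not> is_singleton_br T ((butlast ^^ j) A)"
      "is_singleton_br T (butlast ((butlast ^^ j) A))" using ex_fusion[OF A] by blast
  define E0 where "E0 = (butlast ^^ j) A"
  let ?X = "cut_through B E0 A"
  have X: "?X \<subseteq> brs B"
  proof
    fix E show "E \<in> ?X \<Longrightarrow> E \<in> brs B"
      by (induction rule: cut_through.induct) (use j E0_def in \<open>auto simp: minel_def\<close>)
  qed
  have up: "E = E0 \<or> butlast E \<in> ?X" if "E \<in> ?X" for E
    using that by cases auto
  have nonsing: "\<not> is_singleton_br T E" if "E \<in> ?X" for E
    using that
  proof (induction rule: cut_through.induct)
    case base
    then show ?case using j E0_def by simp
  next
    case (path i)
    then show ?case using nonsing_over X brs_ne by (metis subsetD)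
  next
    case (min D)
    then show ?case using nonsing_over X brs_ne unfolding minel_def by (metis subsetD)
  qed
  \<comment> \<open>The length fixes the number of truncations, so at most one truncation of
    \<open>A\<close> lies over a given \<open>P\<close>.\<close>
  have pu: "(butlast ^^ i) A = (butlast ^^ i') A"
    if "(butlast ^^ i) A \<in> brs B" "(butlast ^^ i') A \<in> brs B"
      "butlast ((butlast ^^ i) A) = butlast ((butlast ^^ i') A)" for i i'
  proof -
    have ne: "(butlast ^^ i) A \<noteq> []" "(butlast ^^ i') A \<noteq> []" using that brs_ne by blast+
    then have "length ((butlast ^^ i) A) = length ((butlast ^^ i') A)"
      using that(3) by (metis append_butlast_last_id length_append_singleton)
    moreover have "length ((butlast ^^ i) A) \<noteq> 0" using ne by simp
    ultimately have "i = i'" unfolding butlast_pow_length by linarith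
    then show ?thesis by simp
  qed
  have good: "(\<exists>i. D = (butlast ^^ i) A) \<or> minel B D \<and> (\<forall>i. (butlast ^^ i) A \<in> brs B \<longrightarrow>
      butlast ((butlast ^^ i) A) = butlast D \<longrightarrow> last D \<inter> last ((butlast ^^ i) A) = {})"
    if "D \<in> ?X" "butlast D \<in> ?X" for D
    using that(1)
  proof cases
    case base
    then show ?thesis using that(2) nonsing j E0_def by simp
  qed auto
  have uniq: "\<exists>!D. D \<in> ?X \<and> butlast D = P \<and> v \<in> last D"
    if P: "P \<in> ?X" "u \<in> last P" "v \<in> ch T u" for P u v
  proof (cases "\<exists>i. (butlast ^^ i) A \<in> brs B \<and> butlast ((butlast ^^ i) A) = P \<and> v \<in> last ((butlast ^^ i) A)")
    case True
    then obtain i where i: "(butlast ^^ i) A \<in> brs B" "butlast ((butlast ^^ i) A) = P" "v \<in> last ((butlast ^^ i) A)"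
      by blast
    show ?thesis
    proof (rule ex1I[of _ "(butlast ^^ i) A"])
      show "(butlast ^^ i) A \<in> ?X \<and> butlast ((butlast ^^ i) A) = P \<and> v \<in> last ((butlast ^^ i) A)"
        using i P cut_through.path by blast
      fix D assume D: "D \<in> ?X \<and> butlast D = P \<and> v \<in> last D"
      then consider i' where "D = (butlast ^^ i') A" | "last D \<inter> last ((butlast ^^ i) A) = {}"
        using good[of D] P i by blast
      then show "D = (butlast ^^ i) A"
      proof cases
        case 1
        then show ?thesis using pu[of i' i] D i X by auto
      next
        case 2
        then show ?thesis using D i by blast
      qed
    qed
  next
    case False
    obtain m where m: "minel B m" "butlast m = P" "v \<in> last m" using min_elt P X by blast
    show ?thesis
    proof (rule ex1I[of _ m])
      have "m \<in> ?X"
      proof (rule cut_through.min[OF m(1)])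
        show "butlast m \<in> ?X" using m P by simp
        fix i assume "(butlast ^^ i) A \<in> brs B" "butlast ((butlast ^^ i) A) = butlast m"
        then show "last m \<inter> last ((butlast ^^ i) A) = {}"
          using minel_disj[OF m(1), of "(butlast ^^ i) A" v] False m by blast
      qed
      then show "m \<in> ?X \<and> butlast m = P \<and> v \<in> last m" using m by simp
      fix D assume D: "D \<in> ?X \<and> butlast D = P \<and> v \<in> last D"
      then have "D \<in> brs B" using X by blast
      then have "minel B D" using good[of D] D P False by blast
      then show "D = m" using minel_unique m D by metis
    qed
  qed
  have "cut T B E0 ?X" unfolding cut_def
    using X cut_through.base up uniq j E0_def by blast
  \<comment> \<open>The path is climbed from \<open>E0\<close>, the \<open>j\<close>-fold truncation
    of \<open>A\<close>, up to \<open>A\<close> itself.\<close>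
  moreover have "(butlast ^^ (j - i)) A \<in> ?X" if "i \<le> j" for i
    using that
  proof (induction i)
    case 0
    then show ?case using cut_through.base E0_def by simp
  next
    case (Suc i)
    then have e: "butlast ((butlast ^^ (j - Suc i)) A) = (butlast ^^ (j - i)) A"
      by (metis Suc_diff_Suc Suc_le_lessD funpow.simps(2) o_apply)
    then have "(butlast ^^ (j - Suc i)) A \<noteq> []" using Suc X brs_ne by (metis Suc_leD butlast.simps(1) subsetD)
    then show ?case using Suc e butlast_pow_in[OF A(1)] by (intro cut_through.path) auto
  qed
  from this[of j] have "A \<in> ?X" by simp
  ultimately show ?thesis using that by blast
qed

lemma ex_nontrivial: "B \<noteq> bmin T \<Longrightarrow> \<exists>A \<in> brs B. A \<notin> triv T"
proof (rule ccontr)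
  assume a: "B \<noteq> bmin T" "\<not> (\<exists>A \<in> brs B. A \<notin> triv T)"
  then have "brs B = brs (bmin T)" using triv_in brs_bmin by blast
  then show False using ble_eqI[OF ble_refl[OF nb] bmin_le] a by blast
qed

lemma max_pow: "i \<le> k \<Longrightarrow> k \<le> depth T \<Longrightarrow> (butlast ^^ i) (max_br T k) = max_br T (k - i)"
proof (induction i)
  case (Suc i)
  then obtain m where "k - i = Suc m" by (metis Suc_diff_Suc Suc_le_lessD)
  then show ?case using Suc by (simp add: max_br_Suc) (metis diff_Suc_1 diff_Suc_eq_diff_pred diff_commute)
qed simp

end

text \<open>The indicator function of a cut is a flow, so by atomicity its support is the whole collision.\<close>

lemma (in rpt) collision_cut:
  assumes coll: "collision T C"
  shows "n_bracketing T C" "cut T C (fusion_br T C) (essential T C)" "brs C = essential T C \<union> triv T"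
    "\<exists>A \<in> essential T C. A \<notin> triv T"
proof -
  show nC: "n_bracketing T C" using coll by (simp add: collision_def assoc_def)
  then interpret C: brk T C using brkI by simp
  obtain A where A: "A \<in> brs C" "A \<notin> triv T"
    using C.ex_nontrivial coll by (auto simp: collision_def)
  then have "\<not> is_singleton_br T A" by (auto simp: triv_def is_sing_iff)
  then obtain E0 X where c: "cut T C E0 X" and AX: "A \<in> X" using C.ex_cut A by blast
  let ?l = "\<lambda>E. if E \<in> X then 1 else (0::real)"
  have X: "X \<subseteq> brs C" using c by (simp add: cut_def)
  have p: "pflow T C ?l" using C.cut_flow[OF c] .
  have bS: "brs (supp_br T C ?l) = X \<union> triv T" using X by (auto simp: supp_br_def)
  have "supp_br T C ?l \<noteq> bmin T"
  proof
    assume "supp_br T C ?l = bmin T"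
    then have "X \<union> triv T = triv T" using bS C.brs_bmin by simp
    then show False using AX A by blast
  qed
  then have i: "supp_br T C ?l \<in> assoc T - {bmin T}"
    using C.supp_br_nb(1)[OF p] by (simp add: assoc_def)
  have "supp_br T C ?l = C"
    by (rule mp[OF bspec[OF conjunct2[OF coll[unfolded collision_def]] i] C.supp_br_nb(2)[OF p]])
  then have bC: "brs C = X \<union> triv T" using bS by simp
  have len: "length E0 \<le> length E" if "E \<in> X" for E
    using C.cut_nonsing[OF c that] butlast_pow_length[of _ E] by (metis diff_le_self)
  \<comment> \<open>A trivial member is a maximum bracket. If it were at least as long as the
    nontrivial \<open>A\<close>, its truncation to the length of \<open>A\<close> would share
    vertices with \<open>A\<close> and equal it by \<open>cut_unique\<close>. So \<open>A\<close> is
    longer, and its truncation to that length equals the given member, again by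
    \<open>cut_unique\<close>.\<close>
  have nontriv: "\<exists>A' \<in> X. \<exists>l. A' \<notin> triv T \<and> E = (butlast ^^ l) A'" if E: "E \<in> X" for E
  proof (cases "E \<in> triv T")
    case False
    then show ?thesis using E by (intro bexI[of _ E] exI[of _ 0]) auto
  next
    case True
    then obtain k where k: "k \<le> depth T" "E = max_br T k"
      using C.triv_max C.cut_nonsing[OF c E] by blast
    have Ane: "A \<noteq> []" using A C.brs_ne by blast
    have "length A > k"
    proof (rule ccontr)
      assume "\<not> k < length A"
      then obtain k' where k': "length A = Suc k'" "k' < k" using Ane by (cases A) auto
      then have t: "(butlast ^^ (k - k')) E = max_br T k'" using C.max_pow k by simp
      have "length E0 \<le> length E - (k - k')" using len[OF AX] k k' by simp
      then have "max_br T k' \<in> X" using C.cut_trunc[OF c E] t by metis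
      moreover obtain v where v: "v \<in> last A" using C.brs_ex A by blast
      moreover have "v \<in> last (max_br T k')" using C.brs_level[OF A(1) k'(1)] v by auto
      ultimately have "A = max_br T k'" using C.cut_unique[OF c AX] by blast
      then show False using A k k' by (auto simp: triv_def)
    qed
    let ?i = "length A - Suc k"
    have lA: "length ((butlast ^^ ?i) A) = Suc k" using \<open>length A > k\<close> by (simp add: butlast_pow_length)
    have "length E0 \<le> length A - ?i" using len[OF E] k \<open>length A > k\<close> by simp
    then have AiX: "(butlast ^^ ?i) A \<in> X" using C.cut_trunc[OF c AX] by blast
    then have Ai: "(butlast ^^ ?i) A \<in> brs C" using X by blast
    then obtain v where v: "v \<in> last ((butlast ^^ ?i) A)" using C.brs_ex by blast
    then have "v \<in> last E" using C.brs_level[OF Ai lA] k by auto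
    then have "E = (butlast ^^ ?i) A" using C.cut_unique[OF c E AiX] v by blast
    then show ?thesis using AX A by blast
  qed
  have E0X: "E0 \<in> X" "\<not> is_singleton_br T E0" "is_singleton_br T (butlast E0)" using c by (auto simp: cut_def)
  have fus: "fusion_br T C = E0" unfolding fusion_br_def
  proof (rule the_equality)
    obtain j where "(butlast ^^ j) A = E0" using C.cut_nonsing[OF c AX] by blast
    then show "E0 \<in> brs C \<and> \<not> is_singleton_br T E0 \<and> is_singleton_br T (butlast E0) \<and>
      (\<exists>A\<in>brs C. \<exists>l. nontrivial_br T A \<and> E0 = (butlast ^^ l) A)"
      using E0X X A by (auto simp: nontrivial_iff)
    fix E assume E: "E \<in> brs C \<and> \<not> is_singleton_br T E \<and> is_singleton_br T (butlast E) \<and>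
      (\<exists>A\<in>brs C. \<exists>l. nontrivial_br T A \<and> E = (butlast ^^ l) A)"
    then obtain A' l where A': "A' \<in> X" "E = (butlast ^^ l) A'" using bC by (auto simp: nontrivial_iff)
    obtain j where j: "(butlast ^^ j) A' = E0" using C.cut_nonsing[OF c A'(1)] by blast
    have Ene: "E \<noteq> []" "E0 \<noteq> []" using E E0X X C.brs_ne by blast+
    have lE: "length E = length A' - l" "length E0 = length A' - j"
      using A' j butlast_pow_length by metis+
    \<comment> \<open>Both are truncations of \<open>A'\<close>. If \<open>E\<close> is longer than
      \<open>E0\<close>, then \<open>butlast E\<close> belongs to the cut and is not a singleton; if
      \<open>E\<close> is shorter, it is a proper truncation of \<open>E0\<close> and hence a
      singleton. Either contradicts the choice of \<open>E\<close>.\<close>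
    show "E = E0"
    proof (cases "l < j")
      case True
      then have "length E0 \<le> length A' - Suc l" using lE by simp
      then have "butlast E \<in> X" using C.cut_trunc[OF c A'(1), of "Suc l"] A'(2) by simp
      then show ?thesis using C.cut_nonsing[OF c] E by blast
    next
      case False
      then obtain d where d: "l = d + j" by (metis le_add_diff_inverse2 not_less)
      have e: "E = (butlast ^^ d) E0" using A' j d by (simp add: funpow_add)
      show ?thesis
      proof (cases d)
        case 0
        then show ?thesis using e by simp
      next
        case (Suc d')
        have s: "(butlast ^^ i) (butlast E0) = [] \<or> is_singleton_br T ((butlast ^^ i) (butlast E0))" for i
        proof (induction i)
          case (Suc i)
          then show ?case using C.butlast_sing[of "(butlast ^^ i) (butlast E0)"] by auto
        qed (use E0X in simp)
        have "E = (butlast ^^ d') (butlast E0)" using e Suc by (simp add: funpow_swap1)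
        then show ?thesis using s[of d'] E Ene by metis
      qed
    qed
  qed
  have "essential T C = X"
  proof
    show "X \<subseteq> essential T C"
    proof
      fix E assume E: "E \<in> X"
      then show "E \<in> essential T C"
        using nontriv[OF E] C.cut_nonsing[OF c E] X unfolding essential_def fus nontrivial_iff by blast
    qed
    show "essential T C \<subseteq> X"
    proof
      fix E assume "E \<in> essential T C"
      then obtain A' l j where A': "A' \<in> brs C" "A' \<notin> triv T" "E = (butlast ^^ l) A'" "(butlast ^^ j) E = E0"
        unfolding essential_def fus nontrivial_iff by blast
      then have "A' \<in> X" using bC by blast
      moreover have "length E0 \<le> length A' - l" using A' butlast_pow_length by (metis diff_le_self)
      ultimately show "E \<in> X" using C.cut_trunc[OF c] A' by blast
    qed
  qed
  then show "cut T C (fusion_br T C) (essential T C)" "brs C = essential T C \<union> triv T"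
    "\<exists>A \<in> essential T C. A \<notin> triv T"
    using c fus bC A AX by auto
qed

section \<open>The contracted tree\<close>

lemma strict_linear_orderI:
  assumes "\<And>x. x \<in> A \<Longrightarrow> (x, x) \<notin> r"
    and "\<And>x y z. x \<in> A \<Longrightarrow> y \<in> A \<Longrightarrow> z \<in> A \<Longrightarrow> (x, y) \<in> r \<Longrightarrow> (y, z) \<in> r \<Longrightarrow> (x, z) \<in> r"
    and "\<And>x y. x \<in> A \<Longrightarrow> y \<in> A \<Longrightarrow> x \<noteq> y \<Longrightarrow> (x, y) \<in> r \<or> (y, x) \<in> r"
  shows "strict_linear_order_on A (Restr r A)"
  unfolding strict_linear_order_on_def
proof (intro conjI)
  show "trans (Restr r A)" by (rule transI) (use assms(2) in auto)
  show "irrefl (Restr r A)" using assms(1) by (auto simp: irrefl_def)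
  show "total_on A (Restr r A)" using assms(3) by (auto simp: total_on_def)
qed

lemma (in rpt) rdist_pow_le: "v \<in> tverts T \<Longrightarrow> rdist T ((tpar T ^^ j) v) \<le> rdist T v"
proof (induction j)
  case (Suc j)
  have "rdist T (tpar T x) \<le> rdist T x" if "x \<in> tverts T" for x
    using rdist_par[OF that] par_root by (cases "x = troot T") auto
  from this[of "(tpar T ^^ j) v"] show ?case using Suc par_pow_in[of v j] by simp
qed simp

lemma (in brk) consecutive:
  assumes A: "A \<in> brs B" and u: "u \<in> last (butlast A)" and x: "x \<in> last A" "x \<in> ch T u"
    and z: "z \<in> last A" "z \<in> ch T u" and y: "y \<in> ch T u" "(x, y) \<in> tsib T" "(y, z) \<in> tsib T"
  shows "y \<in> last A"
proof -
  obtain k where k: "A \<in> brackets T k" using brs_bracket A by blast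
  have len: "length A = Suc k" using k by (simp add: brackets_def)
  have "length A = Suc (rdist T x)" using brs_rdist A x by blast
  then obtain j where j: "k = Suc j" using rdist_ch[OF x(2)] len by simp
  have ne: "butlast A \<noteq> []" using len j by (metis length_butlast diff_Suc_1 list.size(3) nat.distinct(1))
  then have l: "last A = A ! k" "last (butlast A) = A ! j"
    using len j brs_ne[OF A] by (simp_all add: last_conv_nth nth_butlast)
  have "consecutive_in T u (A ! k \<inter> ch T u)" using k u l j unfolding brackets_def by force
  then show ?thesis unfolding consecutive_in_def l using x y z l by blast
qed

text \<open>A witness over the singleton bracket of the parent may be replaced by the singleton of
  \<open>u\<close>, so both recursions compare siblings by \<open>tsib\<close>. This is the case
  needed below the fusion bracket, at the parent of the fused vertices.\<close>

lemma (in brk) sing_eprec: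
  "a \<in> level T k \<Longrightarrow> u \<in> level T k \<Longrightarrow> eprec T B (sing_br T a) u \<longleftrightarrow> tless T a u"
proof (induction k arbitrary: a u)
  case 0
  then have a: "a = troot T" "u = troot T" by (auto simp: level_0)
  have n: "((butlast ^^ i) (sing_br T a), A) \<notin> bless B" for i A
  proof
    assume l: "((butlast ^^ i) (sing_br T a), A) \<in> bless B"
    note d = blessD[OF l]
    have "length ((butlast ^^ i) (sing_br T a)) \<le> Suc 0" using a by (simp add: butlast_pow_length)
    then have "butlast ((butlast ^^ i) (sing_br T a)) = []" by (simp flip: length_0_conv)
    then show False using brs_butlast_nil d l bless_irrefl by metis
  qed
  then show ?case using a tless_irrefl[of u 0] 0 by (simp add: eprec_def)
next
  case (Suc k)
  note pa = level_Suc_par[OF Suc.prems(1)] and pu = level_Suc_par[OF Suc.prems(2)]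
  have va: "a \<in> tverts T" "u \<in> tverts T" using Suc.prems level_verts by auto
  have b: "butlast (sing_br T a) = sing_br T (tpar T a)" "butlast (sing_br T u) = sing_br T (tpar T u)"
    using pa pu va butlast_sing_br by auto
  have "(\<exists>A \<in> brs B. u \<in> last A \<and> (sing_br T a, A) \<in> bless B) \<longleftrightarrow> tpar T a = tpar T u \<and> (a, u) \<in> tsib T"
  proof
    assume "\<exists>A \<in> brs B. u \<in> last A \<and> (sing_br T a, A) \<in> bless B"
    then obtain A where A: "A \<in> brs B" "u \<in> last A" "(sing_br T a, A) \<in> bless B" by blast
    note d = blessD[OF A(3)]
    have bA: "butlast A = sing_br T (tpar T a)" using d b by simp
    then have "tpar T u \<in> last (sing_br T (tpar T a))" using brs_butlast(3)[OF A(1) _ A(2)] by simp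
    then have p: "tpar T u = tpar T a" by simp
    have "(sing_br T a, sing_br T u) \<in> bless B"
      by (rule bless_transfer[OF A(3), of _ _ a u]) (use d A p b va sing_in in auto)
    then show "tpar T a = tpar T u \<and> (a, u) \<in> tsib T" using sing_less[of a "tpar T a" u] pa pu p by auto
  next
    assume "tpar T a = tpar T u \<and> (a, u) \<in> tsib T"
    then have "(sing_br T a, sing_br T u) \<in> bless B" using sing_less[of a "tpar T a" u] pa pu by auto
    then show "\<exists>A \<in> brs B. u \<in> last A \<and> (sing_br T a, A) \<in> bless B" using sing_in va by force
  qed
  moreover have "eprec T B (sing_br T (tpar T a)) (tpar T u) \<longleftrightarrow> tless T (tpar T a) (tpar T u)"
    using Suc.IH pa pu by blast
  ultimately show ?case
    using pa pu eprec_rec[of T B "sing_br T a" u] tless_rec[of T a u] b by auto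
qed

text \<open>Contraction replaces the vertices of each essential \<open>E\<close> by the single vertex \<open>v\<^sub>E\<close>, which changes
  the position of \<open>u\<close> by \<open>gco T B E u\<close>. As this depends on \<open>B\<close> alone, \<open>\<rho>\<close> becomes linear in the length function.\<close>

definition gco :: "'v plane_tree \<Rightarrow> 'v bracketing \<Rightarrow> 'v bracket \<Rightarrow> 'v \<Rightarrow> real" where
  "gco T B E u = (if eprec T B E u then 1 else 0) - real (card {x \<in> last E. tless T x u})"

definition vel :: "'v plane_tree \<Rightarrow> 'v bracketing \<Rightarrow> ('v bracket \<Rightarrow> real) \<Rightarrow> nat \<Rightarrow> 'v \<Rightarrow> real" where
  "vel T B l k u = (\<Sum>E | E \<in> brs B \<and> length E = Suc k. l E * gco T B E u)"

definition Vel :: "'v plane_tree \<Rightarrow> 'v bracketing \<Rightarrow> ('v bracket \<Rightarrow> real) \<Rightarrow> vec" where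
  "Vel T B l = (\<lambda>k i. if coord T k i
     then vel T B l k (lvert T k i) - vel T B l k (lvert T k (i + 1)) else 0)"

locale coll = brk T C for T :: "'v plane_tree" and C +
  assumes coll: "collision T C"
begin

abbreviation "E0 \<equiv> fusion_br T C"
abbreviation "X \<equiv> essential T C"
abbreviation "W \<equiv> fused T C"
abbreviation "w \<equiv> fusion_vertex T C"
abbreviation "F \<equiv> below_fused T C"
abbreviation "T' \<equiv> contract T C"
abbreviation "\<psi> \<equiv> contract_map T C"

lemma cutX: "cut T C E0 X"
  using collision_cut[OF coll] by blast

lemma X_brs: "E \<in> X \<Longrightarrow> E \<in> brs C"
  and E0_in: "E0 \<in> X"
  and E0_butlast: "is_singleton_br T (butlast E0)"
  and X_up: "E \<in> X \<Longrightarrow> E \<noteq> E0 \<Longrightarrow> butlast E \<in> X"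
  and X_cover: "P \<in> X \<Longrightarrow> u \<in> last P \<Longrightarrow> v \<in> ch T u \<Longrightarrow> \<exists>D \<in> X. butlast D = P \<and> v \<in> last D"
  using cutX unfolding cut_def by blast+

lemma X_unique: "E \<in> X \<Longrightarrow> E' \<in> X \<Longrightarrow> v \<in> last E \<Longrightarrow> v \<in> last E' \<Longrightarrow> E = E'"
  using cut_unique[OF cutX] .

lemma finite_X: "finite X"
  by (rule finite_subset[OF _ finite_brs]) (use X_brs in blast)

lemma w_in: "w \<in> tverts T" and E0_w: "butlast E0 = sing_br T w"
proof -
  obtain w' where w': "w' \<in> tverts T" "butlast E0 = sing_br T w'"
    using E0_butlast by (auto simp: is_sing_iff)
  have "w = w'" unfolding fusion_vertex_def
    by (rule the_equality) (use w' sing_br_inj in auto)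
  then show "w \<in> tverts T" "butlast E0 = sing_br T w" using w' by auto
qed

lemma W_ch: "x \<in> W \<Longrightarrow> x \<in> ch T w"
proof -
  assume x: "x \<in> W"
  have "butlast E0 \<noteq> []" using E0_w by simp
  then have "x \<in> ch T (tpar T x) \<and> tpar T x \<in> last (butlast E0)"
    using brs_butlast(3)[of E0 x] X_brs[OF E0_in] x by (simp add: fused_def)
  then show ?thesis using E0_w last_sing_br by (metis singletonD)
qed

lemma W_ne: "\<exists>x. x \<in> W"
  using brs_ex[OF X_brs[OF E0_in]] by (simp add: fused_def)

text \<open>The fused vertices are consecutive, so an outside sibling lies on one side of all of
  them and comparing with a single one suffices.\<close>

lemma W_side:
  assumes a: "a \<in> ch T w" "a \<notin> W" and x: "x \<in> W" "x' \<in> W"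
  shows "(a, x) \<in> tsib T \<Longrightarrow> (a, x') \<in> tsib T" "(x, a) \<in> tsib T \<Longrightarrow> (x', a) \<in> tsib T"
proof -
  have c: "(y, a) \<in> tsib T \<Longrightarrow> (a, z) \<in> tsib T \<Longrightarrow> False" if "y \<in> W" "z \<in> W" for y z
    using consecutive[OF X_brs[OF E0_in], of w y z a] that a W_ch by (auto simp: fused_def E0_w)
  have t: "(y, a) \<in> tsib T \<or> (a, y) \<in> tsib T" if "y \<in> W" for y
    using sib_total[OF W_ch[OF that] a(1)] a that by metis
  show "(a, x) \<in> tsib T \<Longrightarrow> (a, x') \<in> tsib T" "(x, a) \<in> tsib T \<Longrightarrow> (x', a) \<in> tsib T"
    using c x t by blast+
qed

lemma root_F: "troot T \<notin> F"
  using W_ch by (auto simp: below_fused_def par_pow_root in_ch)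

lemma F_rec: "v \<in> tverts T \<Longrightarrow> v \<in> F \<longleftrightarrow> v \<in> W \<or> tpar T v \<in> F"
proof -
  assume v: "v \<in> tverts T"
  have "(\<exists>j. (tpar T ^^ j) v \<in> W) \<longleftrightarrow> v \<in> W \<or> (\<exists>j. (tpar T ^^ j) (tpar T v) \<in> W)"
    by (subst ex_nat_split) (simp add: funpow_swap1)
  then show ?thesis using v par_in by (simp add: below_fused_def)
qed

lemma F_verts: "v \<in> F \<Longrightarrow> v \<in> tverts T"
  by (simp add: below_fused_def)

lemma w_F: "w \<notin> F"
proof
  assume "w \<in> F"
  then obtain j where "(tpar T ^^ j) w \<in> W" by (auto simp: below_fused_def)
  then have "rdist T ((tpar T ^^ j) w) = Suc (rdist T w)" using W_ch rdist_ch by blast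
  then show False using rdist_pow_le[OF w_in, of j] by simp
qed

text \<open>\<open>X_cover\<close> lifts essential brackets along the descendants of
  \<open>W\<close>. Together with \<open>X_unique\<close> this makes the \<open>THE\<close> in
  \<open>contract_map\<close> well defined.\<close>

lemma F_class: "v \<in> F \<Longrightarrow> \<exists>E \<in> X. v \<in> last E"
proof (induction "rdist T v" arbitrary: v)
  case 0
  then show ?case using rdist_0_iff[OF F_verts] root_F by metis
next
  case (Suc n)
  show ?case
  proof (cases "v \<in> W")
    case True
    then show ?thesis using E0_in by (auto simp: fused_def)
  next
    case False
    then have p: "tpar T v \<in> F" using F_rec[OF F_verts] Suc.prems by blast
    have nr: "v \<noteq> troot T" using root_F Suc.prems by blast
    then have "rdist T v = Suc (rdist T (tpar T v))" using rdist_par F_verts Suc.prems by blast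
    then obtain P where P: "P \<in> X" "tpar T v \<in> last P" using Suc.hyps p by auto
    have "v \<in> ch T (tpar T v)" using nr F_verts[OF Suc.prems] by (simp add: in_ch)
    then show ?thesis using X_cover[OF P] by blast
  qed
qed

lemma class_butlast:
  assumes "E \<in> X" "E \<noteq> E0" "v \<in> last E"
  shows "butlast E \<in> X" "tpar T v \<in> last (butlast E)" "v \<noteq> troot T"
proof -
  show b: "butlast E \<in> X" using X_up assms by blast
  then have "butlast E \<noteq> []" using X_brs brs_ne by blast
  then show "tpar T v \<in> last (butlast E)" "v \<noteq> troot T"
    using brs_butlast[OF X_brs[OF assms(1)]] assms by auto
qed

lemma class_F: "E \<in> X \<Longrightarrow> v \<in> last E \<Longrightarrow> v \<in> F"
proof (induction "length E" arbitrary: E v)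
  case 0
  then show ?case using X_brs brs_ne by auto
next
  case (Suc n)
  have v: "v \<in> tverts T" using brs_verts[OF X_brs] Suc.prems by blast
  show ?case
  proof (cases "E = E0")
    case True
    then show ?thesis using F_rec[OF v] Suc.prems by (simp add: fused_def)
  next
    case False
    note b = class_butlast[OF Suc.prems(1) False Suc.prems(2)]
    have "n = length (butlast E)" using Suc.hyps(2) by simp
    then have "tpar T v \<in> F" using Suc.hyps(1) b by blast
    then show ?thesis using F_rec[OF v] by blast
  qed
qed

lemma psi_F: "E \<in> X \<Longrightarrow> v \<in> last E \<Longrightarrow> \<psi> v = Inr E"
proof -
  assume E: "E \<in> X" "v \<in> last E"
  have "(THE E. E \<in> X \<and> E \<in> blev C (rdist T v) \<and> v \<in> last E) = E"
  proof (rule the_equality)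
    show "E \<in> X \<and> E \<in> blev C (rdist T v) \<and> v \<in> last E"
      using E X_brs brs_rdist by (auto simp: blev_def)
  qed (use X_unique E in blast)
  then show ?thesis using class_F[OF E] by (simp add: contract_map_def)
qed

lemma psi_out: "v \<notin> F \<Longrightarrow> \<psi> v = Inl v"
  by (simp add: contract_map_def)

lemma psi_cases:
  obtains "v \<notin> F" "\<psi> v = Inl v" | E where "v \<in> F" "E \<in> X" "v \<in> last E" "\<psi> v = Inr E"
  using F_class psi_F psi_out by blast

lemma T'_sel:
  "tverts T' = Inl ` (tverts T - F) \<union> Inr ` X" "troot T' = Inl (troot T)"
  "tpar T' (Inl v) = Inl (tpar T v)" "tpar T' (Inr E) = (if E = E0 then Inl w else Inr (butlast E))"
  by (simp_all add: contract_def Let_def)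

lemma T'_sib:
  "(Inl a, Inl b) \<in> tsib T' \<longleftrightarrow> (a, b) \<in> tsib T"
  "(Inl a, Inr E) \<in> tsib T' \<longleftrightarrow> E = E0 \<and> a \<in> ch T w - W \<and> (\<forall>x \<in> W. (a, x) \<in> tsib T)"
  "(Inr E, Inl a) \<in> tsib T' \<longleftrightarrow> E = E0 \<and> a \<in> ch T w - W \<and> (\<forall>x \<in> W. (x, a) \<in> tsib T)"
  "(Inr E, Inr E') \<in> tsib T' \<longleftrightarrow> (E, E') \<in> bless C"
  by (auto simp: contract_def Let_def)

text \<open>With surjectivity this carries all tree axioms except the sibling orders from
  \<open>T\<close> to the contracted tree.\<close>

lemma psi_par: "v \<in> tverts T \<Longrightarrow> \<psi> (tpar T v) = tpar T' (\<psi> v)"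
proof -
  assume v: "v \<in> tverts T"
  show ?thesis
  proof (cases rule: psi_cases[of v])
    case 1
    then have "tpar T v \<notin> F" using F_rec[OF v] by blast
    then show ?thesis using 1 psi_out by (simp add: T'_sel)
  next
    case (2 E)
    show ?thesis
    proof (cases "E = E0")
      case True
      then have "tpar T v = w" using W_ch[of v] 2 by (auto simp: fused_def in_ch)
      then show ?thesis using True 2 psi_out[OF w_F] by (simp add: T'_sel)
    next
      case False
      then show ?thesis using class_butlast[OF 2(2) False 2(3)] psi_F 2 by (simp add: T'_sel)
    qed
  qed
qed

lemma psi_in: "v \<in> tverts T \<Longrightarrow> \<psi> v \<in> tverts T'"
  by (cases rule: psi_cases[of v]) (auto simp: T'_sel)

lemma psi_surj: "tverts T' = \<psi> ` tverts T"
proof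
  show "\<psi> ` tverts T \<subseteq> tverts T'" using psi_in by blast
  have "Inr E \<in> \<psi> ` tverts T" if E: "E \<in> X" for E
  proof -
    obtain v where v: "v \<in> last E" using brs_ex X_brs E by blast
    then show ?thesis using psi_F[OF E v] brs_verts[OF X_brs[OF E] v] by force
  qed
  moreover have "Inl v \<in> \<psi> ` tverts T" if "v \<in> tverts T - F" for v
    using psi_out[of v] that by force
  ultimately show "tverts T' \<subseteq> \<psi> ` tverts T" by (auto simp: T'_sel)
qed

lemma psi_root: "\<psi> (troot T) = troot T'"
  using psi_out[OF root_F] by (simp add: T'_sel)

lemma psi_pow: "v \<in> tverts T \<Longrightarrow> \<psi> ((tpar T ^^ k) v) = (tpar T' ^^ k) (\<psi> v)"
  by (induction k) (simp_all add: psi_par par_pow_in)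

lemma ch_Inl:
  assumes "x \<in> ch T' (Inl u)"
  obtains a where "x = Inl a" "a \<in> ch T u" "a \<notin> F" | "x = Inr E0" "u = w"
  using assms
  by (cases x) (auto simp: in_ch T'_sel split: if_splits)

lemma ch_Inr:
  assumes "x \<in> ch T' (Inr P)"
  obtains E where "x = Inr E" "E \<in> X" "butlast E = P" "E \<noteq> E0"
  using assms
  by (cases x) (auto simp: in_ch T'_sel split: if_splits)

lemma rpt_T': "rooted_plane_tree T'"
  unfolding rooted_plane_tree_def
proof (intro conjI ballI)
  show "finite (tverts T')" using psi_surj fin_verts by simp
  show "troot T' \<in> tverts T'" using psi_root psi_in root_in by metis
  show "tpar T' (troot T') = troot T'" using psi_par[OF root_in] par_root psi_root by simp
  show "tpar T' v \<in> tverts T'" if "v \<in> tverts T'" for v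
    using that psi_surj psi_par psi_in par_in by force
  show "\<exists>k. (tpar T' ^^ k) v = troot T'" if v': "v \<in> tverts T'" for v
  proof -
    obtain u where u: "u \<in> tverts T" "v = \<psi> u" using v' psi_surj by blast
    obtain k where "(tpar T ^^ k) u = troot T" using reach[OF u(1)] by blast
    then have "(tpar T' ^^ k) v = troot T'" using psi_pow[OF u(1), of k] psi_root u by simp
    then show ?thesis by blast
  qed
  fix u' assume u': "u' \<in> tverts T'"
  show "strict_linear_order_on (ch T' u') (Restr (tsib T') (ch T' u'))"
  proof (cases u')
    case (Inl u)
    obtain x0 where x0: "x0 \<in> W" using W_ne by blast
    \<comment> \<open>Representing the fused vertex by one \<open>x0\<close> of \<open>W\<close>
      turns the order on these children into the sibling order of \<open>T\<close>; by
      \<open>W_side\<close> the choice of \<open>x0\<close> is immaterial.\<close>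
    define rep where "rep = case_sum (\<lambda>a. a) (\<lambda>E :: 'v bracket. x0)"
    have rep_ch: "rep x \<in> ch T u" if "x \<in> ch T' (Inl u)" for x
      using that by (cases rule: ch_Inl) (use W_ch[OF x0] in \<open>auto simp: rep_def\<close>)
    have FW: "a \<notin> W" if "a \<in> ch T u" "a \<notin> F" for a
      using that F_rec by (auto simp: in_ch)
    have rep_sib: "(x, y) \<in> tsib T' \<longleftrightarrow> (rep x, rep y) \<in> tsib T"
      if x: "x \<in> ch T' (Inl u)" and y: "y \<in> ch T' (Inl u)" for x y
      using x
    proof (cases rule: ch_Inl)
      case (1 a)
      show ?thesis using y
      proof (cases rule: ch_Inl)
        case (1 b)
        then show ?thesis using \<open>x = Inl a\<close> by (simp add: rep_def T'_sib)
      next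
        case 2
        then have "a \<in> ch T w" "a \<notin> W" using 1 FW by auto
        moreover from this have "(\<forall>x \<in> W. (a, x) \<in> tsib T) \<longleftrightarrow> (a, x0) \<in> tsib T"
          using W_side(1)[OF _ _ x0] x0 by blast
        ultimately show ?thesis using \<open>x = Inl a\<close> 2 by (simp add: rep_def T'_sib)
      qed
    next
      case 2
      show ?thesis using y
      proof (cases rule: ch_Inl)
        case (1 a)
        then have "a \<in> ch T w" "a \<notin> W" using 2 FW by auto
        moreover from this have "(\<forall>x \<in> W. (x, a) \<in> tsib T) \<longleftrightarrow> (x0, a) \<in> tsib T"
          using W_side(2)[OF _ _ x0] x0 by blast
        ultimately show ?thesis using 1 2 by (simp add: rep_def T'_sib)
      next
        case 2
        then show ?thesis using \<open>x = Inr E0\<close> bless_irrefl sib_irrefl[OF W_ch[OF x0]]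
          by (simp add: rep_def T'_sib)
      qed
    qed
    have rep_inj: "x = y" if "x \<in> ch T' (Inl u)" "y \<in> ch T' (Inl u)" "rep x = rep y" for x y
      using that(1)
    proof (cases rule: ch_Inl)
      case (1 a)
      show ?thesis using that(2)
        by (cases rule: ch_Inl) (use 1 that(3) FW x0 in \<open>auto simp: rep_def\<close>)
    next
      case 2
      show ?thesis using that(2)
        by (cases rule: ch_Inl) (use 2 that(3) FW x0 in \<open>auto simp: rep_def\<close>)
    qed
    show ?thesis unfolding Inl
    proof (rule strict_linear_orderI)
      fix x assume "x \<in> ch T' (Inl u)"
      then show "(x, x) \<notin> tsib T'" using rep_sib sib_irrefl[OF rep_ch] by blast
    next
      fix x y z assume i: "x \<in> ch T' (Inl u)" "y \<in> ch T' (Inl u)" "z \<in> ch T' (Inl u)"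
        and "(x, y) \<in> tsib T'" "(y, z) \<in> tsib T'"
      then have "(rep x, rep y) \<in> tsib T" "(rep y, rep z) \<in> tsib T" using rep_sib by blast+
      then have "(rep x, rep z) \<in> tsib T" using sib_trans[OF rep_ch rep_ch rep_ch] i by blast
      then show "(x, z) \<in> tsib T'" using rep_sib i by blast
    next
      fix x y assume i: "x \<in> ch T' (Inl u)" "y \<in> ch T' (Inl u)" "x \<noteq> y"
      then have "rep x \<noteq> rep y" using rep_inj by blast
      then have "(rep x, rep y) \<in> tsib T \<or> (rep y, rep x) \<in> tsib T"
        using sib_total[OF rep_ch rep_ch] i by blast
      then show "(x, y) \<in> tsib T' \<or> (y, x) \<in> tsib T'" using rep_sib i by blast
    qed
  next
    case (Inr P)
    show ?thesis unfolding Inr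
    proof (rule strict_linear_orderI)
      fix x assume "x \<in> ch T' (Inr P)"
      then show "(x, x) \<notin> tsib T'" by (cases rule: ch_Inr) (simp add: T'_sib bless_irrefl)
    next
      fix x y z assume i: "x \<in> ch T' (Inr P)" "y \<in> ch T' (Inr P)" "z \<in> ch T' (Inr P)"
        and l: "(x, y) \<in> tsib T'" "(y, z) \<in> tsib T'"
      obtain E1 E2 E3 where "x = Inr E1" "y = Inr E2" "z = Inr E3"
        using i ch_Inr by metis
      then show "(x, z) \<in> tsib T'" using l bless_trans[of E1 E2 E3] by (simp add: T'_sib)
    next
      fix x y assume i: "x \<in> ch T' (Inr P)" "y \<in> ch T' (Inr P)" "x \<noteq> y"
      obtain E1 where E1: "x = Inr E1" "E1 \<in> X" "butlast E1 = P" using i(1) ch_Inr by metis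
      obtain E2 where E2: "y = Inr E2" "E2 \<in> X" "butlast E2 = P" using i(2) ch_Inr by metis
      have "last E1 \<inter> last E2 = {}" using X_unique E1 E2 i by blast
      then show "(x, y) \<in> tsib T' \<or> (y, x) \<in> tsib T'"
        using bless_total[of E1 E2] E1 E2 X_brs by (simp add: T'_sib)
    qed
  qed
qed

end

sublocale coll \<subseteq> C': rpt "contract T C"
  by unfold_locales (rule rpt_T')

section \<open>Positions in the contracted tree\<close>

context coll
begin

lemma psi_root_iff: "\<psi> v = troot T' \<longleftrightarrow> v = troot T"
  using psi_root by (cases rule: psi_cases[of v]) (auto simp: T'_sel)

lemma rdist_psi: "v \<in> tverts T \<Longrightarrow> rdist T' (\<psi> v) = rdist T v"
proof (induction "rdist T v" arbitrary: v)
  case 0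
  then show ?case using rdist_0_iff psi_root C'.rdist_root by metis
next
  case (Suc n)
  then have nr: "v \<noteq> troot T" by auto
  then have "rdist T v = Suc (rdist T (tpar T v))" using rdist_par Suc.prems by blast
  moreover have "rdist T' (\<psi> v) = Suc (rdist T' (\<psi> (tpar T v)))"
    using C'.rdist_par[OF psi_in[OF Suc.prems]] nr psi_root_iff psi_par[OF Suc.prems] by simp
  ultimately show ?case using Suc par_in by simp
qed

lemma level_psi: "level T' k = \<psi> ` level T k"
  using psi_surj rdist_psi by (auto simp: level_def)

lemma psi_level: "v \<in> level T k \<Longrightarrow> \<psi> v \<in> level T' k"
  using level_psi by blast

text \<open>The only sibling comparison that changes form is one with the fused vertex, and there
  \<open>W_side\<close> reduces it to the comparison with \<open>u\<close> itself.\<close>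

lemma tless_out: "x \<in> level T k \<Longrightarrow> u \<in> level T k \<Longrightarrow> x \<notin> F \<Longrightarrow>
    tless T' (Inl x) (\<psi> u) \<longleftrightarrow> tless T x u"
proof (induction k arbitrary: x u)
  case 0
  then have x: "x = troot T" "u = troot T" by (auto simp: level_0)
  have "\<psi> u \<in> level T' 0" "\<psi> u = Inl x" using x psi_root T'_sel by (auto simp: C'.level_0)
  then have "\<not> tless T' (Inl x) (\<psi> u)" using C'.tless_irrefl[of "\<psi> u" 0] by simp
  moreover have "\<not> tless T x u" using tless_irrefl[of u 0] x by (simp add: level_0)
  ultimately show ?case by blast
next
  case (Suc k)
  note px = level_Suc_par[OF Suc.prems(1)] and pu = level_Suc_par[OF Suc.prems(2)]
  have v: "x \<in> tverts T" "u \<in> tverts T" using Suc.prems level_verts by auto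
  have pxF: "tpar T x \<notin> F" "x \<notin> W" using F_rec[OF v(1)] Suc.prems by auto
  have IH: "tless T' (Inl (tpar T x)) (\<psi> (tpar T u)) \<longleftrightarrow> tless T (tpar T x) (tpar T u)"
    using Suc.IH px pu pxF by blast
  have "Inl (tpar T x) = \<psi> (tpar T u) \<and> (Inl x, \<psi> u) \<in> tsib T' \<longleftrightarrow> tpar T x = tpar T u \<and> (x, u) \<in> tsib T"
  proof (cases "tpar T x = tpar T u")
    case True
    then have puF: "tpar T u \<notin> F" using pxF by simp
    have "(Inl x, \<psi> u) \<in> tsib T' \<longleftrightarrow> (x, u) \<in> tsib T"
    proof (cases "u \<in> F")
      case False
      then show ?thesis using psi_out by (simp add: T'_sib)
    next
      case uF: True
      then have uW: "u \<in> W" using F_rec[OF v(2)] puF by blast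
      then have pw: "tpar T u = w" using W_ch by (auto simp: in_ch)
      have "\<psi> u = Inr E0" using psi_F[OF E0_in] uW by (simp add: fused_def)
      moreover have "x \<in> ch T w" using px True pw by simp
      moreover from this have "(\<forall>y \<in> W. (x, y) \<in> tsib T) \<longleftrightarrow> (x, u) \<in> tsib T"
        using W_side(1)[OF _ _ uW] pxF uW by blast
      ultimately show ?thesis using pxF by (simp add: T'_sib)
    qed
    then show ?thesis using True psi_out[OF puF] by simp
  next
    case False
    have "Inl (tpar T x) \<noteq> \<psi> (tpar T u)"
      by (cases rule: psi_cases[of "tpar T u"]) (use False in auto)
    then show ?thesis using False by blast
  qed
  moreover have "Inl x \<noteq> troot T'" "\<psi> u \<noteq> troot T'" using px pu psi_root_iff by (auto simp: T'_sel)
  ultimately show ?case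
    using tless_rec[of T' "Inl x" "\<psi> u"] tless_rec[of T x u] IH px pu psi_par[OF v(2)]
    by (auto simp: T'_sel)
qed

text \<open>\<open>tless_rec\<close> in the contracted tree and \<open>eprec_rec\<close> in
  \<open>C\<close> run in parallel. A witness \<open>A\<close> through \<open>u\<close> is exchanged
  by \<open>bless_transfer\<close> for the essential bracket or the singleton representing the image
  of \<open>u\<close>. At \<open>E0\<close> the recursion leaves the essential brackets and meets
  \<open>sing_eprec\<close> and \<open>tless_out\<close> at \<open>w\<close>.\<close>

lemma tless_class: "E \<in> X \<Longrightarrow> length E = Suc k \<Longrightarrow> u \<in> level T k \<Longrightarrow>
    tless T' (Inr E) (\<psi> u) \<longleftrightarrow> eprec T C E u"
proof (induction k arbitrary: E u)
  case 0
  \<comment> \<open>No essential bracket has level 0: the only candidate is the root bracket, a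
    singleton.\<close>
  then have "butlast E = []" by (cases E) auto
  then have "E = [{troot T}]" using brs_butlast_nil X_brs 0 by blast
  then show ?case using cut_nonsing[OF cutX 0(1)] root_sing by blast
next
  case (Suc k)
  note pu = level_Suc_par[OF Suc.prems(3)]
  have v: "u \<in> tverts T" using Suc.prems level_verts by auto
  have EB: "E \<in> brs C" using X_brs Suc.prems by blast
  have nr: "Inr E \<noteq> troot T'" "\<psi> u \<noteq> troot T'" using pu psi_root_iff by (auto simp: T'_sel)
  have "(tpar T' (Inr E) = \<psi> (tpar T u) \<and> (Inr E, \<psi> u) \<in> tsib T' \<longleftrightarrow>
      (\<exists>A \<in> brs C. u \<in> last A \<and> (E, A) \<in> bless C)) \<and>
    (tless T' (tpar T' (Inr E)) (\<psi> (tpar T u)) \<longleftrightarrow> eprec T C (butlast E) (tpar T u))" (is "(?L1 \<longleftrightarrow> ?R1) \<and> (?L2 \<longleftrightarrow> ?R2)")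
  proof (cases "E = E0")
    case True
    have pE: "tpar T' (Inr E) = Inl w" using True by (simp add: T'_sel)
    have "length (butlast E0) = Suc k" using Suc.prems True by simp
    then have wl: "w \<in> level T k" using w_in by (simp add: E0_w level_def)
    have "?L2 \<longleftrightarrow> ?R2" using tless_out[OF wl _ w_F] sing_eprec[OF wl] pu True pE E0_w by simp
    moreover have "?L1 \<longleftrightarrow> ?R1"
    proof
      assume L: ?L1
      then have pw: "tpar T u = w" using pE
        by (cases rule: psi_cases[of "tpar T u"]) auto
      have uF: "u \<notin> F"
      proof
        assume "u \<in> F"
        then have "u \<in> W" using F_rec[OF v] pw w_F by simp
        then have "\<psi> u = Inr E0" using psi_F[OF E0_in] by (simp add: fused_def)
        then show False using L True bless_irrefl by (simp add: T'_sib)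
      qed
      then have u: "u \<in> ch T w - W" "\<forall>x \<in> W. (x, u) \<in> tsib T"
        using L True psi_out by (auto simp: T'_sib)
      obtain x where x: "x \<in> W" using W_ne by blast
      have "(sing_br T x, sing_br T u) \<in> bless C" using sing_less[of x w u] u x W_ch by blast
      then have "(E0, sing_br T u) \<in> bless C"
        by (rule bless_transfer[where x = x and y = u])
          (use EB True sing_in v butlast_sing_br u x pu pw in \<open>auto simp: E0_w fused_def\<close>)
      then show ?R1 using sing_in[OF v] True by force
    next
      assume ?R1
      then obtain A where A: "A \<in> brs C" "u \<in> last A" "(E0, A) \<in> bless C" using True by blast
      note d = blessD[OF A(3)]
      have uW: "u \<notin> W" using d A by (auto simp: fused_def)
      have "butlast A = sing_br T w" using d E0_w by simp
      then have "tpar T u \<in> last (sing_br T w)" using brs_butlast(3)[OF A(1) _ A(2)] by simp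
      then have pw: "tpar T u = w" by simp
      then have uF: "u \<notin> F" using F_rec[OF v] uW w_F by simp
      have "(x, u) \<in> tsib T" if x: "x \<in> W" for x
      proof -
        have xc: "x \<in> ch T w" using W_ch x .
        have "(sing_br T x, sing_br T u) \<in> bless C"
          by (rule bless_transfer[OF A(3), of _ _ x u])
            (use x xc uW A sing_in v butlast_sing_br pu pw in \<open>auto simp: fused_def in_ch\<close>)
        then show ?thesis using sing_less[OF xc, of u] pu pw by simp
      qed
      then show ?L1 using uF uW psi_out[OF uF] psi_out[OF w_F] pw pu True pE by (simp add: T'_sib)
    qed
    ultimately show ?thesis by blast
  next
    case False
    let ?P = "butlast E"
    have P: "?P \<in> X" using X_up False Suc.prems by blast
    then have Pne: "?P \<noteq> []" using X_brs brs_ne by blast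
    have pE: "tpar T' (Inr E) = Inr ?P" using False by (simp add: T'_sel)
    have "length ?P = Suc k" using Suc.prems by simp
    then have "?L2 \<longleftrightarrow> ?R2" using Suc.IH[OF P] pu pE by simp
    moreover have "?L1 \<longleftrightarrow> ?R1"
    proof
      assume L: ?L1
      then have pF: "tpar T u \<in> F" using pE psi_out by fastforce
      then have "u \<in> F" using F_rec[OF v] by blast
      then obtain D where D: "D \<in> X" "u \<in> last D" "\<psi> u = Inr D" using F_class psi_F by blast
      then show ?R1 using L X_brs by (auto simp: T'_sib)
    next
      assume ?R1
      then obtain A where A: "A \<in> brs C" "u \<in> last A" "(E, A) \<in> bless C" by blast
      note d = blessD[OF A(3)]
      have pP: "tpar T u \<in> last ?P" using brs_butlast(3)[OF A(1) _ A(2)] d Pne by simp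
      have "u \<in> ch T (tpar T u)" using pu by blast
      then obtain D where D: "D \<in> X" "butlast D = ?P" "u \<in> last D" using X_cover[OF P pP] by blast
      have "u \<notin> last E" using d A by blast
      then have "D \<noteq> E" using D by blast
      then have disj: "last E \<inter> last D = {}" using X_unique D Suc.prems by blast
      obtain x where x: "x \<in> last E" using brs_ex EB by blast
      have "(E, D) \<in> bless C"
        by (rule bless_transfer[OF A(3) EB X_brs[OF D(1)] _ disj x x A(2) D(3)]) (use D in simp)
      then show ?L1 using psi_F[OF D(1,3)] psi_F[OF P pP] pE by (simp add: T'_sib)
    qed
    ultimately show ?thesis by blast
  qed
  then show ?case
    using tless_rec[of T' "Inr E" "\<psi> u"] eprec_rec[of T C E u] nr psi_par[OF v] by auto
qed

lemma X_level: "Inr E \<in> level T' k \<longleftrightarrow> E \<in> X \<and> length E = Suc k"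
proof
  assume "Inr E \<in> level T' k"
  then obtain v where v: "v \<in> level T k" "\<psi> v = Inr E" using level_psi by force
  then have "E \<in> X" "v \<in> last E" by (cases rule: psi_cases[of v]; simp)+
  then show "E \<in> X \<and> length E = Suc k" using brs_rdist[OF X_brs] v by (auto simp: level_def)
next
  assume E: "E \<in> X \<and> length E = Suc k"
  then obtain v where v: "v \<in> last E" using brs_ex X_brs by blast
  then have "v \<in> level T k" using brs_level[OF X_brs] E by blast
  then show "Inr E \<in> level T' k" using psi_level psi_F v E by metis
qed

text \<open>The predecessors of the image of \<open>u\<close> are the surviving predecessors of
  \<open>u\<close> and the essential brackets before \<open>u\<close>. The lost predecessors are
  counted bracket by bracket, so the change is a sum of terms \<open>gco\<close>.\<close>

lemma lpos_psi:
  assumes u: "u \<in> level T k"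
  shows "real (lpos T' (\<psi> u)) = real (lpos T u) + vel T C (\<lambda>E. if E \<in> X then 1 else 0) k u"
proof -
  let ?Xk = "{E \<in> X. length E = Suc k}"
  have Inl_level: "Inl x \<in> level T' k \<longleftrightarrow> x \<in> level T k \<and> x \<notin> F" for x
  proof
    assume "Inl x \<in> level T' k"
    then obtain v where v: "v \<in> level T k" "\<psi> v = Inl x" using level_psi by force
    then show "x \<in> level T k \<and> x \<notin> F" by (cases rule: psi_cases[of v]) auto
  qed (use psi_level psi_out in metis)
  have fX: "finite ?Xk" using finite_X by simp
  have "{z \<in> level T' k. tless T' z (\<psi> u)} =
      Inl ` {x \<in> level T k - F. tless T x u} \<union> Inr ` {E \<in> ?Xk. eprec T C E u}" (is "?S = ?S1 \<union> ?S2")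
  proof (rule Set.set_eqI)
    fix z show "z \<in> ?S \<longleftrightarrow> z \<in> ?S1 \<union> ?S2"
    proof (cases z)
      case (Inl x)
      then show ?thesis using Inl_level[of x] tless_out[OF _ u, of x] by auto
    next
      case (Inr E)
      then show ?thesis using X_level[of E k] tless_class[OF _ _ u, of E] by auto
    qed
  qed
  moreover have "card (?S1 \<union> ?S2) = card ?S1 + card ?S2"
    using finite_X by (intro card_Un_disjoint) auto
  ultimately have "card ?S = card {x \<in> level T k - F. tless T x u} + card {E \<in> ?Xk. eprec T C E u}"
    by (simp add: card_image)
  moreover have "card {x \<in> level T k. tless T x u} =
      card {x \<in> level T k - F. tless T x u} + card {x \<in> level T k \<inter> F. tless T x u}"
    by (subst card_Un_disjoint[symmetric]) (auto intro: arg_cong[of _ _ card])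
  moreover have "card {x \<in> level T k \<inter> F. tless T x u} = (\<Sum>E\<in>?Xk. card {x \<in> last E. tless T x u})"
  proof -
    have "{x \<in> level T k \<inter> F. tless T x u} = (\<Union>E\<in>?Xk. {x \<in> last E. tless T x u})"
    proof (intro equalityI subsetI)
      fix x assume x: "x \<in> {x \<in> level T k \<inter> F. tless T x u}"
      then obtain E where "E \<in> X" "x \<in> last E" using F_class by blast
      then show "x \<in> (\<Union>E\<in>?Xk. {x \<in> last E. tless T x u})"
        using x brs_rdist[OF X_brs, of E x] by (auto simp: level_def)
    next
      fix x assume "x \<in> (\<Union>E\<in>?Xk. {x \<in> last E. tless T x u})"
      then show "x \<in> {x \<in> level T k \<inter> F. tless T x u}"
        using class_F brs_level[OF X_brs] by blast
    qed
    moreover have "card (\<Union>E\<in>?Xk. {x \<in> last E. tless T x u}) = (\<Sum>E\<in>?Xk. card {x \<in> last E. tless T x u})"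
      by (rule card_UN_disjoint) (use fX finite_last X_brs X_unique in auto)
    ultimately show ?thesis by simp
  qed
  moreover have "vel T C (\<lambda>E. if E \<in> X then 1 else 0) k u =
      real (card {E \<in> ?Xk. eprec T C E u}) - real (\<Sum>E\<in>?Xk. card {x \<in> last E. tless T x u})"
  proof -
    have "vel T C (\<lambda>E. if E \<in> X then 1 else 0) k u = (\<Sum>E\<in>?Xk. gco T C E u)"
      unfolding vel_def
      by (rule sum.mono_neutral_cong_right) (use finite_brs X_brs in auto)
    also have "\<dots> = (\<Sum>E\<in>?Xk. if eprec T C E u then 1 else 0)
        - (\<Sum>E\<in>?Xk. real (card {x \<in> last E. tless T x u}))"
      unfolding gco_def by (rule sum_subtractf)
    also have "(\<Sum>E\<in>?Xk. if eprec T C E u then 1 else (0::real)) = real (card {E \<in> ?Xk. eprec T C E u})"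
      using fX by (simp add: sum.If_cases Int_def)
    finally show ?thesis by simp
  qed
  ultimately show ?thesis
    using lpos_eq[OF u] C'.lpos_eq[OF psi_level[OF u]] by simp
qed

text \<open>The positions of neighbours in \<open>T\<close> contribute -1 to the difference, which
  cancels the \<open>+ 1\<close> in \<open>rho\<close>.\<close>

lemma rho_eq: "rho T C = Vel T C (\<lambda>E. if E \<in> X then 1 else 0)"
proof (intro ext)
  fix k i
  show "rho T C k i = Vel T C (\<lambda>E. if E \<in> X then 1 else 0) k i"
  proof (cases "coord T k i")
    case True
    then have "1 \<le> i" "i \<le> card (level T k)" "1 \<le> i + 1" "i + 1 \<le> card (level T k)" by (auto simp: coord_def)
    then show ?thesis using lvert[of i k] lvert[of "i + 1" k]
      by (simp add: rho_def Vel_def lpos_psi)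
  qed (simp add: rho_def Vel_def)
qed

end

section \<open>Recovering a flow from its velocities\<close>

lemma vel_add: "vel T B (\<lambda>A. l A + l' A) k u = vel T B l k u + vel T B l' k u"
  by (simp add: vel_def distrib_right sum.distrib)

lemma vel_scale: "vel T B (\<lambda>A. t * l A) k u = t * vel T B l k u"
  by (simp add: vel_def sum_distrib_left mult.assoc)

lemma Vel_add: "Vel T B (\<lambda>A. l A + l' A) = (\<lambda>k i. Vel T B l k i + Vel T B l' k i)"
  by (auto simp: Vel_def vel_add fun_eq_iff)

lemma Vel_scale: "Vel T B (\<lambda>A. t * l A) = (\<lambda>k i. t * Vel T B l k i)"
  by (auto simp: Vel_def vel_scale fun_eq_iff right_diff_distrib)

text \<open>At the first entry where the lists differ, the containment is proper. The lists of
  cardinalities thus give a well-founded measure for strict containment.\<close>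

lemma bsub_card_lex:
  assumes "list_all2 (\<subseteq>) A A'" "A \<noteq> A'" "\<And>x. x \<in> set A' \<Longrightarrow> finite x"
  shows "(map card A, map card A') \<in> lex less_than"
  using assms
proof (induction rule: list_all2_induct)
  case (Cons x xs y ys)
  show ?case
  proof (cases "x = y")
    case True
    then show ?thesis using Cons by auto
  next
    case False
    then have "card x < card y" using Cons by (intro psubset_card_mono) auto
    then show ?thesis using Cons(2) by (auto dest: list_all2_lengthD)
  qed
qed simp

lemma butlast_pow_take: "(butlast ^^ i) A = take (length A - i) A"
proof (induction i)
  case (Suc i)
  have "butlast (take (length A - i) A) = take (length A - i - 1) A"
    by (simp add: butlast_take)
  then show ?case using Suc by simp
qed simp

section \<open>Which brackets separate two vertices\<close>

context brk
begin

text \<open>The coefficients agree by \<open>eprec_sub\<close> and extension by zero adds no terms,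
  so velocities may be computed in any ambient bracketing.\<close>

lemma vel_sub:
  assumes "n_bracketing T B'" "B' \<preceq> B" "\<And>A. A \<notin> brs B' \<Longrightarrow> l A = 0"
  shows "vel T B' l k u = vel T B l k u"
proof -
  have "gco T B' E u = gco T B E u" if "E \<in> brs B'" for E
    unfolding gco_def using eprec_sub[OF assms(1,2) that] by simp
  then show ?thesis unfolding vel_def
    by (intro sum.mono_neutral_cong_left) (use finite_brs assms ble_brs in auto)
qed

lemma Vel_sub:
  assumes "n_bracketing T B'" "B' \<preceq> B" "\<And>A. A \<notin> brs B' \<Longrightarrow> l A = 0"
  shows "Vel T B' l = Vel T B l"
proof -
  have "vel T B' l = vel T B l" by (intro ext vel_sub) (use assms in auto)
  then show ?thesis unfolding Vel_def by (rule ssubst) (rule refl)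
qed

lemma brs_set: "A \<in> brs B \<Longrightarrow> x \<in> set A \<Longrightarrow> finite x"
proof -
  assume A: "A \<in> brs B" "x \<in> set A"
  obtain k where k: "A \<in> brackets T k" using brs_bracket[OF A(1)] by blast
  then obtain i where "i \<le> k" "x = A ! i" using A by (auto simp: brackets_def in_set_conv_nth less_Suc_eq_le)
  then have "x \<subseteq> level T i" using k by (auto simp: brackets_def)
  then show "finite x" using finite_subset finite_level by blast
qed

text \<open>An initial segment already decides the lexicographic comparison, so strict containment
  of some truncation suffices.\<close>

lemma trunc_card_lex:
  assumes A: "A' \<in> brs B" and len: "length A = length A'"
    and i: "(butlast ^^ i) A \<sqsubset>b (butlast ^^ i) A'"
  shows "(map card A, map card A') \<in> lex less_than"
proof -
  let ?n = "length A' - i"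
  have "(map card (take ?n A), map card (take ?n A')) \<in> lex less_than"
    by (rule bsub_card_lex) (use i len brs_set[OF A] in \<open>auto simp: butlast_pow_take bsub_def dest: in_set_takeD\<close>)
  then have "(map card (take ?n A) @ map card (drop ?n A), map card (take ?n A') @ map card (drop ?n A')) \<in> lex less_than"
    by (rule lex_append_rightI) (use len in simp)
  then show ?thesis by (simp flip: map_append)
qed

lemma pow_last: "E \<in> brs B \<Longrightarrow> u \<in> last E \<Longrightarrow> (butlast ^^ i) E \<noteq> [] \<Longrightarrow> (tpar T ^^ i) u \<in> last ((butlast ^^ i) E)"
proof (induction i)
  case (Suc i)
  then have ne: "(butlast ^^ i) E \<noteq> []" by auto
  then have i: "(tpar T ^^ i) u \<in> last ((butlast ^^ i) E)" "(butlast ^^ i) E \<in> brs B"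
    using Suc butlast_pow_in by blast+
  show ?case using brs_butlast(3)[OF i(2) _ i(1)] Suc.prems by simp
qed simp

text \<open>A witness would be comparable with a truncation of \<open>E\<close>, hence disjoint from
  it, yet share an ancestor of \<open>u\<close> with it.\<close>

lemma eprec_self: "E \<in> brs B \<Longrightarrow> u \<in> last E \<Longrightarrow> \<not> eprec T B E u"
proof
  assume E: "E \<in> brs B" "u \<in> last E" "eprec T B E u"
  then obtain i A where A: "(tpar T ^^ i) u \<in> last A" "((butlast ^^ i) E, A) \<in> bless B"
    by (auto simp: eprec_def)
  note d = blessD[OF A(2)]
  have "(tpar T ^^ i) u \<in> last ((butlast ^^ i) E)" using pow_last E brs_ne d by blast
  then show False using d A by blast
qed

text \<open>Let \<open>A\<close>, at height \<open>i\<close>, witness \<open>eprec\<close> for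
  \<open>u\<close>. It cannot contain the truncation of \<open>E\<close>, or it would witness
  \<open>u'\<close> as well; so it lies inside, which puts the next truncation of \<open>E'\<close>
  inside that of \<open>E\<close>. If these coincide, the \<open>i\<close>-th truncations of
  \<open>E'\<close> and \<open>E\<close> must meet, since otherwise \<open>bless_transfer\<close>
  would place the former before the latter, and nestedness gives a proper containment.\<close>

lemma eprec_differ:
  assumes E: "E \<in> brs B" "E' \<in> brs B" "length E' = length E" "u \<in> last E" "u' \<in> last E"
    and e: "eprec T B E' u" "\<not> eprec T B E' u'"
  shows "\<exists>i. (butlast ^^ i) E' \<sqsubset>b (butlast ^^ i) E"
proof -
  obtain i A where A: "A \<in> brs B" "(tpar T ^^ i) u \<in> last A" "((butlast ^^ i) E', A) \<in> bless B"
    using e by (auto simp: eprec_def)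
  let ?E = "(butlast ^^ i) E" and ?E' = "(butlast ^^ i) E'" and ?a = "(tpar T ^^ i) u" and ?a' = "(tpar T ^^ i) u'"
  note d = blessD[OF A(3)]
  have "length ?E = length ?E'" using E by (simp add: butlast_pow_length)
  moreover have "?E' \<noteq> []" using d brs_ne by blast
  ultimately have ne: "?E \<noteq> []" by auto
  then have EB: "?E \<in> brs B" using butlast_pow_in E by blast
  have a: "?a \<in> last ?E" "?a' \<in> last ?E" using pow_last E ne by blast+
  have no: "?a' \<notin> last D" if "D \<in> brs B" "(?E', D) \<in> bless B" for D
    using e(2) that unfolding eprec_def by blast
  have "\<not> ?E \<sqsubseteq>b A" using no[OF A(1,3)] bsub_brs[OF EB A(1)] a by blast
  then have AE: "A \<sqsubseteq>b ?E" using nested[OF EB A(1) a(1) A(2)] by blast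
  then have s: "butlast ?E' \<sqsubseteq>b butlast ?E" using bsub_brs[OF A(1) EB] d by simp
  show ?thesis
  proof (cases "butlast ?E' = butlast ?E")
    case True
    obtain x where x: "x \<in> last ?E'" using brs_ex d by blast
    have "last ?E' \<inter> last ?E \<noteq> {}"
    proof
      assume disj: "last ?E' \<inter> last ?E = {}"
      have "(?E', ?E) \<in> bless B"
        by (rule bless_transfer[OF A(3) _ EB True disj x x A(2) a(1)]) (use d in blast)
      then show False using no[OF EB] a by blast
    qed
    then obtain y where y: "y \<in> last ?E'" "y \<in> last ?E" by blast
    have n: "\<not> last ?E \<subseteq> last ?E'" using d A(2) a by blast
    then have "last ?E' \<subseteq> last ?E" using fiber_nested[OF EB _ True[symmetric] y(2,1)] d by blast
    then have "?E' \<sqsubseteq>b ?E" using fiber_bsub[OF _ EB True] d by blast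
    moreover have "?E' \<noteq> ?E" using n by auto
    ultimately show ?thesis by blast
  next
    case False
    then show ?thesis using s by (intro exI[of _ "Suc i"]) simp
  qed
qed

text \<open>Shifts the strict containment to the truncations, the form used by the induction over
  fibres. For \<open>i = 0\<close> strictness survives because the fibres differ.\<close>

lemma eprec_differ_fiber:
  assumes E: "E \<in> brs B" "E' \<in> brs B" "length E' = length E" "u \<in> last E" "u' \<in> last E"
    and e: "eprec T B E' u \<noteq> eprec T B E' u'" and n: "butlast E' \<noteq> butlast E"
  shows "\<exists>i. (butlast ^^ i) (butlast E') \<sqsubset>b (butlast ^^ i) (butlast E)"
proof -
  obtain i where i: "(butlast ^^ i) E' \<sqsubset>b (butlast ^^ i) E"
    using eprec_differ[OF E(1-5)] eprec_differ[OF E(1-3) E(5,4)] e by blast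
  show ?thesis
  proof (cases i)
    case 0
    then have "butlast E' \<sqsubseteq>b butlast E" using i bsub_brs[OF E(2,1)] by simp
    then show ?thesis using n by (intro exI[of _ 0]) simp
  next
    case (Suc j)
    then show ?thesis using i by (intro exI[of _ j]) (simp add: funpow_swap1)
  qed
qed

lemma minel_sub: "minel B m \<Longrightarrow> D \<in> brs B \<Longrightarrow> butlast D = butlast m \<Longrightarrow> v \<in> last m \<Longrightarrow> v \<in> last D \<Longrightarrow> last m \<subseteq> last D"
  unfolding minel_def by blast

lemma fiber_minel:
  assumes "D \<in> brs B" "v \<in> last D" "butlast D \<noteq> []"
  obtains m where "minel B m" "butlast m = butlast D" "v \<in> last m" "last m \<subseteq> last D"
proof -
  have "v \<in> ch T (tpar T v)" "tpar T v \<in> last (butlast D)" "butlast D \<in> brs B"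
    using brs_butlast[OF assms(1,3)] assms(2) by auto
  then obtain m where "minel B m" "butlast m = butlast D" "v \<in> last m" using min_elt by metis
  then show ?thesis using that minel_sub assms by metis
qed

text \<open>Among the pairs of minimal brackets whose smallest common bracket is \<open>E\<close>, one with the fewest
  minimal brackets in between has none: an intermediate one would yield a closer pair.\<close>

lemma adjacent:
  assumes E: "E \<in> brs B" "butlast E \<noteq> []" "\<not> minel B E"
  obtains m m' where "minel B m" "minel B m'" "butlast m = butlast E" "butlast m' = butlast E"
    "(m, m') \<in> bless B" "last m \<subseteq> last E" "last m' \<subseteq> last E"
    "\<And>D. D \<in> brs B \<Longrightarrow> butlast D = butlast E \<Longrightarrow> last m \<subseteq> last D \<Longrightarrow> last m' \<subseteq> last D \<Longrightarrow> last E \<subseteq> last D"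
    "\<And>m''. minel B m'' \<Longrightarrow> (m, m'') \<in> bless B \<Longrightarrow> (m'', m') \<in> bless B \<Longrightarrow> False"
proof -
  let ?P = "butlast E"
  define K where "K = (\<lambda>p. case p of (m, m') \<Rightarrow> minel B m \<and> minel B m' \<and> butlast m = ?P \<and> butlast m' = ?P \<and>
     (m, m') \<in> bless B \<and> last m \<subseteq> last E \<and> last m' \<subseteq> last E \<and>
     (\<forall>D \<in> brs B. butlast D = ?P \<longrightarrow> last m \<subseteq> last D \<longrightarrow> last m' \<subseteq> last D \<longrightarrow> last E \<subseteq> last D))"
  define btw where "btw = (\<lambda>(m, m'). {m''. minel B m'' \<and> (m, m'') \<in> bless B \<and> (m'', m') \<in> bless B})"
  have fin: "finite (btw p)" for p
    by (rule finite_subset[OF _ finite_brs]) (auto simp: btw_def minel_def split: prod.splits)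
  have "\<exists>p. K p"
  proof -
    let ?S = "{D \<in> brs B. butlast D = ?P \<and> last D \<subset> last E}"
    obtain D0 where D0: "D0 \<in> brs B" "butlast D0 = ?P" "last D0 \<inter> last E \<noteq> {}" "\<not> last E \<subseteq> last D0"
      using E unfolding minel_def by blast
    then obtain y where y: "y \<in> last D0" "y \<in> last E" by blast
    then have "D0 \<in> ?S" using fiber_nested[OF D0(1) E(1) D0(2) y] D0 by blast
    moreover have "finite ?S" using finite_brs by simp
    \<comment> \<open>\<open>D\<close> is a maximal proper sub-bracket of \<open>E\<close> in the
      fibre. Any bracket containing a vertex of \<open>D\<close> and a vertex of \<open>E\<close>
      outside \<open>D\<close> is then larger than \<open>D\<close>, hence contains
      \<open>E\<close>.\<close>
    ultimately obtain D where D: "D \<in> ?S" and mx: "\<And>D'. D' \<in> ?S \<Longrightarrow> card (last D') \<le> card (last D)"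
    proof -
      have f: "finite ((\<lambda>D. card (last D)) ` ?S)" using finite_brs by simp
      have n: "(\<lambda>D. card (last D)) ` ?S \<noteq> {}" using \<open>D0 \<in> ?S\<close> by blast
      obtain D where "D \<in> ?S" "card (last D) = Max ((\<lambda>D. card (last D)) ` ?S)" using Max_in[OF f n] by fastforce
      then show ?thesis using that[of D] Max_ge[OF f] by simp
    qed
    obtain v where v: "v \<in> last D" using brs_ex D by blast
    obtain v' where v': "v' \<in> last E" "v' \<notin> last D" using D by blast
    have vE: "v \<in> last E" using D v by blast
    obtain m where m: "minel B m" "butlast m = ?P" "v \<in> last m" "last m \<subseteq> last E"
      using fiber_minel[OF E(1) vE E(2)] by metis
    obtain m' where m': "minel B m'" "butlast m' = ?P" "v' \<in> last m'" "last m' \<subseteq> last E"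
      using fiber_minel[OF E(1) v'(1) E(2)] by metis
    have mD: "last m \<subseteq> last D" using minel_sub[OF m(1) _ _ m(3) v] D m by auto
    have both: "last E \<subseteq> last D'" if D': "D' \<in> brs B" "butlast D' = ?P" "last m \<subseteq> last D'" "last m' \<subseteq> last D'" for D'
    proof (rule ccontr)
      assume n: "\<not> last E \<subseteq> last D'"
      have "last D' \<subseteq> last E" using fiber_nested[OF D'(1) E(1) D'(2), of v] vE m D' n by blast
      then have "D' \<in> ?S" using D' n by blast
      moreover have "last D \<subset> last D'" using fiber_nested[of D D' v] D D' v m m' v' by auto
      then have "card (last D) < card (last D')" using finite_last D' by (simp add: psubset_card_mono)
      ultimately show False using mx[of D'] by simp
    qed
    have mB: "m \<in> brs B" "m' \<in> brs B" using m m' by (auto simp: minel_def)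
    have "last m \<inter> last m' = {}"
    proof (rule ccontr)
      assume "last m \<inter> last m' \<noteq> {}"
      then obtain z where z: "z \<in> last m" "z \<in> last m'" by blast
      have "m = m'" by (rule minel_unique[OF m(1) m'(1) _ z]) (use m m' in simp)
      then show False using mD m'(3) v'(2) by blast
    qed
    then have "(m, m') \<in> bless B \<or> (m', m) \<in> bless B" using bless_total[OF mB] m m' by simp
    then have "K (m, m') \<or> K (m', m)" unfolding K_def prod.case using m m' both by blast
    then show ?thesis by blast
  qed
  then obtain p0 where "K p0" by blast
  then obtain p where p: "K p" and min: "\<And>q. K q \<Longrightarrow> card (btw p) \<le> card (btw q)"
    using ex_has_least_nat[of K p0 "\<lambda>q. card (btw q)"] by blast
  obtain m m' where pm: "p = (m, m')" by (cases p)
  have k: "minel B m" "minel B m'" "butlast m = ?P" "butlast m' = ?P" "(m, m') \<in> bless B"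
     "last m \<subseteq> last E" "last m' \<subseteq> last E"
    and both: "\<And>D. D \<in> brs B \<Longrightarrow> butlast D = ?P \<Longrightarrow> last m \<subseteq> last D \<Longrightarrow> last m' \<subseteq> last D \<Longrightarrow> last E \<subseteq> last D"
    using p unfolding K_def pm by auto
  have mB: "m \<in> brs B" "m' \<in> brs B" using k by (auto simp: minel_def)
  have False if m'': "minel B m''" "(m, m'') \<in> bless B" "(m'', m') \<in> bless B" for m''
  proof -
    have mB'': "m'' \<in> brs B" "butlast m'' = ?P" using m'' blessD k by (auto simp: minel_def)
    obtain x where x: "x \<in> last m" using brs_ex mB by blast
    obtain x' where x': "x' \<in> last m'" using brs_ex mB by blast
    obtain z where z: "z \<in> last m''" using brs_ex mB'' by blast
    \<comment> \<open>If \<open>E\<close> missed \<open>m''\<close>, it would have to come before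
      \<open>m''\<close> because it contains \<open>m\<close>, and after it because it contains
      \<open>m'\<close>.\<close>
    have "last E \<inter> last m'' \<noteq> {}"
    proof
      assume disj: "last E \<inter> last m'' = {}"
      have "(E, m'') \<in> bless B"
        by (rule bless_transfer[OF m''(2) E(1) mB''(1) _ disj x _ z z]) (use mB'' x k in auto)
      moreover have "(m'', E) \<in> bless B"
        by (rule bless_transfer[OF m''(3) mB''(1) E(1) _ _ z z x']) (use mB'' x' k disj in auto)
      ultimately show False using bless_asym by blast
    qed
    then obtain y where y: "y \<in> last m''" "y \<in> last E" by blast
    have mE: "last m'' \<subseteq> last E"
      by (rule minel_sub[OF m''(1) E(1) _ y]) (use mB'' in simp)
    let ?b = "\<lambda>n n'. \<forall>D \<in> brs B. butlast D = ?P \<longrightarrow> last n \<subseteq> last D \<longrightarrow> last n' \<subseteq> last D \<longrightarrow> last E \<subseteq> last D"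
    have Ks: "?b m m'' \<Longrightarrow> K (m, m'')" "?b m'' m' \<Longrightarrow> K (m'', m')"
      unfolding K_def prod.case using k(1-4,6,7) m'' mB''(2) mE by blast+
    \<comment> \<open>Otherwise each pair has a common bracket not containing \<open>E\<close>. Both
      of these contain \<open>m''\<close>, so they are nested, and the larger one contains
      \<open>m\<close> and \<open>m'\<close> without containing \<open>E\<close>.\<close>
    have "K (m, m'') \<or> K (m'', m')"
    proof (rule ccontr)
      assume "\<not> (K (m, m'') \<or> K (m'', m'))"
      then have "\<not> ?b m m''" "\<not> ?b m'' m'" using Ks by blast+
      then obtain D1 D2 where D: "D1 \<in> brs B" "butlast D1 = ?P" "last m \<subseteq> last D1" "last m'' \<subseteq> last D1" "\<not> last E \<subseteq> last D1"
        "D2 \<in> brs B" "butlast D2 = ?P" "last m'' \<subseteq> last D2" "last m' \<subseteq> last D2" "\<not> last E \<subseteq> last D2"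
        by blast
      have "last D1 \<subseteq> last D2 \<or> last D2 \<subseteq> last D1" using fiber_nested[of D1 D2 z] D z by auto
      then show False
      proof
        assume "last D1 \<subseteq> last D2"
        then have "last m \<subseteq> last D2" using D(3) by (rule subset_trans[rotated])
        then show False using both[OF D(6,7) _ D(9)] D(10) by simp
      next
        assume "last D2 \<subseteq> last D1"
        then have "last m' \<subseteq> last D1" using D(9) by (rule subset_trans[rotated])
        then show False using both[OF D(1,2,3)] D(5) by simp
      qed
    qed
    moreover have "btw (m, m'') \<subset> btw (m, m')" "btw (m'', m') \<subset> btw (m, m')"
      using m'' bless_trans bless_irrefl unfolding btw_def by blast+
    then have "card (btw (m, m'')) < card (btw p)" "card (btw (m'', m')) < card (btw p)"
      using fin pm by (auto intro: psubset_card_mono)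
    ultimately show False using min by (meson not_le)
  qed
  note btw_empty = this
  show ?thesis
    by (rule that[OF k]) (erule (3) both, erule (2) btw_empty)
qed

end

locale recover = brk T B for T :: "'v plane_tree" and B +
  fixes G :: "real set" and d :: "'v bracket \<Rightarrow> real"
  assumes G0: "0 \<in> G" and Gdiff: "x \<in> G \<Longrightarrow> y \<in> G \<Longrightarrow> x - y \<in> G"
    and fl: "flow T B d" and Vel_G: "Vel T B d k i \<in> G"
begin

lemma Gadd: "x \<in> G \<Longrightarrow> y \<in> G \<Longrightarrow> x + y \<in> G"
  using Gdiff[of x "0 - y"] Gdiff[OF G0, of y] by simp

lemma Gsum: "(\<And>x. x \<in> S \<Longrightarrow> f x \<in> G) \<Longrightarrow> sum f S \<in> G"
  by (induction S rule: infinite_finite_induct) (auto simp: G0 intro: Gadd)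

text \<open>The coordinates compare neighbours only; telescoping reaches any two vertices of a
  level.\<close>

lemma vel_G:
  assumes k: "1 \<le> k" and u: "u \<in> level T k" "u' \<in> level T k"
  shows "vel T B d k u - vel T B d k u' \<in> G"
proof -
  let ?f = "\<lambda>i. vel T B d k (lvert T k i)"
  have st: "?f i - ?f (Suc i) \<in> G" if "1 \<le> i" "Suc i \<le> card (level T k)" for i
  proof -
    have "coord T k i" using that k level_le_depth[OF u(1)] by (simp add: coord_def)
    then show ?thesis using Vel_G[of k i] by (simp add: Vel_def)
  qed
  have "Suc i \<le> card (level T k) \<Longrightarrow> ?f 1 - ?f (Suc i) \<in> G" for i
  proof (induction i)
    case (Suc i)
    then show ?case using Gadd[OF _ st[of "Suc i"]] by fastforce
  qed (simp add: G0)
  then have "?f 1 - ?f i \<in> G" if "1 \<le> i" "i \<le> card (level T k)" for i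
    using that by (cases i) auto
  then have "?f 1 - vel T B d k v \<in> G" if "v \<in> level T k" for v
    using lpos_range[OF that] lvert_lpos[OF that] by metis
  from Gdiff[OF this[OF u(2)] this[OF u(1)]] show ?thesis by simp
qed

definition tot :: "nat \<Rightarrow> 'v \<Rightarrow> real" where
  "tot k x = (\<Sum>E | E \<in> brs B \<and> length E = Suc k \<and> x \<in> last E. d E)"

definition ep :: "nat \<Rightarrow> 'v \<Rightarrow> real" where
  "ep k u = (\<Sum>E | E \<in> brs B \<and> length E = Suc k. d E * (if eprec T B E u then 1 else 0))"

text \<open>Double counting: the sum over brackets of their vertices before \<open>u\<close> is
  exchanged for a sum over these vertices.\<close>

lemma vel_eq: "vel T B d k u = ep k u - (\<Sum>x | x \<in> level T k \<and> tless T x u. tot k x)"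
proof -
  let ?L = "{E. E \<in> brs B \<and> length E = Suc k}" and ?X = "{x. x \<in> level T k \<and> tless T x u}"
  have fL: "finite ?L" using finite_brs by simp
  have fX: "finite ?X" by simp
  have "(\<Sum>E\<in>?L. d E * real (card {x \<in> last E. tless T x u})) = (\<Sum>E\<in>?L. \<Sum>x\<in>?X. if x \<in> last E then d E else 0)"
  proof (rule sum.cong[OF refl])
    fix E assume "E \<in> ?L"
    then have "{x \<in> last E. tless T x u} = ?X \<inter> {x. x \<in> last E}" using brs_level by blast
    then show "d E * real (card {x \<in> last E. tless T x u}) = (\<Sum>x\<in>?X. if x \<in> last E then d E else 0)"
      using fX by (simp add: sum.If_cases)
  qed
  also have "\<dots> = (\<Sum>x\<in>?X. \<Sum>E\<in>?L. if x \<in> last E then d E else 0)" by (rule sum.swap)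
  also have "\<dots> = (\<Sum>x\<in>?X. tot k x)"
    unfolding tot_def using fL
    by (intro sum.cong[OF refl]) (simp add: sum.If_cases Int_def conj_ac)
  finally have "(\<Sum>E\<in>?L. d E * real (card {x \<in> last E. tless T x u})) = (\<Sum>x\<in>?X. tot k x)" .
  then show ?thesis unfolding vel_def ep_def gco_def
    by (simp add: right_diff_distrib sum_subtractf)
qed

text \<open>Group the brackets through \<open>x\<close> by their truncation \<open>Q\<close>. If
  \<open>Q\<close> is not a singleton, the flow equation makes the group sum to \<open>d Q\<close>,
  which \<open>low\<close> controls; the group over the singleton bracket of the parent
  remains.\<close>

lemma tot_sing:
  assumes low: "\<And>Q. Q \<in> brs B \<Longrightarrow> length Q = Suc k \<Longrightarrow> d Q \<in> G" and x: "x \<in> level T (Suc k)"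
  shows "tot (Suc k) x - (\<Sum>D | D \<in> brs B \<and> butlast D = sing_br T (tpar T x) \<and> x \<in> last D. d D) \<in> G"
proof -
  let ?p = "tpar T x"
  let ?Q = "{Q \<in> brs B. length Q = Suc k \<and> ?p \<in> last Q}"
  let ?F = "\<lambda>Q. {D. D \<in> brs B \<and> butlast D = Q \<and> x \<in> last D}"
  note px = level_Suc_par[OF x]
  have fin: "finite ?Q" "\<And>Q. finite (?F Q)" using finite_brs by simp_all
  have "{E. E \<in> brs B \<and> length E = Suc (Suc k) \<and> x \<in> last E} = (\<Union>Q\<in>?Q. ?F Q)"
  proof (intro equalityI subsetI)
    fix E assume E: "E \<in> {E. E \<in> brs B \<and> length E = Suc (Suc k) \<and> x \<in> last E}"
    then have "butlast E \<in> ?Q" using brs_par[of E x] px by auto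
    then show "E \<in> (\<Union>Q\<in>?Q. ?F Q)" using E by blast
  next
    fix E assume "E \<in> (\<Union>Q\<in>?Q. ?F Q)"
    then have "E \<in> brs B" "x \<in> last E" by auto
    then show "E \<in> {E. E \<in> brs B \<and> length E = Suc (Suc k) \<and> x \<in> last E}"
      using brs_rdist x by (auto simp: level_def)
  qed
  then have "tot (Suc k) x = sum d (\<Union>Q\<in>?Q. ?F Q)" by (simp add: tot_def)
  also have "\<dots> = (\<Sum>Q\<in>?Q. sum d (?F Q))"
    by (rule sum.UNION_disjoint) (use fin in auto)
  also have "\<dots> = sum d (?F (sing_br T ?p)) + (\<Sum>Q\<in>?Q - {sing_br T ?p}. sum d (?F Q))"
  proof (rule sum.remove[OF fin(1)])
    have "?p \<in> tverts T" "rdist T ?p = k" using px by (simp_all add: level_def)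
    then show "sing_br T ?p \<in> ?Q" using sing_in by simp
  qed
  finally have "tot (Suc k) x - sum d (?F (sing_br T ?p)) = (\<Sum>Q\<in>?Q - {sing_br T ?p}. sum d (?F Q))" by simp
  moreover have "sum d (?F Q) \<in> G" if "Q \<in> ?Q - {sing_br T ?p}" for Q
  proof -
    have "\<not> is_singleton_br T Q" using that by (auto simp: is_sing_iff)
    then have "d Q = sum d (?F Q)" by (intro flow_sum[OF fl, of Q ?p x]) (use that px in simp_all)
    then show ?thesis using low[of Q] that by simp
  qed
  ultimately show ?thesis using Gsum[of "?Q - {sing_br T ?p}"] by simp
qed

text \<open>Brackets outside the fibre that separate \<open>u\<close> from \<open>u'\<close> have
  values in \<open>G\<close>, by \<open>eprec_differ_fiber\<close> and \<open>below\<close>. Inside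
  the fibre, adjacency of \<open>m\<close> and \<open>m'\<close> reduces the coefficient to the
  indicator of containing \<open>u\<close> but not \<open>u'\<close>.\<close>

lemma fiber_step:
  assumes E: "E \<in> brs B" "length E = Suc (Suc k)"
    and below: "\<And>E' i. E' \<in> brs B \<Longrightarrow> length E' = length E \<Longrightarrow>
      (butlast ^^ i) (butlast E') \<sqsubset>b (butlast ^^ i) (butlast E) \<Longrightarrow> d E' \<in> G"
    and m: "minel B m" "minel B m'" "butlast m = butlast E" "butlast m' = butlast E"
    "(m, m') \<in> bless B" "last m \<subseteq> last E" "last m' \<subseteq> last E"
    and btw: "\<And>m''. minel B m'' \<Longrightarrow> (m, m'') \<in> bless B \<Longrightarrow> (m'', m') \<in> bless B \<Longrightarrow> False"
    and u: "u \<in> last m" "u' \<in> last m'"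
  shows "(\<Sum>D | D \<in> brs B \<and> butlast D = butlast E \<and> u \<in> last D \<and> u' \<notin> last D. d D)
    - ((\<Sum>x | x \<in> level T (Suc k) \<and> tless T x u'. tot (Suc k) x)
      - (\<Sum>x | x \<in> level T (Suc k) \<and> tless T x u. tot (Suc k) x)) \<in> G" (is "?A - ?t \<in> G")
proof -
  let ?P = "butlast E"
  let ?e = "\<lambda>E u. if eprec T B E u then 1 else (0::real)"
  let ?L = "{E. E \<in> brs B \<and> length E = Suc (Suc k)}"
  let ?fib = "{D \<in> brs B. butlast D = ?P}"
  have uE: "u \<in> last E" "u' \<in> last E" using u m by blast+
  have uL: "u \<in> level T (Suc k)" "u' \<in> level T (Suc k)" using uE brs_level[OF E] by blast+
  have Pne: "?P \<noteq> []" using E by (metis length_butlast diff_Suc_1 list.size(3) nat.distinct(1))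
  have mB: "m \<in> brs B" "m' \<in> brs B" using m by (auto simp: minel_def)
  have len: "length D = Suc (Suc k)" if "D \<in> brs B" "butlast D = ?P" for D
    using that E brs_ne by (metis append_butlast_last_id length_append_singleton)
  \<comment> \<open>The parent of \<open>v\<close> lies in the common truncation, so by
    \<open>eprec_self\<close> only the top comparison counts, and it can be tested on the minimal
    bracket.\<close>
  have ep_m: "eprec T B D v \<longleftrightarrow> (D, n) \<in> bless B"
    if D: "D \<in> brs B" "butlast D = ?P" and n: "minel B n" "butlast n = ?P" "v \<in> last n" "v \<in> last E" for D n v
  proof -
    have nB: "n \<in> brs B" using n by (simp add: minel_def)
    have "tpar T v \<in> last ?P" "?P \<in> brs B" using brs_butlast[OF E(1) Pne] n by auto
    then have "\<not> eprec T B (butlast D) (tpar T v)" using eprec_self D by simp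
    then have "eprec T B D v \<longleftrightarrow> (\<exists>A \<in> brs B. v \<in> last A \<and> (D, A) \<in> bless B)"
      using eprec_rec[of T B D v] by blast
    also have "\<dots> \<longleftrightarrow> (D, n) \<in> bless B"
    proof
      assume "\<exists>A \<in> brs B. v \<in> last A \<and> (D, A) \<in> bless B"
      then obtain A where A: "A \<in> brs B" "v \<in> last A" "(D, A) \<in> bless B" by blast
      have "v \<notin> last D" using blessD[OF A(3)] A by blast
      then have disj: "last D \<inter> last n = {}" by (rule minel_disj[OF n(1) D(1) _ n(3), rotated]) (use D n in simp)
      obtain x where x: "x \<in> last D" using brs_ex D by blast
      show "(D, n) \<in> bless B"
        by (rule bless_transfer[OF A(3) D(1) nB _ disj x x A(2) n(3)]) (use D n in simp)
    qed (use n nB in blast)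
    finally show ?thesis .
  qed
  have diff: "?e D u' - ?e D u = (if u \<in> last D \<and> u' \<notin> last D then 1 else 0)"
    if D: "D \<in> brs B" "butlast D = ?P" for D
  proof -
    have e: "eprec T B D u \<longleftrightarrow> (D, m) \<in> bless B" "eprec T B D u' \<longleftrightarrow> (D, m') \<in> bless B"
      using ep_m[OF D] m u uE by blast+
    have imp: "(D, m') \<in> bless B" if "(D, m) \<in> bless B" using bless_trans[OF that m(5)] .
    \<comment> \<open>If \<open>D\<close> precedes \<open>m'\<close> but not \<open>m\<close> and
      misses \<open>u\<close>, it comes after \<open>m\<close>; a minimal bracket inside
      \<open>D\<close> would then lie strictly between \<open>m\<close> and
      \<open>m'\<close>.\<close>
    have iff: "(D, m') \<in> bless B \<and> (D, m) \<notin> bless B \<longleftrightarrow> u \<in> last D \<and> u' \<notin> last D"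
    proof
      assume l: "(D, m') \<in> bless B \<and> (D, m) \<notin> bless B"
      then have u'D: "u' \<notin> last D" using blessD[of D m'] u by blast
      have "u \<in> last D"
      proof (rule ccontr)
        assume "u \<notin> last D"
        then have "last D \<inter> last m = {}" by (rule minel_disj[OF m(1) D(1) _ u(1), rotated]) (use D m in simp)
        then have mD: "(m, D) \<in> bless B" using bless_total[OF D(1) mB(1)] D m l by simp
        obtain x where x: "x \<in> last D" using brs_ex D by blast
        have "butlast D \<noteq> []" using D Pne by simp
        then obtain m'' where m'': "minel B m''" "butlast m'' = butlast D" "x \<in> last m''" "last m'' \<subseteq> last D"
          using fiber_minel[OF D(1) x] by metis
        have mB'': "m'' \<in> brs B" using m'' by (simp add: minel_def)
        have "(m, m'') \<in> bless B"
          by (rule bless_transfer[OF mD mB(1) mB'' _ _ u(1) u(1) x m''(3)])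
            (use D m m'' blessD[OF mD] in auto)
        moreover have "(m'', m') \<in> bless B"
          by (rule bless_transfer[OF _ mB'' mB(2) _ _ x m''(3) u(2) u(2)])
            (use D m m'' l blessD[of D m'] in auto)
        ultimately show False using btw m'' by blast
      qed
      then show "u \<in> last D \<and> u' \<notin> last D" using u'D by blast
    next
      assume l: "u \<in> last D \<and> u' \<notin> last D"
      then have disj: "last D \<inter> last m' = {}" using minel_disj[OF m(2) D(1) _ u(2)] D m by simp
      have "(D, m') \<in> bless B"
        by (rule bless_transfer[OF m(5) D(1) mB(2) _ disj u(1) _ u(2) u(2)]) (use D m l in auto)
      moreover have "(D, m) \<notin> bless B" using blessD[of D m] l u by blast
      ultimately show "(D, m') \<in> bless B \<and> (D, m) \<notin> bless B" by blast
    qed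
    show ?thesis using e imp iff by auto
  qed
  have fin: "finite ?L" using finite_brs by simp
  have sub: "?fib \<subseteq> ?L" using len by auto
  have "ep (Suc k) u' - ep (Suc k) u = (\<Sum>D\<in>?L. d D * (?e D u' - ?e D u))"
    by (simp add: ep_def right_diff_distrib sum_subtractf)
  also have "\<dots> = (\<Sum>D\<in>?L - ?fib. d D * (?e D u' - ?e D u)) + (\<Sum>D\<in>?fib. d D * (?e D u' - ?e D u))"
    by (rule sum.subset_diff[OF sub fin])
  also have "(\<Sum>D\<in>?fib. d D * (?e D u' - ?e D u)) = ?A"
  proof -
    have "(\<Sum>D\<in>?fib. d D * (?e D u' - ?e D u)) = (\<Sum>D\<in>?fib. if u \<in> last D \<and> u' \<notin> last D then d D else 0)"
    proof (rule sum.cong[OF refl])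
      fix D assume D: "D \<in> ?fib"
      then have "?e D u' - ?e D u = (if u \<in> last D \<and> u' \<notin> last D then 1 else 0)" using diff[of D] by simp
      then show "d D * (?e D u' - ?e D u) = (if u \<in> last D \<and> u' \<notin> last D then d D else 0)"
        by (simp only:) simp
    qed
    also have "\<dots> = ?A" using finite_brs by (simp add: sum.If_cases Int_def conj_ac)
    finally show ?thesis .
  qed
  finally have e: "ep (Suc k) u' - ep (Suc k) u = (\<Sum>D\<in>?L - ?fib. d D * (?e D u' - ?e D u)) + ?A" .
  have "(\<Sum>D\<in>?L - ?fib. d D * (?e D u' - ?e D u)) \<in> G"
  proof (rule Gsum)
    fix D assume D: "D \<in> ?L - ?fib"
    show "d D * (?e D u' - ?e D u) \<in> G"
    proof (cases "eprec T B D u' = eprec T B D u")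
      case True
      then show ?thesis by (simp add: G0)
    next
      case False
      then have "\<exists>i. (butlast ^^ i) (butlast D) \<sqsubset>b (butlast ^^ i) ?P"
        using eprec_differ_fiber[of E D u u'] E D uE by auto
      then have "d D \<in> G" using below[of D] D E by auto
      then show ?thesis using False Gdiff[OF G0, of "d D"] by auto
    qed
  qed
  moreover have "vel T B d (Suc k) u' - vel T B d (Suc k) u \<in> G" using vel_G uL by simp
  moreover have "vel T B d (Suc k) u' - vel T B d (Suc k) u = (ep (Suc k) u' - ep (Suc k) u) - ?t"
    by (simp add: vel_eq)
  ultimately have "((ep (Suc k) u' - ep (Suc k) u) - ?t) - (\<Sum>D\<in>?L - ?fib. d D * (?e D u' - ?e D u)) \<in> G"
    using Gdiff by simp
  then show ?thesis unfolding e by (simp add: algebra_simps)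
qed

text \<open>Tail sums of the chains in a fibre: these, rather than single values, are what velocity
  differences determine.\<close>

definition above :: "'v bracket \<Rightarrow> real" where
  "above E = (\<Sum>D | D \<in> brs B \<and> butlast D = butlast E \<and> last E \<subseteq> last D. d D)"

text \<open>Of the brackets through \<open>u\<close>, those that also contain \<open>u'\<close>
  contain \<open>m\<close> and \<open>m'\<close>, hence are exactly the ones containing
  \<open>E\<close>.\<close>

lemma above_diff:
  assumes E: "E \<in> brs B"
    and m: "u \<in> last m" "u' \<in> last m'" "minel B m" "minel B m'" "butlast m = butlast E" "butlast m' = butlast E"
    "last m \<subseteq> last E" "last m' \<subseteq> last E"
    and both: "\<And>D. D \<in> brs B \<Longrightarrow> butlast D = butlast E \<Longrightarrow> last m \<subseteq> last D \<Longrightarrow> last m' \<subseteq> last D \<Longrightarrow> last E \<subseteq> last D"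
  shows "(\<Sum>D | D \<in> brs B \<and> butlast D = butlast E \<and> u \<in> last D. d D)
    - (\<Sum>D | D \<in> brs B \<and> butlast D = butlast E \<and> u \<in> last D \<and> u' \<notin> last D. d D) = above E"
proof -
  have iff: "u \<in> last D \<and> u' \<in> last D \<longleftrightarrow> last E \<subseteq> last D" if D: "D \<in> brs B" "butlast D = butlast E" for D
  proof
    assume "u \<in> last D \<and> u' \<in> last D"
    then show "last E \<subseteq> last D"
      using both[OF D] minel_sub[OF m(3) D(1) _ m(1)] minel_sub[OF m(4) D(1) _ m(2)] D m by simp
  qed (use m in blast)
  have "{D. D \<in> brs B \<and> butlast D = butlast E \<and> u \<in> last D} =
      {D. D \<in> brs B \<and> butlast D = butlast E \<and> u \<in> last D \<and> u' \<notin> last D} \<union>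
      {D. D \<in> brs B \<and> butlast D = butlast E \<and> last E \<subseteq> last D}"
    using iff by blast
  moreover have "sum d ({D. D \<in> brs B \<and> butlast D = butlast E \<and> u \<in> last D \<and> u' \<notin> last D} \<union>
      {D. D \<in> brs B \<and> butlast D = butlast E \<and> last E \<subseteq> last D}) =
      (\<Sum>D | D \<in> brs B \<and> butlast D = butlast E \<and> u \<in> last D \<and> u' \<notin> last D. d D) + above E"
    unfolding above_def by (rule sum.union_disjoint) (use finite_brs iff in auto)
  ultimately show ?thesis by simp
qed

text \<open>Undoes the summation from large brackets to small ones. Every bracket strictly above
  \<open>E\<close> in its fibre is nonminimal, which is the range of the first hypothesis.\<close>

lemma above_topdown:
  assumes P: "\<And>E. E \<in> brs B \<Longrightarrow> butlast E = P \<Longrightarrow> \<not> minel B E \<Longrightarrow> above E \<in> G"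
    and ab: "E \<in> brs B" "butlast E = P" "above E \<in> G"
  shows "d E \<in> G"
  using ab
proof (induction "card (tverts T) - card (last E)" arbitrary: E rule: less_induct)
  case less
  let ?S = "{D. D \<in> brs B \<and> butlast D = butlast E \<and> last E \<subseteq> last D}"
  have fin: "finite ?S" using finite_brs by simp
  have "above E = d E + (\<Sum>D\<in>?S - {E}. d D)"
    unfolding above_def by (rule sum.remove) (use fin less in auto)
  then have "d E = above E - (\<Sum>D\<in>?S - {E}. d D)" by simp
  moreover have "(\<Sum>D\<in>?S - {E}. d D) \<in> G"
  proof (rule Gsum)
    fix D assume D: "D \<in> ?S - {E}"
    then have s: "last E \<subset> last D" using fiber_eq[of D E] less by auto
    have "last D \<subseteq> tverts T" using brs_verts D by blast
    then have "card (last E) < card (last D)" "card (last D) \<le> card (tverts T)"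
      using s fin_verts finite_last[of D] D by (auto simp: psubset_card_mono card_mono)
    moreover have "\<not> minel B D"
    proof
      assume "minel B D"
      moreover have "last E \<inter> last D \<noteq> {}" using s brs_ex[of E] less by blast
      ultimately have "last D \<subseteq> last E" using D less(2) unfolding minel_def by simp
      then show False using s by blast
    qed
    ultimately show "d D \<in> G" using less(1)[of D] P[of D] D less by auto
  qed
  ultimately show ?case using Gdiff[OF less(4)] by simp
qed

lemma sing_sub_eq: "A \<in> brs B \<Longrightarrow> w \<in> tverts T \<Longrightarrow> A \<sqsubseteq>b sing_br T w \<Longrightarrow> A = sing_br T w"
proof (induction "rdist T w" arbitrary: A w)
  case 0
  then have w: "w = troot T" using rdist_0_iff[OF 0(3)] by simp
  then have "last A \<subseteq> {troot T}" using bsub_brs[OF 0(2) sing_in[OF 0(3)]] 0 by simp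
  then have "troot T \<in> last A" using brs_ex[OF 0(2)] by blast
  then show ?case using brs_root 0 w sing_br_root by simp
next
  case (Suc n)
  then have nr: "w \<noteq> troot T" by auto
  have s: "butlast A \<sqsubseteq>b butlast (sing_br T w)" "last A \<subseteq> {w}"
    using bsub_brs[OF Suc.prems(1) sing_in[OF Suc.prems(2)]] Suc.prems by auto
  then have w: "w \<in> last A" using brs_ex[OF Suc.prems(1)] by blast
  then have l: "last A = {w}" using s by blast
  have b: "butlast (sing_br T w) = sing_br T (tpar T w)" using butlast_sing_br nr Suc.prems by blast
  have "n = rdist T (tpar T w)" using Suc.hyps(2) rdist_par nr Suc.prems by simp
  then have "butlast A = sing_br T (tpar T w)"
    using Suc.hyps(1)[of "tpar T w" "butlast A"] s b brs_par[OF Suc.prems(1) w nr] par_in Suc.prems by simp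
  then show ?case using fiber_eq[OF Suc.prems(1) sing_in[OF Suc.prems(2)]] b l by simp
qed

text \<open>Makes singleton fibres the base case: the hypothesis \<open>below\<close> of
  \<open>fiber_step\<close> is vacuous there.\<close>

lemma not_below_sing:
  assumes Q: "Q \<in> brs B" "length Q = length (sing_br T w)" and w: "w \<in> tverts T"
  shows "\<not> (butlast ^^ i) Q \<sqsubset>b (butlast ^^ i) (sing_br T w)"
proof
  assume s: "(butlast ^^ i) Q \<sqsubset>b (butlast ^^ i) (sing_br T w)"
  then have ne: "(butlast ^^ i) Q \<noteq> []" by (auto simp: bsub_def)
  have "length ((butlast ^^ i) Q) = length ((butlast ^^ i) (sing_br T w))" using Q by (simp add: butlast_pow_length)
  then have ne': "(butlast ^^ i) (sing_br T w) \<noteq> []" using ne by auto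
  have "(butlast ^^ j) (sing_br T w) \<noteq> [] \<Longrightarrow> is_singleton_br T ((butlast ^^ j) (sing_br T w))" for j
  proof (induction j)
    case 0
    then show ?case using w by (auto simp: is_sing_iff)
  next
    case (Suc j)
    then show ?case using butlast_sing[of "(butlast ^^ j) (sing_br T w)"] by fastforce
  qed
  then obtain a where "a \<in> tverts T" "(butlast ^^ i) (sing_br T w) = sing_br T a" using ne' by (auto simp: is_sing_iff)
  then show False using sing_sub_eq[OF butlast_pow_in[OF Q(1) ne]] s by metis
qed

text \<open>Here the minimal brackets are singletons, and adjacent ones belong to neighbouring
  siblings \<open>u\<close>, \<open>u'\<close>, so the counting part in \<open>fiber_step\<close> is
  \<open>tot (Suc k) u\<close>. By \<open>tot_sing\<close> it equals, modulo \<open>G\<close>, the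
  full fibre sum through \<open>u\<close>, and subtracting leaves a tail sum.\<close>

lemma G_sing_fiber:
  assumes low: "\<And>Q. Q \<in> brs B \<Longrightarrow> length Q = Suc k \<Longrightarrow> d Q \<in> G"
    and w: "w \<in> tverts T" "rdist T w = k" and E: "E \<in> brs B" "butlast E = sing_br T w"
  shows "d E \<in> G"
proof -
  have ab: "above E \<in> G" if E: "E \<in> brs B" "butlast E = sing_br T w" "\<not> minel B E" for E
  proof -
    have lenE: "length E = Suc (Suc k)"
      using E(2) w brs_ne[OF E(1)] by (metis append_butlast_last_id length_append_singleton length_sing_br)
    have ne: "butlast E \<noteq> []" using E by simp
    obtain m m' where m: "minel B m" "minel B m'" "butlast m = butlast E" "butlast m' = butlast E"
      "(m, m') \<in> bless B" "last m \<subseteq> last E" "last m' \<subseteq> last E"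
      and both: "\<And>D. D \<in> brs B \<Longrightarrow> butlast D = butlast E \<Longrightarrow> last m \<subseteq> last D \<Longrightarrow> last m' \<subseteq> last D \<Longrightarrow> last E \<subseteq> last D"
      and btw: "\<And>m''. minel B m'' \<Longrightarrow> (m, m'') \<in> bless B \<Longrightarrow> (m'', m') \<in> bless B \<Longrightarrow> False"
      using adjacent[OF E(1) ne E(3)] by metis
    have mB: "m \<in> brs B" "m' \<in> brs B" using m by (auto simp: minel_def)
    obtain u where u: "u \<in> last m" using brs_ex mB by blast
    obtain u' where u': "u' \<in> last m'" using brs_ex mB by blast
    have ad: "(\<Sum>D | D \<in> brs B \<and> butlast D = butlast E \<and> u \<in> last D. d D)
        - (\<Sum>D | D \<in> brs B \<and> butlast D = butlast E \<and> u \<in> last D \<and> u' \<notin> last D. d D) = above E"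
      by (rule above_diff[OF E(1) u u' m(1-4) m(6,7)]) (erule (3) both)
    have chw: "v \<in> ch T w" if "v \<in> last D" "D \<in> brs B" "butlast D = sing_br T w" for v D
      using brs_butlast(3)[of D v] that by (metis last_sing_br singletonD sing_br_ne)
    have sm: "minel B (sing_br T v)" "butlast (sing_br T v) = sing_br T w" if "v \<in> ch T w" for v
      using that sing_in butlast_sing_br by (auto simp: minel_def in_ch)
    have uc: "u \<in> ch T w" "u' \<in> ch T w" using chw u u' mB m E by metis+
    have meq: "m = sing_br T u" "m' = sing_br T u'"
      using minel_unique[OF m(1) sm(1)[OF uc(1)] _ u] minel_unique[OF m(2) sm(1)[OF uc(2)] _ u'] sm uc m E by auto
    have uu': "(u, u') \<in> tsib T" using sing_less[OF uc] m(5) meq by simp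
    have wl: "w \<in> level T k" using w by (simp add: level_def)
    have uL: "u \<in> level T (Suc k)" "u' \<in> level T (Suc k)" using level_ch[OF wl] uc by auto
    have tuu': "tless T u u'" using tless_rec[of T u u'] uc uu' by (simp add: in_ch)
    \<comment> \<open>A vertex between two siblings has the same parent, and its singleton would be
      a minimal bracket between \<open>m\<close> and \<open>m'\<close>.\<close>
    have no: False if x: "x \<in> level T (Suc k)" "tless T u x" "tless T x u'" for x
    proof -
      note px = level_Suc_par[OF x(1)]
      have 1: "w = tpar T x \<and> (u, x) \<in> tsib T \<or> tless T w (tpar T x)"
        using tless_rec[of T u x] x uc by (auto simp: in_ch)
      have 2: "w = tpar T x \<and> (x, u') \<in> tsib T \<or> tless T (tpar T x) w"
        using tless_rec[of T x u'] x uc by (auto simp: in_ch)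
      have "w = tpar T x"
        using 1 2 tless_asym[OF wl, of "tpar T x"] px by blast
      moreover then have "\<not> tless T w (tpar T x)" "\<not> tless T (tpar T x) w" using tless_irrefl[OF wl] by auto
      ultimately have x': "x \<in> ch T w" "(u, x) \<in> tsib T" "(x, u') \<in> tsib T" using 1 2 px by auto
      then show False using btw[of "sing_br T x"] sm(1) sing_less uc meq by simp
    qed
    have set: "{x. x \<in> level T (Suc k) \<and> tless T x u'} = insert u {x. x \<in> level T (Suc k) \<and> tless T x u}"
      using no tuu' uL tless_total[OF _ uL(1)] tless_trans[OF _ uL] by blast
    have "(\<Sum>x | x \<in> level T (Suc k) \<and> tless T x u'. tot (Suc k) x)
      - (\<Sum>x | x \<in> level T (Suc k) \<and> tless T x u. tot (Suc k) x) = tot (Suc k) u"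
      unfolding set using tless_irrefl[OF uL(1)] by simp
    moreover have "d E' \<in> G" if "E' \<in> brs B" "length E' = length E"
        "(butlast ^^ i) (butlast E') \<sqsubset>b (butlast ^^ i) (butlast E)" for E' i
    proof -
      have "butlast E' \<noteq> []" using that lenE by (metis length_butlast diff_Suc_1 list.size(3) nat.distinct(1))
      then have "butlast E' \<in> brs B" using brs_butlast that by blast
      then show ?thesis using not_below_sing[of "butlast E'" w i] that w E lenE by simp
    qed
    ultimately have "(\<Sum>D | D \<in> brs B \<and> butlast D = butlast E \<and> u \<in> last D \<and> u' \<notin> last D. d D) - tot (Suc k) u \<in> G"
      using fiber_step[OF E(1) lenE _ m btw u u'] by auto
    moreover have "tot (Suc k) u - (\<Sum>D | D \<in> brs B \<and> butlast D = butlast E \<and> u \<in> last D. d D) \<in> G"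
      using tot_sing[OF low uL(1)] uc E by (simp add: in_ch)
    ultimately have "(\<Sum>D | D \<in> brs B \<and> butlast D = butlast E \<and> u \<in> last D \<and> u' \<notin> last D. d D)
        - (\<Sum>D | D \<in> brs B \<and> butlast D = butlast E \<and> u \<in> last D. d D) \<in> G"
      using Gadd by fastforce
    \<comment> \<open>The sign is negative because the partial fibre sum, which omits the brackets
      containing \<open>u'\<close>, is compared with the full one.\<close>
    then have "- above E \<in> G" unfolding ad[symmetric] by simp
    then show ?thesis using Gdiff[OF G0, of "- above E"] by simp
  qed
  show ?thesis
  proof (cases "minel B E")
    case False
    then show ?thesis using above_topdown[OF ab E] ab[OF E] by blast
  next
    \<comment> \<open>A minimal bracket over a singleton is contained in the singleton of any of its
      vertices, hence is a singleton and has value 0.\<close>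
    case True
    obtain v where v: "v \<in> last E" using brs_ex E by blast
    then have vc: "v \<in> ch T w" using brs_butlast(3)[of E v] E by (metis last_sing_br singletonD sing_br_ne)
    then have "sing_br T v \<in> brs B" "butlast (sing_br T v) = butlast E"
      using sing_in butlast_sing_br E by (auto simp: in_ch)
    then have "last E \<subseteq> {v}" using minel_sub[OF True, of "sing_br T v" v] v by simp
    then have "last E = last (sing_br T v)" using v by auto
    then have "E = sing_br T v" using fiber_eq[OF E(1) \<open>sing_br T v \<in> brs B\<close>] \<open>butlast (sing_br T v) = butlast E\<close> by simp
    then have "is_singleton_br T E" using vc by (auto simp: is_sing_iff in_ch)
    then show ?thesis using fl G0 by (simp add: flow_def)
  qed
qed

text \<open>Induction along the lexicographic order of the cardinalities \<open>(|P\<^sup>0|, |P\<^sup>1|, \<dots>)\<close>: by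
  \<open>eprec_differ_fiber\<close>, the velocity difference of two vertices in a common bracket over \<open>P\<close>
  only involves brackets over \<open>P\<close> itself and over smaller brackets.\<close>

lemma G_fiber:
  assumes low: "\<And>Q. Q \<in> brs B \<Longrightarrow> length Q = Suc k \<Longrightarrow> d Q \<in> G"
  shows "P \<in> brs B \<Longrightarrow> length P = Suc k \<Longrightarrow> E \<in> brs B \<Longrightarrow> butlast E = P \<Longrightarrow> d E \<in> G"
proof (induction P arbitrary: E rule: wf_induct[OF wf_inv_image[OF wf_lex[OF wf_less_than]], where f1 = "map card"])
  case (1 P)
  show ?case
  proof (cases "is_singleton_br T P")
    case True
    then obtain w where w: "w \<in> tverts T" "P = sing_br T w" by (auto simp: is_sing_iff)
    show ?thesis
      by (rule G_sing_fiber[of k w, OF low]) (use w 1 in simp_all)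
  next
    case ns: False
    have Pne: "P \<noteq> []" using 1 by auto
    \<comment> \<open>All singleton fibres of this level are settled, so the counting part of
      \<open>fiber_step\<close> is now harmless.\<close>
    have tot_G: "tot (Suc k) x \<in> G" if x: "x \<in> level T (Suc k)" for x
    proof -
      note px = level_Suc_par[OF x]
      have "(\<Sum>D | D \<in> brs B \<and> butlast D = sing_br T (tpar T x) \<and> x \<in> last D. d D) \<in> G"
        by (rule Gsum, rule G_sing_fiber[of k "tpar T x", OF low]) (use px in \<open>auto simp: level_def\<close>)
      from Gadd[OF tot_sing[OF low x] this] show ?thesis by simp
    qed
    have ab: "above E \<in> G" if E: "E \<in> brs B" "butlast E = P" for E
    proof -
      have lenE: "length E = Suc (Suc k)"
        using E(2) 1 brs_ne[OF E(1)] by (metis append_butlast_last_id length_append_singleton)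
      \<comment> \<open>For a nonsingleton \<open>P\<close> the flow equation identifies the full
        fibre sum with \<open>d P\<close>, known from the previous level.\<close>
      have fib: "(\<Sum>D | D \<in> brs B \<and> butlast D = butlast E \<and> u \<in> last D. d D) \<in> G" if u: "u \<in> last E" for u
      proof -
        have "d P = (\<Sum>D | D \<in> brs B \<and> butlast D = P \<and> u \<in> last D. d D)"
          by (rule flow_sum[OF fl 1(2) ns, of "tpar T u"]) (use brs_butlast(3)[OF E(1) _ u] E Pne in simp_all)
        then show ?thesis using low[OF 1(2,3)] E by simp
      qed
      show ?thesis
      proof (cases "minel B E")
        case True
        obtain u where u: "u \<in> last E" using brs_ex E by blast
        have "above E = (\<Sum>D | D \<in> brs B \<and> butlast D = butlast E \<and> u \<in> last D. d D)"
          unfolding above_def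
          by (rule sum.cong) (use u minel_sub[OF True _ _ u] in auto)
        then show ?thesis using fib[OF u] by simp
      next
        case False
        have ne: "butlast E \<noteq> []" using E Pne by simp
        obtain m m' where m: "minel B m" "minel B m'" "butlast m = butlast E" "butlast m' = butlast E"
          "(m, m') \<in> bless B" "last m \<subseteq> last E" "last m' \<subseteq> last E"
          and both: "\<And>D. D \<in> brs B \<Longrightarrow> butlast D = butlast E \<Longrightarrow> last m \<subseteq> last D \<Longrightarrow> last m' \<subseteq> last D \<Longrightarrow> last E \<subseteq> last D"
          and btw: "\<And>m''. minel B m'' \<Longrightarrow> (m, m'') \<in> bless B \<Longrightarrow> (m'', m') \<in> bless B \<Longrightarrow> False"
          using adjacent[OF E(1) ne False] by metis
        have mB: "m \<in> brs B" "m' \<in> brs B" using m by (auto simp: minel_def)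
        obtain u where u: "u \<in> last m" using brs_ex mB by blast
        obtain u' where u': "u' \<in> last m'" using brs_ex mB by blast
        have "d E' \<in> G" if E': "E' \<in> brs B" "length E' = length E"
            "(butlast ^^ i) (butlast E') \<sqsubset>b (butlast ^^ i) (butlast E)" for E' i
        proof -
          have l: "length (butlast E') = Suc k" using E' lenE by simp
          then have "butlast E' \<noteq> []" by (metis list.size(3) nat.distinct(1))
          then have b: "butlast E' \<in> brs B" using brs_butlast E' by blast
          have "(map card (butlast E'), map card P) \<in> lex less_than"
            by (rule trunc_card_lex[OF 1(2)]) (use l 1 E' E in auto)
          then have "(butlast E', P) \<in> inv_image (lex less_than) (map card)" by (simp add: inv_image_def)
          then show ?thesis using 1(1) b l E'(1) by blast
        qed
        then have "(\<Sum>D | D \<in> brs B \<and> butlast D = butlast E \<and> u \<in> last D \<and> u' \<notin> last D. d D)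
          - ((\<Sum>x | x \<in> level T (Suc k) \<and> tless T x u'. tot (Suc k) x)
            - (\<Sum>x | x \<in> level T (Suc k) \<and> tless T x u. tot (Suc k) x)) \<in> G"
          by (rule fiber_step[OF E(1) lenE _ m btw u u'])
        moreover have "(\<Sum>x | x \<in> level T (Suc k) \<and> tless T x u'. tot (Suc k) x)
            - (\<Sum>x | x \<in> level T (Suc k) \<and> tless T x u. tot (Suc k) x) \<in> G"
          by (intro Gdiff Gsum) (use tot_G in auto)
        ultimately have part: "(\<Sum>D | D \<in> brs B \<and> butlast D = butlast E \<and> u \<in> last D \<and> u' \<notin> last D. d D) \<in> G"
          using Gadd by fastforce
        have ad: "(\<Sum>D | D \<in> brs B \<and> butlast D = butlast E \<and> u \<in> last D. d D)
        - (\<Sum>D | D \<in> brs B \<and> butlast D = butlast E \<and> u \<in> last D \<and> u' \<notin> last D. d D) = above E"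
      by (rule above_diff[OF E(1) u u' m(1-4) m(6,7)]) (erule (3) both)
        have uE: "u \<in> last E" using u m by blast
        show ?thesis unfolding ad[symmetric] by (rule Gdiff[OF fib[OF uE] part])
      qed
    qed
    show ?thesis
      by (rule above_topdown[of P, OF ab]) (use 1 ab in simp_all)
  qed
qed

text \<open>Induction on the level; level 0 holds only the root bracket, a singleton with value
  0.\<close>

lemma G_all: "E \<in> brs B \<Longrightarrow> d E \<in> G"
proof -
  have "E \<in> brs B \<Longrightarrow> length E = Suc k \<Longrightarrow> d E \<in> G" for k E
  proof (induction k arbitrary: E)
    case 0
    then have "butlast E = []" by (cases E) auto
    then have "is_singleton_br T E" using brs_butlast_nil 0 root_sing by metis
    then show ?case using fl G0 by (simp add: flow_def)
  next
    case (Suc k)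
    have l: "length (butlast E) = Suc k" using Suc.prems by simp
    then have "butlast E \<noteq> []" by (metis list.size(3) nat.distinct(1))
    then have "butlast E \<in> brs B" using brs_butlast Suc.prems by blast
    show ?case
      by (rule G_fiber[of k "butlast E", OF Suc.IH]) (use \<open>butlast E \<in> brs B\<close> l Suc.prems in simp_all)
  qed
  note level = this
  assume E: "E \<in> brs B"
  then obtain k where "length E = Suc k" using brs_ne by (cases E) auto
  then show "d E \<in> G" using level E by blast
qed

end

section \<open>Decomposition into collisions\<close>

text \<open>\<open>lmin\<close>, \<open>lcoll\<close> and \<open>lcomb\<close> are the length
  functions of \<open>ell_min\<close>, \<open>ell\<close> and \<open>ell_comb\<close> without their
  bracketings, which \<open>supp_br\<close> restores inside a common \<open>B\<close>.\<close>

definition lmin :: "'v plane_tree \<Rightarrow> 'v bracket \<Rightarrow> real" where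
  "lmin T A = (if is_max_br T A \<and> \<not> is_singleton_br T A then 1 else 0)"

definition lcoll :: "'v plane_tree \<Rightarrow> 'v bracketing \<Rightarrow> 'v bracket \<Rightarrow> real" where
  "lcoll T C A = (if A \<in> essential T C then 1 else 0)"

definition lcomb :: "'v plane_tree \<Rightarrow> real \<Rightarrow> (real \<times> 'v bracketing) list \<Rightarrow> 'v bracket \<Rightarrow> real" where
  "lcomb T l0 cs A = l0 * lmin T A + (\<Sum>(t, C) \<leftarrow> cs. t * lcoll T C A)"

context brk
begin

lemma max_nonsing_Suc:
  assumes "Suc k \<le> depth T" "\<not> is_singleton_br T (max_br T k)"
  shows "\<not> is_singleton_br T (max_br T (Suc k))"
  using nonsing_over[OF max_in[OF assms(1)]] assms(2) by (simp add: max_br_Suc)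

lemma max_fiber:
  assumes D: "D \<in> triv T" "butlast D = max_br T k" and ns: "\<not> is_singleton_br T (max_br T k)"
  shows "D = max_br T (Suc k)"
proof -
  have "\<not> is_singleton_br T D" using nonsing_over[OF triv_in[OF D(1)]] D ns by simp
  then obtain j where j: "j \<le> depth T" "D = max_br T j" using triv_max D by blast
  have "length (butlast D) = Suc k" using D by simp
  then show ?thesis using j by simp
qed

lemma max_sum:
  assumes ns: "\<not> is_singleton_br T (max_br T k)" and v: "v \<in> level T (Suc k)"
    and z: "\<And>D. D \<in> brs B \<Longrightarrow> D \<notin> triv T \<Longrightarrow> l D = 0"
  shows "(\<Sum>D | D \<in> brs B \<and> butlast D = max_br T k \<and> v \<in> last D. l D) = l (max_br T (Suc k))"
proof -
  have k: "Suc k \<le> depth T" using level_le_depth v by blast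
  have "(\<Sum>D | D \<in> brs B \<and> butlast D = max_br T k \<and> v \<in> last D. l D) = (\<Sum>D\<in>{max_br T (Suc k)}. l D)"
  proof (rule sum.mono_neutral_right)
    show "finite {D. D \<in> brs B \<and> butlast D = max_br T k \<and> v \<in> last D}" using finite_brs by simp
    show "{max_br T (Suc k)} \<subseteq> {D. D \<in> brs B \<and> butlast D = max_br T k \<and> v \<in> last D}"
      using max_in[OF k] v by (simp add: max_br_Suc)
    show "\<forall>D \<in> {D. D \<in> brs B \<and> butlast D = max_br T k \<and> v \<in> last D} - {max_br T (Suc k)}. l D = 0"
      using z max_fiber[OF _ _ ns] by blast
  qed
  then show ?thesis by simp
qed

lemma lmin_triv: "A \<notin> triv T \<Longrightarrow> lmin T A = 0"
  by (auto simp: lmin_def triv_def is_max_br_def)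

lemma lmin_max: "k \<le> depth T \<Longrightarrow> \<not> is_singleton_br T (max_br T k) \<Longrightarrow> lmin T (max_br T k) = 1"
  by (auto simp: lmin_def is_max_br_def)

lemma lmin_flow: "flow T B (lmin T)"
  unfolding flow_def
proof (intro conjI allI impI ballI)
  fix A assume "A \<notin> brs B"
  then show "lmin T A = 0" using triv_in lmin_triv by blast
next
  fix P u v assume P: "P \<in> brs B" "\<not> is_singleton_br T P" "u \<in> last P" "v \<in> ch T u"
  show "lmin T P = (\<Sum>D | D \<in> brs B \<and> butlast D = P \<and> v \<in> last D. lmin T D)"
  proof (cases "P \<in> triv T")
    case True
    then obtain k where k: "k \<le> depth T" "P = max_br T k" using triv_max P by blast
    then have v: "v \<in> level T (Suc k)" using P level_ch[of u k v] by simp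
    have ns: "\<not> is_singleton_br T (max_br T k)" using P k by simp
    have d: "Suc k \<le> depth T" using level_le_depth v by blast
    show ?thesis unfolding k(2)
      using max_sum[OF ns v, of "lmin T"] lmin_triv lmin_max[OF k(1) ns] lmin_max[OF d max_nonsing_Suc[OF d ns]] by simp
  next
    case False
    have "lmin T D = 0" if "D \<in> brs B" "butlast D = P" for D
      using that False triv_butlast[of D] brs_ne[OF P(1)] lmin_triv[of D] by blast
    then show ?thesis using lmin_triv[OF False] by (simp add: sum.neutral)
  qed
qed (simp add: lmin_def)

lemma lmin_pflow: "pflow T B (\<lambda>A. t * lmin T A)"
  using flow_scale[OF lmin_flow] lmin_triv by (simp add: pflow_def)

lemma lmin_supp: "supp_br T B (\<lambda>A. t * lmin T A) = bmin T"
proof -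
  have "{A \<in> brs B. t * lmin T A \<noteq> 0} \<union> triv T = triv T" using lmin_triv by auto
  then show ?thesis by (simp add: supp_br_def bmin_eq)
qed

text \<open>For \<open>lmin\<close> the velocity of \<open>u\<close> is \<open>1 - lpos T u\<close>,
  as if the level collapsed to a point, so neighbours differ by 1. A coordinate exists only on
  levels with at least two vertices, where the maximum bracket is not a singleton.\<close>

lemma ones_eq: "ones T = Vel T B (lmin T)"
proof (intro ext)
  fix k i
  show "ones T k i = Vel T B (lmin T) k i"
  proof (cases "coord T k i")
    case True
    then have c: "k \<le> depth T" "1 \<le> i" "i \<le> card (level T k)" "1 \<le> i + 1" "i + 1 \<le> card (level T k)"
      by (auto simp: coord_def)
    have ns: "\<not> is_singleton_br T (max_br T k)"
    proof
      assume "is_singleton_br T (max_br T k)"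
      then obtain u where "max_br T k = sing_br T u" by (auto simp: is_sing_iff)
      then have "level T k = {u}" by (metis last_max_br last_sing_br)
      then show False using c by simp
    qed
    have v: "vel T B (lmin T) k u = 1 - real (lpos T u)" if u: "u \<in> level T k" for u
    proof -
      have "vel T B (lmin T) k u = (\<Sum>E\<in>{max_br T k}. lmin T E * gco T B E u)"
        unfolding vel_def
      proof (rule sum.mono_neutral_right)
        show "{max_br T k} \<subseteq> {E. E \<in> brs B \<and> length E = Suc k}" using max_in c by simp
        show "\<forall>E \<in> {E. E \<in> brs B \<and> length E = Suc k} - {max_br T k}. lmin T E * gco T B E u = 0"
          by (auto simp: lmin_def is_max_br_def)
      qed (use finite_brs in simp)
      also have "\<dots> = gco T B (max_br T k) u" using lmin_max[OF c(1) ns] by simp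
      also have "\<dots> = - real (card {x \<in> level T k. tless T x u})"
        using eprec_self[OF max_in[OF c(1)], of u] u by (simp add: gco_def)
      finally show ?thesis using lpos_eq[OF u] by simp
    qed
    show ?thesis using True v lvert[OF c(2,3)] lvert[OF c(4,5)] by (simp add: ones_def Vel_def)
  qed (simp add: ones_def Vel_def)
qed

text \<open>All nontrivial brackets of \<open>C\<close> are essential, so this function is metric on
  \<open>C\<close>, and \<open>tau_met_iff\<close> returns \<open>C\<close> as its support.\<close>

lemma lcoll_props:
  assumes C: "C \<in> collisions_below T B"
  shows "pflow T B (lcoll T C)" "supp_br T B (lcoll T C) = C" "Vel T B (lcoll T C) = rho T C"
proof -
  have cC: "collision T C" and le: "C \<preceq> B" using C by (auto simp: collisions_below_def)
  interpret C: coll T C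
    by (rule coll.intro[OF brkI[OF collision_cut(1)[OF cC]]]) (unfold_locales, rule cC)
  have l: "lcoll T C = (\<lambda>E. if E \<in> essential T C then 1 else 0)" by (auto simp: lcoll_def)
  have z: "lcoll T C A = 0" if "A \<notin> brs C" for A using that C.X_brs by (auto simp: lcoll_def)
  have "flow T C (lcoll T C)" using C.cut_flow[OF C.cutX] unfolding l pflow_def by blast
  moreover have "\<forall>A \<in> brs C. A \<notin> triv T \<longrightarrow> lcoll T C A > 0"
    using collision_cut(3)[OF cC] by (auto simp: lcoll_def)
  ultimately have "metric T (C, lcoll T C)" using C.metric_iff by blast
  then have "(C, lcoll T C) \<in> tau_met T B" using le by (simp add: tau_met_def)
  then show "pflow T B (lcoll T C)" "supp_br T B (lcoll T C) = C" using tau_met_iff by auto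
  show "Vel T B (lcoll T C) = rho T C"
    using Vel_sub[OF C.nb le z] C.rho_eq unfolding l by simp
qed

lemma comb:
  assumes "\<forall>(t, C) \<in> set cs. t \<ge> 0 \<and> C \<in> collisions_below T B"
  shows "pflow T B (lcomb T l0 cs)" "ell_comb T l0 cs = (supp_br T B (lcomb T l0 cs), lcomb T l0 cs)"
    "Vel T B (lcomb T l0 cs) = rho_comb T l0 cs"
proof -
  have "pflow T B (lcomb T l0 cs) \<and> ell_comb T l0 cs = (supp_br T B (lcomb T l0 cs), lcomb T l0 cs) \<and>
    Vel T B (lcomb T l0 cs) = rho_comb T l0 cs"
    using assms
  proof (induction cs)
    case Nil
    have l: "lcomb T l0 [] = (\<lambda>A. l0 * lmin T A)" by (auto simp: lcomb_def)
    have "mscale T l0 (ell_min T) = (bmin T, \<lambda>A. l0 * lmin T A)"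
      by (auto simp: mscale_def mzero_def ell_min_def lmin_def)
    then show ?case unfolding l
      using lmin_pflow[of l0] lmin_supp[of l0] Vel_scale[of T B l0 "lmin T"] ones_eq
      by (simp add: ell_comb_def rho_comb_def)
  next
    case (Cons p cs)
    obtain t C where p: "p = (t, C)" by (cases p)
    have t: "t \<ge> 0" and C: "C \<in> collisions_below T B" using Cons.prems p by auto
    note lc = lcoll_props[OF C]
    have IH: "pflow T B (lcomb T l0 cs)" "ell_comb T l0 cs = (supp_br T B (lcomb T l0 cs), lcomb T l0 cs)"
      "Vel T B (lcomb T l0 cs) = rho_comb T l0 cs" using Cons by auto
    have l: "lcomb T l0 (p # cs) = (\<lambda>A. t * lcoll T C A + lcomb T l0 cs A)"
      by (auto simp: lcomb_def p)
    have pt: "pflow T B (\<lambda>A. t * lcoll T C A)" using pflow_scale[OF lc(1) t] .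
    \<comment> \<open>The factor 0 is separate because \<open>mscale\<close> then replaces the
      bracketing by \<open>bmin T\<close>; any other factor keeps the support.\<close>
    have s: "mscale T t (ell T C) = (supp_br T B (\<lambda>A. t * lcoll T C A), \<lambda>A. t * lcoll T C A)"
    proof (cases "t = 0")
      case True
      then show ?thesis using mzero_eq by (simp add: mscale_def)
    next
      case False
      then show ?thesis using supp_br_scale[OF False, of "lcoll T C"] lc
        by (auto simp: mscale_def ell_def lcoll_def)
    qed
    have "ell_comb T l0 (p # cs) = madd T (mscale T t (ell T C)) (ell_comb T l0 cs)"
      by (simp add: ell_comb_def p)
    also have "\<dots> = (supp_br T B (\<lambda>A. t * lcoll T C A + lcomb T l0 cs A), \<lambda>A. t * lcoll T C A + lcomb T l0 cs A)"
      unfolding s IH(2) by (rule madd_supp[OF pt IH(1)])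
    finally have e: "ell_comb T l0 (p # cs) = (supp_br T B (lcomb T l0 (p # cs)), lcomb T l0 (p # cs))"
      unfolding l .
    have "Vel T B (lcomb T l0 (p # cs)) = rho_comb T l0 (p # cs)"
      unfolding l Vel_add Vel_scale lc(3) IH(3) by (simp add: rho_comb_def p add.left_commute)
    moreover have "pflow T B (lcomb T l0 (p # cs))" unfolding l by (rule pflow_add[OF pt IH(1)])
    ultimately show ?case using e by blast
  qed
  then show "pflow T B (lcomb T l0 cs)" "ell_comb T l0 cs = (supp_br T B (lcomb T l0 cs), lcomb T l0 cs)"
    "Vel T B (lcomb T l0 cs) = rho_comb T l0 cs" by auto
qed

lemma ex_collision_below:
  assumes B': "n_bracketing T B'" "B' \<preceq> B" "B' \<noteq> bmin T"
  obtains C where "collision T C" "C \<preceq> B'"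
proof -
  interpret B': brk T B' using brkI B' by blast
  let ?Q = "\<lambda>C. C \<in> assoc T - {bmin T} \<and> C \<preceq> B'"
  have "?Q B'" using B' ble_refl by (simp add: assoc_def)
  then obtain C where C: "?Q C" and min: "\<And>D. ?Q D \<Longrightarrow> card (brs C) \<le> card (brs D)"
    using ex_has_least_nat[of ?Q B' "\<lambda>C. card (brs C)"] by blast
  have "D = C" if D: "D \<in> assoc T - {bmin T}" "D \<preceq> C" for D
  proof -
    have "?Q D" using D C ble_trans by blast
    then have le: "card (brs C) \<le> card (brs D)" using min by blast
    have sub: "brs D \<subseteq> brs C" using ble_brs D by blast
    have "brs C \<subseteq> brs B'" using ble_brs C by blast
    then have "finite (brs C)" using B'.finite_brs finite_subset by blast
    then have "brs D = brs C" using card_seteq[OF _ sub le] by blast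
    moreover have "C \<preceq> C" using C by (intro ble_refl[of T]) (simp add: assoc_def)
    ultimately show ?thesis using ble_eqI[OF D(2)] by blast
  qed
  then have "collision T C" using C by (simp add: collision_def)
  then show ?thesis using that C by blast
qed

text \<open>Subtract from \<open>l\<close> the largest possible multiple of the indicator of a collision in its support.\<close>

lemma decompose:
  "pflow T B l \<Longrightarrow> \<exists>l0 cs. (\<forall>(t, C) \<in> set cs. t \<ge> 0 \<and> C \<in> collisions_below T B) \<and> l = lcomb T l0 cs"
proof (induction "card {A \<in> brs B. A \<notin> triv T \<and> l A \<noteq> 0}" arbitrary: l rule: less_induct)
  case less
  let ?N = "\<lambda>l. {A \<in> brs B. A \<notin> triv T \<and> l A \<noteq> (0::real)}"
  have f: "flow T B l" and nn: "\<And>A. A \<in> brs B \<Longrightarrow> A \<notin> triv T \<Longrightarrow> l A \<ge> 0"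
    using less.prems by (auto simp: pflow_def)
  have off: "l A = 0" if "A \<notin> brs B \<or> is_singleton_br T A" for A using f that by (auto simp: flow_def)
  show ?case
  proof (cases "?N l = {}")
    case True
    then have z: "l A = 0" if "A \<in> brs B" "A \<notin> triv T" for A using that by blast
    \<comment> \<open>With no nontrivial values, the chain over a nonsingleton maximum bracket
      contributes only the next maximum bracket. So one number, possibly negative, occurs on all of
      these, and \<open>l\<close> is that multiple of \<open>lmin\<close>.\<close>
    have eq: "\<not> is_singleton_br T (max_br T k) \<longrightarrow> l (max_br T k) = l (max_br T (depth T))" if "k \<le> depth T" for k
      using that
    proof (induction rule: inc_induct)
      case (step k)
      show ?case
      proof
        assume ns: "\<not> is_singleton_br T (max_br T k)"
        have k: "Suc k \<le> depth T" using step by simp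
        then obtain v where v: "v \<in> level T (Suc k)" using level_ne by blast
        note pv = level_Suc_par[OF v]
        have "l (max_br T k) = (\<Sum>D | D \<in> brs B \<and> butlast D = max_br T k \<and> v \<in> last D. l D)"
          by (rule flow_sum[OF f, of _ "tpar T v"]) (use max_in[of k] k ns pv in simp_all)
        also have "\<dots> = l (max_br T (Suc k))" by (rule max_sum[OF ns v z])
        finally show "l (max_br T k) = l (max_br T (depth T))"
          using step.IH max_nonsing_Suc[OF k ns] by simp
      qed
    qed simp
    define c where "c = l (max_br T (depth T))"
    have "l A = c * lmin T A" for A
    proof (cases "A \<in> triv T")
      case False
      then show ?thesis using z off lmin_triv by (cases "A \<in> brs B") auto
    next
      case True
      show ?thesis
      proof (cases "is_singleton_br T A")
        case True
        then show ?thesis using off by (simp add: lmin_def)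
      next
        case False
        then obtain k where "k \<le> depth T" "A = max_br T k" using triv_max True by blast
        then show ?thesis using eq False lmin_max by (simp add: c_def)
      qed
    qed
    then have "l = lcomb T c []" by (simp add: lcomb_def fun_eq_iff)
    moreover have "\<forall>(t, C) \<in> set []. t \<ge> 0 \<and> C \<in> collisions_below T B" by simp
    ultimately show ?thesis by blast
  next
    case False
    let ?B = "supp_br T B l"
    note nbB = supp_br_nb[OF less.prems]
    have brsB: "brs ?B = {A \<in> brs B. l A \<noteq> 0} \<union> triv T" by (simp add: supp_br_def)
    have "?B \<noteq> bmin T"
    proof
      assume "?B = bmin T"
      then have "{A \<in> brs B. l A \<noteq> 0} \<union> triv T = triv T" using brsB brs_bmin by simp
      then show False using False by blast
    qed
    then obtain C where C: "collision T C" "C \<preceq> ?B" using ex_collision_below[OF nbB] by blast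
    have CB: "C \<in> collisions_below T B" using C ble_trans nbB by (auto simp: collisions_below_def)
    let ?X = "{A \<in> essential T C. A \<notin> triv T}"
    have XN: "?X \<subseteq> ?N l"
    proof
      fix A assume A: "A \<in> ?X"
      then have "A \<in> brs C" using collision_cut(3)[OF C(1)] by blast
      then have "A \<in> brs ?B" using ble_brs[OF C(2)] by blast
      then show "A \<in> ?N l" using A brsB by blast
    qed
    have finN: "finite (?N l)" using finite_brs by simp
    have finX: "finite (l ` ?X)" using XN finN finite_subset by blast
    have neX: "l ` ?X \<noteq> {}" using collision_cut(4)[OF C(1)] by blast
    \<comment> \<open>The least value on the nontrivial essential brackets: subtracting this
      multiple keeps nontrivial values nonnegative and removes at least one bracket,
      \<open>A0\<close>, from the support.\<close>
    define t where "t = Min (l ` ?X)"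
    obtain A0 where A0: "A0 \<in> ?X" "l A0 = t" using Min_in[OF finX neX] unfolding t_def by fastforce
    have tmin: "t \<le> l A" if "A \<in> ?X" for A using Min_le[OF finX] that unfolding t_def by blast
    have t0: "t \<ge> 0" using A0 XN nn by blast
    let ?l = "\<lambda>A. l A + (- t) * lcoll T C A"
    have "flow T B (lcoll T C)" using lcoll_props(1)[OF CB] by (simp add: pflow_def)
    then have fl: "flow T B ?l" by (intro flow_add f flow_scale)
    have "?l A \<ge> 0" if "A \<in> brs B" "A \<notin> triv T" for A
      using that nn tmin[of A] by (simp add: lcoll_def)
    then have p: "pflow T B ?l" using fl unfolding pflow_def by blast
    have "?N ?l \<subset> ?N l"
    proof
      show "?N ?l \<subseteq> ?N l"
      proof
        fix A assume A: "A \<in> ?N ?l"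
        show "A \<in> ?N l"
        proof (cases "A \<in> essential T C")
          case True
          then show ?thesis using A XN by blast
        next
          case False
          then show ?thesis using A by (simp add: lcoll_def)
        qed
      qed
      have "A0 \<in> ?N l" using A0 XN by blast
      moreover have "A0 \<notin> ?N ?l" using A0 by (simp add: lcoll_def)
      ultimately show "?N ?l \<noteq> ?N l" by blast
    qed
    then have "card (?N ?l) < card (?N l)" using finN by (rule psubset_card_mono[rotated])
    then obtain l0 cs where cs: "\<forall>(t, C) \<in> set cs. t \<ge> 0 \<and> C \<in> collisions_below T B" "?l = lcomb T l0 cs"
      using less.hyps[OF _ p] by blast
    have "l = lcomb T l0 ((t, C) # cs)"
    proof
      fix A
      have "l A + (- t) * lcoll T C A = lcomb T l0 cs A" using cs(2) by metis
      then show "l A = lcomb T l0 ((t, C) # cs) A" by (simp add: lcomb_def)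
    qed
    moreover have "\<forall>(t, C) \<in> set ((t, C) # cs). t \<ge> 0 \<and> C \<in> collisions_below T B"
      using cs(1) t0 CB by simp
    ultimately show ?thesis by blast
  qed
qed

text \<open>\<open>Gamma\<close> admits any ambient bracketing and any decomposition, and
  \<open>decompose\<close> supplies one. Every choice yields \<open>Vel\<close> of \<open>l\<close>
  in some \<open>B1\<close>, which by \<open>Vel_sub\<close> is determined on the support of
  \<open>l\<close>, a common sub-bracketing of \<open>B\<close> and \<open>B1\<close>.\<close>

lemma Gamma_eq:
  assumes l: "pflow T B l"
  shows "Gamma T (supp_br T B l, l) = Vel T B l"
  unfolding Gamma_def
proof (rule the_equality)
  let ?M = "(supp_br T B l, l)"
  have M: "?M \<in> tau_met T B" using tau_met_iff l by blast
  obtain l0 cs where cs: "\<forall>(t, C) \<in> set cs. t \<ge> 0 \<and> C \<in> collisions_below T B" "l = lcomb T l0 cs"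
    using decompose[OF l] by blast
  have "?M = ell_comb T l0 cs" "Vel T B l = rho_comb T l0 cs" using comb[OF cs(1), of l0] cs(2) by auto
  moreover have "B \<in> assoc T" using nb by (simp add: assoc_def)
  ultimately show "\<exists>B1 \<in> assoc T. ?M \<in> tau_met T B1 \<and>
     (\<exists>l0 cs. (\<forall>(t, C) \<in> set cs. t \<ge> 0 \<and> C \<in> collisions_below T B1) \<and>
        ?M = ell_comb T l0 cs \<and> Vel T B l = rho_comb T l0 cs)"
    using M cs(1) by blast
  fix x
  assume "\<exists>B1 \<in> assoc T. ?M \<in> tau_met T B1 \<and>
     (\<exists>l0 cs. (\<forall>(t, C) \<in> set cs. t \<ge> 0 \<and> C \<in> collisions_below T B1) \<and>
        ?M = ell_comb T l0 cs \<and> x = rho_comb T l0 cs)"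
  then obtain B1 l1 cs1 where B1: "B1 \<in> assoc T" "?M \<in> tau_met T B1"
    and cs1: "\<forall>(t, C) \<in> set cs1. t \<ge> 0 \<and> C \<in> collisions_below T B1"
    and e: "?M = ell_comb T l1 cs1" "x = rho_comb T l1 cs1" by blast
  interpret B1: brk T B1 using brkI B1 by (simp add: assoc_def)
  have ll: "l = lcomb T l1 cs1" using e(1) B1.comb(2)[OF cs1, of l1] by simp
  have x: "x = Vel T B1 l" using e(2) B1.comb(3)[OF cs1, of l1] ll by simp
  have le1: "supp_br T B l \<preceq> B1" using B1 by (simp add: tau_met_def)
  have z: "l A = 0" if "A \<notin> brs (supp_br T B l)" for A
    using that l by (auto simp: supp_br_def pflow_def flow_def)
  show "x = Vel T B l"
    using B1.Vel_sub[OF supp_br_nb(1)[OF l] le1 z] Vel_sub[OF supp_br_nb[OF l] z] x by simp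
qed

lemma tau_eq: "tau T B = Vel T B ` {l. pflow T B l}"
proof (intro equalityI subsetI)
  fix x assume "x \<in> tau T B"
  then obtain y c where y: "y \<in> vec_cone (rho T ` collisions_below T B)" and x: "x = (\<lambda>k i. y k i + c * ones T k i)"
    by (auto simp: tau_def)
  obtain tvs where tvs: "\<forall>(t, v) \<in> set tvs. t \<ge> 0 \<and> v \<in> rho T ` collisions_below T B"
    and y': "y = (\<lambda>k i. \<Sum>(t, v) \<leftarrow> tvs. t * v k i)" using y by (auto simp: vec_cone_def)
  have "\<exists>cs. (\<forall>(t, C) \<in> set cs. t \<ge> 0 \<and> C \<in> collisions_below T B) \<and> tvs = map (\<lambda>(t, C). (t, rho T C)) cs"
    using tvs
  proof (induction tvs)
    case (Cons p tvs)
    obtain t v where p: "p = (t, v)" by (cases p)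
    obtain cs where cs: "\<forall>(t, C) \<in> set cs. t \<ge> 0 \<and> C \<in> collisions_below T B" "tvs = map (\<lambda>(t, C). (t, rho T C)) cs"
      using Cons by auto
    obtain C where "C \<in> collisions_below T B" "v = rho T C" "t \<ge> 0" using Cons.prems p by auto
    then show ?case using cs p by (intro exI[of _ "(t, C) # cs"]) simp
  qed simp
  then obtain cs where cs: "\<forall>(t, C) \<in> set cs. t \<ge> 0 \<and> C \<in> collisions_below T B"
    "tvs = map (\<lambda>(t, C). (t, rho T C)) cs" by blast
  have "y = (\<lambda>k i. \<Sum>(t, C) \<leftarrow> cs. t * rho T C k i)"
    unfolding y' cs(2) by (simp add: o_def case_prod_unfold)
  then have "x = rho_comb T c cs" unfolding x rho_comb_def by (simp add: add.commute)
  then show "x \<in> Vel T B ` {l. pflow T B l}" using comb[OF cs(1), of c] by (metis imageI mem_Collect_eq)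
next
  fix x assume "x \<in> Vel T B ` {l. pflow T B l}"
  then obtain l where l: "pflow T B l" "x = Vel T B l" by blast
  obtain l0 cs where cs: "\<forall>(t, C) \<in> set cs. t \<ge> 0 \<and> C \<in> collisions_below T B" "l = lcomb T l0 cs"
    using decompose[OF l(1)] by blast
  let ?tvs = "map (\<lambda>(t, C). (t, rho T C)) cs"
  let ?y = "\<lambda>k i. \<Sum>(t, v) \<leftarrow> ?tvs. t * v k i"
  have x: "x = rho_comb T l0 cs" using l cs comb(3)[OF cs(1), of l0] by simp
  have "\<forall>(t, v) \<in> set ?tvs. t \<ge> 0 \<and> v \<in> rho T ` collisions_below T B" using cs(1) by auto
  then have "?y \<in> vec_cone (rho T ` collisions_below T B)" unfolding vec_cone_def by blast
  moreover have "x = (\<lambda>k i. ?y k i + l0 * ones T k i)"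
    unfolding x rho_comb_def by (simp add: o_def case_prod_unfold add.commute)
  ultimately show "x \<in> tau T B"
    unfolding tau_def by (intro CollectI exI[of _ ?y] exI[of _ l0] conjI)
qed

lemma Vel_0: "Vel T B (\<lambda>A. 0) = (\<lambda>k i. 0)"
  using Vel_scale[of T B 0 "\<lambda>A. 0"] by simp

lemma Vel_Ints:
  assumes "\<And>A. l A \<in> \<int>"
  shows "Vel T B l k i \<in> \<int>"
proof -
  have "vel T B l k u \<in> \<int>" for u
    unfolding vel_def gco_def by (intro Ints_sum Ints_mult assms) auto
  then show ?thesis by (auto simp: Vel_def)
qed

lemma Vel_Ints_rev:
  assumes l: "pflow T B l" and i: "\<And>k i. Vel T B l k i \<in> \<int>"
  shows "l A \<in> \<int>"
proof -
  interpret R: recover T B "\<int>" l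
    by unfold_locales (use l i in \<open>auto simp: pflow_def\<close>)
  show ?thesis using R.G_all[of A] l by (cases "A \<in> brs B") (auto simp: pflow_def flow_def)
qed

lemma Vel_inj:
  assumes l: "pflow T B l" "pflow T B l'" and eq: "Vel T B l = Vel T B l'"
  shows "l = l'"
proof -
  have f: "flow T B (\<lambda>A. l A + (- 1) * l' A)"
    using l unfolding pflow_def by (intro flow_add flow_scale) blast+
  have v: "Vel T B (\<lambda>A. l A + (- 1) * l' A) k i = 0" for k i
    unfolding Vel_add Vel_scale eq by simp
  interpret R: recover T B "{0}" "\<lambda>A. l A + (- 1) * l' A"
    by unfold_locales (use f v in auto)
  have "l A = l' A" for A
    using R.G_all[of A] l by (cases "A \<in> brs B") (auto simp: pflow_def flow_def)
  then show ?thesis by blast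
qed

section \<open>The two monoids and their isomorphism\<close>

abbreviation "emb l \<equiv> (supp_br T B l, l)"

lemma int_carrier: "carrier (int_metric_monoid T B) = emb ` {l. pflow T B l \<and> (\<forall>A. l A \<in> \<int>)}"
proof -
  have "M \<in> tau_met T B \<longleftrightarrow> (\<exists>l. pflow T B l \<and> M = emb l)" for M
    by (cases M) (auto simp: tau_met_iff)
  then show ?thesis by (auto simp: int_metric_monoid_def)
qed

lemma cone_carrier: "carrier (int_cone_monoid T B) = Vel T B ` {l. pflow T B l \<and> (\<forall>A. l A \<in> \<int>)}"
  unfolding int_cone_monoid_def using tau_eq Vel_Ints Vel_Ints_rev by auto

text \<open>Through \<open>emb\<close> the sum of metric bracketings becomes pointwise addition of
  flows, so associativity of the joins is inherited from addition.\<close>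

lemma int_metric_monoid: "monoid (int_metric_monoid T B)"
proof (rule monoidI)
  fix x y assume "x \<in> carrier (int_metric_monoid T B)" "y \<in> carrier (int_metric_monoid T B)"
  then show "x \<otimes>\<^bsub>int_metric_monoid T B\<^esub> y \<in> carrier (int_metric_monoid T B)"
    unfolding int_carrier by (auto simp: int_metric_monoid_def madd_supp intro!: pflow_add)
next
  show "\<one>\<^bsub>int_metric_monoid T B\<^esub> \<in> carrier (int_metric_monoid T B)"
    unfolding int_carrier using pflow_0 by (auto simp: int_metric_monoid_def mzero_eq)
next
  fix x y z assume "x \<in> carrier (int_metric_monoid T B)" "y \<in> carrier (int_metric_monoid T B)"
    "z \<in> carrier (int_metric_monoid T B)"
  then show "x \<otimes>\<^bsub>int_metric_monoid T B\<^esub> y \<otimes>\<^bsub>int_metric_monoid T B\<^esub> z =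
      x \<otimes>\<^bsub>int_metric_monoid T B\<^esub> (y \<otimes>\<^bsub>int_metric_monoid T B\<^esub> z)"
    unfolding int_carrier by (auto simp: int_metric_monoid_def madd_supp pflow_add add.assoc)
next
  fix x assume "x \<in> carrier (int_metric_monoid T B)"
  then show "\<one>\<^bsub>int_metric_monoid T B\<^esub> \<otimes>\<^bsub>int_metric_monoid T B\<^esub> x = x"
    "x \<otimes>\<^bsub>int_metric_monoid T B\<^esub> \<one>\<^bsub>int_metric_monoid T B\<^esub> = x"
    unfolding int_carrier by (auto simp: int_metric_monoid_def mzero_eq madd_supp pflow_0)
qed

lemma int_cone_monoid: "monoid (int_cone_monoid T B)"
proof (rule monoidI)
  fix x y assume "x \<in> carrier (int_cone_monoid T B)" "y \<in> carrier (int_cone_monoid T B)"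
  then obtain l l' where l: "pflow T B l" "\<And>A. l A \<in> \<int>" "pflow T B l'" "\<And>A. l' A \<in> \<int>"
    "x = Vel T B l" "y = Vel T B l'" unfolding cone_carrier by auto
  have "x \<otimes>\<^bsub>int_cone_monoid T B\<^esub> y = Vel T B (\<lambda>A. l A + l' A)"
    by (simp add: int_cone_monoid_def Vel_add l)
  then show "x \<otimes>\<^bsub>int_cone_monoid T B\<^esub> y \<in> carrier (int_cone_monoid T B)"
    unfolding cone_carrier using l pflow_add by (auto intro!: imageI)
next
  have "\<one>\<^bsub>int_cone_monoid T B\<^esub> = Vel T B (\<lambda>A. 0)" by (simp add: int_cone_monoid_def Vel_0)
  then show "\<one>\<^bsub>int_cone_monoid T B\<^esub> \<in> carrier (int_cone_monoid T B)"
    unfolding cone_carrier using pflow_0 by (auto intro!: imageI)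
qed (auto simp: int_cone_monoid_def add.assoc)

lemma Gamma_iso: "Gamma T \<in> iso (int_metric_monoid T B) (int_cone_monoid T B)"
proof (rule isoI)
  show "Gamma T \<in> hom (int_metric_monoid T B) (int_cone_monoid T B)"
  proof (rule homI)
    fix x assume "x \<in> carrier (int_metric_monoid T B)"
    then show "Gamma T x \<in> carrier (int_cone_monoid T B)"
      unfolding int_carrier cone_carrier by (auto simp: Gamma_eq)
  next
    fix x y assume "x \<in> carrier (int_metric_monoid T B)" "y \<in> carrier (int_metric_monoid T B)"
    then obtain l l' where l: "pflow T B l" "pflow T B l'" "x = emb l" "y = emb l'"
      unfolding int_carrier by auto
    have "x \<otimes>\<^bsub>int_metric_monoid T B\<^esub> y = emb (\<lambda>A. l A + l' A)"
      by (simp add: int_metric_monoid_def l madd_supp)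
    then show "Gamma T (x \<otimes>\<^bsub>int_metric_monoid T B\<^esub> y) = Gamma T x \<otimes>\<^bsub>int_cone_monoid T B\<^esub> Gamma T y"
      by (simp add: Gamma_eq l pflow_add Vel_add int_cone_monoid_def)
  qed
  show "bij_betw (Gamma T) (carrier (int_metric_monoid T B)) (carrier (int_cone_monoid T B))"
    unfolding bij_betw_def
  proof
    show "inj_on (Gamma T) (carrier (int_metric_monoid T B))"
    proof (rule inj_onI)
      fix x y assume "x \<in> carrier (int_metric_monoid T B)" "y \<in> carrier (int_metric_monoid T B)"
        and e: "Gamma T x = Gamma T y"
      then obtain l l' where l: "pflow T B l" "pflow T B l'" "x = emb l" "y = emb l'"
        unfolding int_carrier by auto
      then have "l = l'" using e Vel_inj by (simp add: Gamma_eq)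
      then show "x = y" using l by simp
    qed
    show "Gamma T ` carrier (int_metric_monoid T B) = carrier (int_cone_monoid T B)"
      unfolding int_carrier cone_carrier image_image by (intro image_cong) (auto simp: Gamma_eq)
  qed
qed

end

theorem corollary5p40:
  fixes T :: "'v plane_tree" and B :: "'v bracketing"
  assumes "rooted_plane_tree T" and "depth T \<ge> 1" and "\<not> is_path T"
    and "B \<in> assoc T"
  shows "monoid (int_metric_monoid T B) \<and> monoid (int_cone_monoid T B) \<and>
    Gamma T \<in> iso (int_metric_monoid T B) (int_cone_monoid T B) \<and>
    Gamma T \<one>\<^bsub>int_metric_monoid T B\<^esub> = \<one>\<^bsub>int_cone_monoid T B\<^esub>"
proof -
  interpret brk T B
    by unfold_locales (use assms in \<open>auto simp: assoc_def\<close>)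
  have "Gamma T \<one>\<^bsub>int_metric_monoid T B\<^esub> = \<one>\<^bsub>int_cone_monoid T B\<^esub>"
    using Gamma_eq[OF pflow_0] by (simp add: int_metric_monoid_def int_cone_monoid_def mzero_eq Vel_0)
  then show ?thesis using int_metric_monoid int_cone_monoid Gamma_iso by blast
qed

end
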